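(* Let $1\le p\le\infty$ and let $\lambda=(R,B)$ be a frequency of integer type, with basis $B=(b_j)$ of length $N\in\mathbb{N}\cup\{\infty\}$ and Bohr matrix $R$ consisting of integers. Then there is a unique onto isometry $$\psi\colon \mathcal{H}_p(\lambda)\to H_p^R(\mathbb{T}^N),\qquad D\mapsto F,$$ such that $\widehat F(\alpha)=a_n(D)$ for all multi indices $\alpha\in R$ and $n$ with $\lambda_n=\sum_j\alpha_jb_j$.
   Context: A frequency is a strictly increasing sequence $\lambda=(\lambda_n)_{n\ge1}$ of non-negative real numbers tending to $\infty$. A $\lambda$-Dirichlet series is a formal sum $D=\sum a_n e^{-\lambda_n s}$ with complex coefficients $a_n=a_n(D)$. A sequence $B=(b_j)_{j=1}^N$ of real numbers, of length $N\in\mathbb{N}\cup\{\infty\}$, is a basis for $\lambda$ if it is $\mathbb{Q}$-linearly independent and each $\lambda_n$ can be written as a finite sum $\lambda_n=\sum_k r^n_kb_k$ with rational coefficients (only finitely many $r_k^n\neq0$ for each $n$). The matrix $R=(r^n_k)_{n,k}$ is then the Bohr matrix of $\lambda$ with respect to $B$, and one writes $\lambda=(R,B)$. The rows of $R$ are finitely supported sequences of length $N$; $\alpha\in R$ means that $\alpha$ is a row of $R$. $\lambda$ is of integer type if there is a basis $B$ for $\lambda$ such that the entries of $R$ are all integers; $\lambda=(R,B)$ of integer type refers to such a decomposition. $\mathbb{T}^N$ is the (possibly countably infinite) product of $\mathbb{T}=\{w\in\mathbb{C}:|w|=1\}$ with normalized Haar measure; its characters are $z\mapsto z^\alpha$ with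 $\alpha\in\bigoplus_{j=1}^N\mathbb{Z}$, and $\widehat F(\alpha)=\int_{\mathbb{T}^N}F(w)w^{-\alpha}dw$. $H_p^R(\mathbb{T}^N)$ is the closed subspace of all $F\in L_p(\mathbb{T}^N)$ such that $\widehat F(\alpha)\neq0$ implies $\alpha\in R$. A Dirichlet group is a pair $(G,\beta)$ of a compact abelian group $G$ and a continuous homomorphism $\beta\colon\mathbb{R}\to G$ with dense range. It is a $\lambda$-Dirichlet group if for every $n$ there is a (necessarily unique) character $h_{\lambda_n}\in\widehat{G}$ with $h_{\lambda_n}(\beta(t))=e^{-i\lambda_n t}$ for all $t$. $H_p^\lambda(G)$ is the space of all $f\in L_p(G)$ (Haar measure $m$) whose Fourier coefficients $\widehat f(\gamma)=\int_Gf\overline\gamma\,dm$ vanish unless $\gamma=h_{\lambda_n}$ for some $n$. $\mathcal{H}_p(\lambda)$ is the space of all $\lambda$-Dirichlet series $D=\sum a_ne^{-\lambda_ns}$ for which there is $f\in H_p^\lambda(G)$ with $\widehat f(h_{\lambda_n})=a_n$ for all $n$, with norm $\|D\|_p=\|f\|_p$; it does not depend on the choice of the $\lambda$-Dirichlet group. *)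

theory Defs
  imports "HOL-Probability.Probability"
begin

section \<open>The spaces \<open>L\<^sub>p\<close> as spaces of almost-everywhere classes\<close>

definition mem_Lp :: "ennreal \<Rightarrow> 'a measure \<Rightarrow> ('a \<Rightarrow> complex) \<Rightarrow> bool" where
  "mem_Lp p M f \<longleftrightarrow> f \<in> borel_measurable M \<and>
     (if p = \<infinity> then esssup M (\<lambda>x. ennreal (norm (f x))) < \<infinity>
      else integrable M (\<lambda>x. norm (f x) powr enn2real p))"

definition fun_Lp_norm :: "ennreal \<Rightarrow> 'a measure \<Rightarrow> ('a \<Rightarrow> complex) \<Rightarrow> real" where
  "fun_Lp_norm p M f =
     (if p = \<infinity> then enn2real (esssup M (\<lambda>x. ennreal (norm (f x))))
      else (\<integral>x. norm (f x) powr enn2real p \<partial>M) powr (1 / enn2real p))"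

definition ae_class :: "'a measure \<Rightarrow> ('a \<Rightarrow> complex) \<Rightarrow> ('a \<Rightarrow> complex) set" where
  "ae_class M f = {g \<in> borel_measurable M. AE x in M. g x = f x}"

definition Lp :: "ennreal \<Rightarrow> 'a measure \<Rightarrow> ('a \<Rightarrow> complex) set set" where
  "Lp p M = ae_class M ` {f. mem_Lp p M f}"

text \<open>An arbitrary representative of a class. Everything defined through \<open>rep\<close> below does not
  depend on the choice of the representative.\<close>

definition rep :: "('a \<Rightarrow> complex) set \<Rightarrow> 'a \<Rightarrow> complex" where
  "rep F = (SOME f. f \<in> F)"

definition Lp_norm :: "ennreal \<Rightarrow> 'a measure \<Rightarrow> ('a \<Rightarrow> complex) set \<Rightarrow> real" where
  "Lp_norm p M F = fun_Lp_norm p M (rep F)"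

definition Lp_add ::
  "'a measure \<Rightarrow> ('a \<Rightarrow> complex) set \<Rightarrow> ('a \<Rightarrow> complex) set \<Rightarrow> ('a \<Rightarrow> complex) set" where
  "Lp_add M F G = ae_class M (\<lambda>x. rep F x + rep G x)"

definition Lp_scale ::
  "'a measure \<Rightarrow> complex \<Rightarrow> ('a \<Rightarrow> complex) set \<Rightarrow> ('a \<Rightarrow> complex) set" where
  "Lp_scale M c F = ae_class M (\<lambda>x. c * rep F x)"


section \<open>Frequencies, bases and Bohr matrices\<close>

text \<open>Sequences are indexed from \<open>0\<close>: \<open>lam n\<close> stands for the usual \<open>\<lambda>\<^bsub>n+1\<^esub>\<close>, and a sequence
  of length \<open>N\<close> has the indices \<open>j\<close> with \<open>enat j < N\<close>.\<close>

definition frequency :: "(nat \<Rightarrow> real) \<Rightarrow> bool" where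
  "frequency lam \<longleftrightarrow> strict_mono lam \<and> (\<forall>n. 0 \<le> lam n) \<and> filterlim lam at_top sequentially"

definition indices :: "enat \<Rightarrow> nat set" where
  "indices N = {j. enat j < N}"

text \<open>The rows of \<open>R\<close> are extended by zero beyond the length \<open>N\<close>.\<close>

definition bohr_matrix :: "enat \<Rightarrow> (nat \<Rightarrow> real) \<Rightarrow> (nat \<Rightarrow> real) \<Rightarrow> (nat \<Rightarrow> nat \<Rightarrow> rat) \<Rightarrow> bool" where
  "bohr_matrix N b lam R \<longleftrightarrow>
     (\<forall>n. finite {j. R n j \<noteq> 0} \<and> {j. R n j \<noteq> 0} \<subseteq> indices N \<and>
          lam n = (\<Sum>j | R n j \<noteq> 0. of_rat (R n j) * b j))"

definition frequency_basis :: "enat \<Rightarrow> (nat \<Rightarrow> real) \<Rightarrow> (nat \<Rightarrow> real) \<Rightarrow> bool" where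
  "frequency_basis N b lam \<longleftrightarrow>
     inj_on b (indices N) \<and>
     module.independent (\<lambda>q x. of_rat q * x) (b ` indices N) \<and>
     (\<exists>R. bohr_matrix N b lam R)"

definition integer_type_decomposition ::
  "enat \<Rightarrow> (nat \<Rightarrow> real) \<Rightarrow> (nat \<Rightarrow> real) \<Rightarrow> (nat \<Rightarrow> nat \<Rightarrow> rat) \<Rightarrow> bool" where
  "integer_type_decomposition N b lam R \<longleftrightarrow>
     frequency_basis N b lam \<and> bohr_matrix N b lam R \<and> (\<forall>n j. R n j \<in> \<int>)"

definition bohr_rows :: "(nat \<Rightarrow> nat \<Rightarrow> rat) \<Rightarrow> (nat \<Rightarrow> int) set" where
  "bohr_rows R = {\<alpha>. \<exists>n. \<forall>j. R n j = of_int (\<alpha> j)}"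


section \<open>The torus \<open>\<T>\<^sup>N\<close> and its Hardy spaces\<close>

text \<open>The normalized Haar measure of the circle is the image of the normalized Lebesgue measure
  of \<open>[0, 2\<pi>]\<close> under \<open>t \<mapsto> e\<^sup>i\<^sup>t\<close>, and that of \<open>\<T>\<^sup>N\<close> is the product of copies of it.\<close>

definition circle_measure :: "complex measure" where
  "circle_measure =
     distr (uniform_measure lborel {0..2 * pi}) (restrict_space borel (sphere 0 1)) cis"

definition torus_measure :: "enat \<Rightarrow> (nat \<Rightarrow> complex) measure" where
  "torus_measure N = PiM (indices N) (\<lambda>_. circle_measure)"

definition multi_indices :: "enat \<Rightarrow> (nat \<Rightarrow> int) set" where
  "multi_indices N = {\<alpha>. finite {j. \<alpha> j \<noteq> 0} \<and> {j. \<alpha> j \<noteq> 0} \<subseteq> indices N}"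

definition monomial :: "(nat \<Rightarrow> int) \<Rightarrow> (nat \<Rightarrow> complex) \<Rightarrow> complex" where
  "monomial \<alpha> w = (\<Prod>j | \<alpha> j \<noteq> 0. w j powi \<alpha> j)"

definition torus_coeff ::
  "enat \<Rightarrow> ((nat \<Rightarrow> complex) \<Rightarrow> complex) set \<Rightarrow> (nat \<Rightarrow> int) \<Rightarrow> complex" where
  "torus_coeff N F \<alpha> = (\<integral>w. rep F w * monomial (\<lambda>j. - \<alpha> j) w \<partial>torus_measure N)"

definition torus_Hardy ::
  "ennreal \<Rightarrow> enat \<Rightarrow> (nat \<Rightarrow> nat \<Rightarrow> rat) \<Rightarrow> ((nat \<Rightarrow> complex) \<Rightarrow> complex) set set" where
  "torus_Hardy p N R =
     {F \<in> Lp p (torus_measure N). \<forall>\<alpha> \<in> multi_indices N. torus_coeff N F \<alpha> \<noteq> 0 \<longrightarrow> \<alpha> \<in> bohr_rows R}"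


section \<open>Dirichlet groups\<close>

text \<open>Compact abelian groups are written additively; compact groups are assumed Hausdorff.\<close>

definition normalized_haar :: "'g::{topological_ab_group_add, t2_space} measure \<Rightarrow> bool" where
  "normalized_haar m \<longleftrightarrow>
     sets m = sets borel \<and> prob_space m \<and>
     (\<forall>a. distr m m (\<lambda>x. a + x) = m) \<and>
     (\<forall>A \<in> sets m. emeasure m A = (SUP K \<in> {K. compact K \<and> K \<subseteq> A}. emeasure m K))"

definition group_character :: "('g::{topological_ab_group_add, t2_space} \<Rightarrow> complex) \<Rightarrow> bool" where
  "group_character \<gamma> \<longleftrightarrow>
     continuous_on UNIV \<gamma> \<and> (\<forall>x. norm (\<gamma> x) = 1) \<and> (\<forall>x y. \<gamma> (x + y) = \<gamma> x * \<gamma> y)"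

definition dirichlet_group :: "(real \<Rightarrow> 'g::{topological_ab_group_add, t2_space}) \<Rightarrow> bool" where
  "dirichlet_group \<beta> \<longleftrightarrow>
     compact (UNIV :: 'g set) \<and> continuous_on UNIV \<beta> \<and> (\<forall>s t. \<beta> (s + t) = \<beta> s + \<beta> t) \<and>
     closure (range \<beta>) = UNIV"

definition extends_exp ::
  "(real \<Rightarrow> 'g::{topological_ab_group_add, t2_space}) \<Rightarrow> real \<Rightarrow> ('g \<Rightarrow> complex) \<Rightarrow> bool" where
  "extends_exp \<beta> x h \<longleftrightarrow> group_character h \<and> (\<forall>t. h (\<beta> t) = exp (- \<i> * of_real x * of_real t))"

definition lambda_dirichlet_group ::
  "(nat \<Rightarrow> real) \<Rightarrow> (real \<Rightarrow> 'g::{topological_ab_group_add, t2_space}) \<Rightarrow> bool" where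
  "lambda_dirichlet_group lam \<beta> \<longleftrightarrow> dirichlet_group \<beta> \<and> (\<forall>n. \<exists>h. extends_exp \<beta> (lam n) h)"

text \<open>The character \<open>h\<^sub>x\<close>; it is unique because \<open>\<beta>\<close> has dense range.\<close>

definition exp_char ::
  "(real \<Rightarrow> 'g::{topological_ab_group_add, t2_space}) \<Rightarrow> real \<Rightarrow> 'g \<Rightarrow> complex" where
  "exp_char \<beta> x = (THE h. extends_exp \<beta> x h)"

definition group_coeff :: "'g measure \<Rightarrow> ('g \<Rightarrow> complex) set \<Rightarrow> ('g \<Rightarrow> complex) \<Rightarrow> complex" where
  "group_coeff m f \<gamma> = (\<integral>x. rep f x * cnj (\<gamma> x) \<partial>m)"

definition group_Hardy ::
  "ennreal \<Rightarrow> (nat \<Rightarrow> real) \<Rightarrow> (real \<Rightarrow> 'g::{topological_ab_group_add, t2_space}) \<Rightarrow> 'g measure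
     \<Rightarrow> ('g \<Rightarrow> complex) set set" where
  "group_Hardy p lam \<beta> m =
     {f \<in> Lp p m. \<forall>\<gamma>. group_character \<gamma> \<and> group_coeff m f \<gamma> \<noteq> 0 \<longrightarrow> (\<exists>n. \<gamma> = exp_char \<beta> (lam n))}"


section \<open>Hardy spaces of Dirichlet series\<close>

text \<open>For a fixed frequency, a formal general Dirichlet series is identified with its sequence of
  coefficients.\<close>

type_synonym dirichlet_series = "nat \<Rightarrow> complex"

definition has_group_function ::
  "(nat \<Rightarrow> real) \<Rightarrow> (real \<Rightarrow> 'g::{topological_ab_group_add, t2_space}) \<Rightarrow> 'g measure
     \<Rightarrow> dirichlet_series \<Rightarrow> ('g \<Rightarrow> complex) set \<Rightarrow> bool" where
  "has_group_function lam \<beta> m D f \<longleftrightarrow> (\<forall>n. group_coeff m f (exp_char \<beta> (lam n)) = D n)"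

definition series_Hardy ::
  "ennreal \<Rightarrow> (nat \<Rightarrow> real) \<Rightarrow> (real \<Rightarrow> 'g::{topological_ab_group_add, t2_space}) \<Rightarrow> 'g measure
     \<Rightarrow> dirichlet_series set" where
  "series_Hardy p lam \<beta> m = {D. \<exists>f \<in> group_Hardy p lam \<beta> m. has_group_function lam \<beta> m D f}"

definition series_norm ::
  "ennreal \<Rightarrow> (nat \<Rightarrow> real) \<Rightarrow> (real \<Rightarrow> 'g::{topological_ab_group_add, t2_space}) \<Rightarrow> 'g measure
     \<Rightarrow> dirichlet_series \<Rightarrow> real" where
  "series_norm p lam \<beta> m D =
     Lp_norm p m (THE f. f \<in> group_Hardy p lam \<beta> m \<and> has_group_function lam \<beta> m D f)"

text \<open>Linear isometries from a normed space of Dirichlet series onto a subspace of \<open>L\<^sub>p(M)\<close>.\<close>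

definition onto_isometry ::
  "dirichlet_series set \<Rightarrow> (dirichlet_series \<Rightarrow> real) \<Rightarrow> ennreal \<Rightarrow> 'a measure
     \<Rightarrow> ('a \<Rightarrow> complex) set set \<Rightarrow> (dirichlet_series \<Rightarrow> ('a \<Rightarrow> complex) set) \<Rightarrow> bool" where
  "onto_isometry H nrm p M K \<psi> \<longleftrightarrow>
     bij_betw \<psi> H K \<and>
     (\<forall>D \<in> H. \<forall>E \<in> H. \<psi> (\<lambda>n. D n + E n) = Lp_add M (\<psi> D) (\<psi> E)) \<and>
     (\<forall>c. \<forall>D \<in> H. \<psi> (\<lambda>n. c * D n) = Lp_scale M c (\<psi> D)) \<and>
     (\<forall>D \<in> H. Lp_norm p M (\<psi> D) = nrm D)"

end

theory Submission
  imports Defs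
begin

text \<open>
  Each of the two Hardy spaces consists of functions of a sequence of unimodular random variables, and
  the two sequences have the same joint distribution. On the group the random variables are the
  characters \<open>h\<^sub>n\<close> that extend \<open>t \<mapsto> exp (-i \<lambda>\<^sub>n t)\<close>; on the torus they are the monomials
  \<open>w \<mapsto> w\<^sup>\<alpha>\<close> with \<open>\<alpha> = \<alpha>\<^sub>n\<close> the \<open>n\<close>-th row of the Bohr matrix.

  A finite product of integer powers of the \<open>h\<^sub>n\<close>, with exponents \<open>k\<^sub>n\<close>, is the constant \<open>1\<close> iff
  \<open>\<Sum> k\<^sub>n \<lambda>\<^sub>n = 0\<close>. The basis is linearly independent over the rationals, so this happens iff
  \<open>\<Sum> k\<^sub>n \<alpha>\<^sub>n = 0\<close>, that is, iff the same product of the monomials is \<open>1\<close> (\<open>same_relations\<close>).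
  A nontrivial character has integral \<open>0\<close>; hence the two sequences have the same mixed moments. A
  measure on the infinite torus is determined by its moments (\<open>torus_moments_determine_measure\<close>), so
  they have a common joint distribution \<open>\<mu>\<close> (\<open>distr_torus_map_eq\<close>).

  An integrable function \<open>f\<close> whose spectrum lies among the products of the \<open>h\<^sub>n\<close> is almost everywhere
  of the form \<open>g \<circ> \<Phi>\<close>, where \<open>\<Phi>\<close> is the map with the coordinates \<open>h\<^sub>n\<close> (\<open>factorization\<close>): take for
  \<open>g\<close> the Radon-Nikodym derivative with respect to \<open>\<mu>\<close> of the image under \<open>\<Phi>\<close> of the complex measure
  with density \<open>f\<close>, and compare Fourier coefficients. Replacing \<open>\<Phi>\<close> by the corresponding map
  of the torus keeps the distribution of \<open>g\<close>, therefore the \<open>L\<^sub>p\<close> norm, the Fourier coefficients and the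
  shape of the spectrum (\<open>spectral_Hardy_transfer\<close>). The argument is symmetric in the two sides and is
  carried out for abstract systems of characters. Linearity, bijectivity and uniqueness then
  follow because an element of either Hardy space is determined by its Fourier coefficients.

  This last fact is elementary on the torus. On the group it amounts to the theorem of Peter and Weyl
  that the characters of a compact abelian group separate points (\<open>characters_separate_points\<close>). The
  dense one-parameter subgroup gives a short proof: for a continuous \<open>f\<close>, the averages of the
  translates of \<open>f\<close> along long and fine finite progressions in the subgroup, twisted by a discrete
  frequency, are nearly eigenvectors of these translations, and the discrete Parseval identity shows
  that for some frequency they stay away from zero (\<open>dft_lower_bound_on_progressions\<close>). A pointwise
  cluster point of them is a multiple of a character.
\<close>

section \<open>The discrete Fourier transform\<close>

definition dft :: "nat \<Rightarrow> (nat \<Rightarrow> complex) \<Rightarrow> nat \<Rightarrow> complex" where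
  "dft n u k = (\<Sum>j<n. u j * cis (- (2 * pi * real j * real k / real n))) / of_nat n"

lemma sum_cis_orthogonal:
  assumes "j < n" "l < n"
  shows "(\<Sum>k<n. cis (2 * pi * (real l - real j) * real k / real n)) = (if j = l then of_nat n else 0)"
proof (cases "j = l")
  case False
  define z where "z = cis (2 * pi * (real l - real j) / real n)"
  have n: "n > 0" using assms by auto
  have pow: "cis (2 * pi * (real l - real j) * real k / real n) = z ^ k" for k
    unfolding z_def Complex.DeMoivre by (rule arg_cong[where f = cis]) (simp add: field_simps)
  have zn: "z ^ n = 1"
  proof -
    have "z ^ n = cis (2 * pi * of_int (int l - int j))"
      using n unfolding z_def Complex.DeMoivre by (intro arg_cong[where f = cis]) (simp add: field_simps)
    then show ?thesis using cis_multiple_2pi[of "of_int (int l - int j)"] by (simp only: Ints_of_int simp_thms)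
  qed
  have "z \<noteq> 1"
  proof
    assume "z = 1"
    then have "cos (2 * pi * (real l - real j) / real n) = 1" by (simp add: z_def complex_eq_iff)
    then obtain m :: int where "2 * pi * (real l - real j) / real n = of_int m * 2 * pi"
      unfolding cos_one_2pi_int by auto
    then have "(2 * pi) * (real l - real j) = (2 * pi) * (of_int m * real n)" using n by (simp add: field_simps)
    then have "real l - real j = of_int m * real n" by (simp only: mult_cancel_left) simp
    then have "real_of_int (int l - int j) = real_of_int (m * int n)" by simp
    then have "int l - int j = m * int n" by (rule of_int_eq_iff[THEN iffD1])
    moreover have "\<bar>int l - int j\<bar> < int n" using assms by auto
    moreover have "\<bar>m * int n\<bar> \<ge> int n" if "m \<noteq> 0"
    proof -
      have "int n * 1 \<le> int n * \<bar>m\<bar>" using that by (intro mult_left_mono) auto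
      then show ?thesis by (simp add: abs_mult mult.commute)
    qed
    ultimately show False using False by (cases "m = 0") auto
  qed
  then show ?thesis using False zn by (simp add: pow sum_gp_strict)
qed auto

lemma dft_parseval:
  assumes n: "n > 0"
  shows "(\<Sum>k<n. (norm (dft n u k))\<^sup>2) = (\<Sum>j<n. (norm (u j))\<^sup>2) / real n"
proof -
  have sq: "dft n u k * cnj (dft n u k) =
      (\<Sum>j<n. \<Sum>l<n. u j * cnj (u l) * cis (2 * pi * (real l - real j) * real k / real n)) / (of_nat n)\<^sup>2" for k
  proof -
    have "cis (2 * pi * (real l - real j) * real k / real n)
        = cis (- (2 * pi * real j * real k / real n)) * cnj (cis (- (2 * pi * real l * real k / real n)))" for j l
      by (simp add: cis_cnj cis_mult diff_divide_distrib algebra_simps)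
    then show ?thesis
      unfolding dft_def by (simp add: sum_product power2_eq_square mult_ac)
  qed
  have "complex_of_real (\<Sum>k<n. (norm (dft n u k))\<^sup>2) = (\<Sum>k<n. dft n u k * cnj (dft n u k))"
    by (simp add: complex_norm_square[symmetric])
  also have "\<dots> = (\<Sum>k<n. \<Sum>j<n. \<Sum>l<n. u j * cnj (u l) * cis (2 * pi * (real l - real j) * real k / real n)) / (of_nat n)\<^sup>2"
    by (simp add: sq sum_divide_distrib)
  also have "(\<Sum>k<n. \<Sum>j<n. \<Sum>l<n. u j * cnj (u l) * cis (2 * pi * (real l - real j) * real k / real n))
      = (\<Sum>j<n. \<Sum>k<n. \<Sum>l<n. u j * cnj (u l) * cis (2 * pi * (real l - real j) * real k / real n))"
    by (rule sum.swap)
  also have "\<dots> = (\<Sum>j<n. \<Sum>l<n. \<Sum>k<n. u j * cnj (u l) * cis (2 * pi * (real l - real j) * real k / real n))"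
    by (intro sum.cong refl sum.swap)
  also have "\<dots> = (\<Sum>j<n. \<Sum>l<n. u j * cnj (u l) * (if j = l then of_nat n else 0))"
    by (intro sum.cong refl) (simp add: sum_cis_orthogonal flip: sum_distrib_left)
  also have "\<dots> = (\<Sum>j<n. u j * cnj (u j)) * of_nat n"
    by (simp add: if_distrib[of "\<lambda>x. _ * x"] sum_distrib_right cong: if_cong)
  also have "(\<Sum>j<n. u j * cnj (u j)) = of_real (\<Sum>j<n. (norm (u j))\<^sup>2)"
    by (simp add: complex_norm_square[symmetric])
  finally have "complex_of_real (\<Sum>k<n. (norm (dft n u k))\<^sup>2) = of_real ((\<Sum>j<n. (norm (u j))\<^sup>2) / real n)"
    using n by (simp add: field_simps power2_eq_square)
  then show ?thesis by (simp only: of_real_eq_iff)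
qed

definition cyclic_autocorrelation :: "nat \<Rightarrow> (nat \<Rightarrow> complex) \<Rightarrow> nat \<Rightarrow> complex" where
  "cyclic_autocorrelation n u s = (\<Sum>j<n. u ((j + s) mod n) * cnj (u j)) / of_nat n"

lemma sum_cyclic_shift:
  fixes g :: "nat \<Rightarrow> 'a::comm_monoid_add"
  assumes n: "n > 0"
  shows "(\<Sum>s<n. g ((j + s) mod n)) = (\<Sum>s<n. g s)"
proof -
  have inj: "inj_on (\<lambda>s. (j + s) mod n) {..<n}"
  proof (rule inj_onI)
    fix x y assume xy: "x \<in> {..<n}" "y \<in> {..<n}" "(j + x) mod n = (j + y) mod n"
    then have "(int j + int x) mod int n = (int j + int y) mod int n"
      by (metis of_nat_add zmod_int)
    then have "int x mod int n = int y mod int n" by (metis mod_diff_left_eq add_diff_cancel_left')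
    then show "x = y" using xy by auto
  qed
  have "(\<lambda>s. (j + s) mod n) ` {..<n} = {..<n}"
    by (rule endo_inj_surj[OF _ _ inj]) (use n in auto)
  then show ?thesis using sum.reindex[OF inj, of g] by simp
qed

lemma cis_mod_period:
  assumes "n > 0"
  shows "cis (- (2 * pi * real (m mod n) * real k / real n)) = cis (- (2 * pi * real m * real k / real n))"
proof -
  have "real m = real (m mod n) + real n * real (m div n)"
    by (metis mod_mult_div_eq of_nat_add of_nat_mult)
  then have "- (2 * pi * real m * real k / real n)
      = - (2 * pi * real (m mod n) * real k / real n) + 2 * pi * (- real (m div n * k))"
    using assms by (simp add: field_simps)
  moreover have "cis (2 * pi * (- real (m div n * k))) = 1"
    by (rule cis_multiple_2pi) (intro Ints_minus Ints_of_nat)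
  ultimately show ?thesis by (metis cis_mult mult.right_neutral)
qed

text \<open>The finite form of the fact that an autocorrelation is positive definite. It turns a sum of fourth
  powers of Fourier coefficients into a mean square.\<close>

lemma dft_cyclic_autocorrelation:
  assumes n: "n > 0"
  shows "dft n (cyclic_autocorrelation n u) k = of_real ((norm (dft n u k))\<^sup>2)"
proof -
  let ?e = "\<lambda>j::nat. cis (- (2 * pi * real j * real k / real n))"
  have e: "?e s = ?e ((j + s) mod n) * cnj (?e j)" for j s
    by (simp only: cis_mod_period[OF n]) (simp add: cis_cnj cis_mult add_divide_distrib algebra_simps)
  have "dft n (cyclic_autocorrelation n u) k * (of_nat n)\<^sup>2
      = (\<Sum>s<n. \<Sum>j<n. u ((j + s) mod n) * cnj (u j) * ?e s)"
    using n unfolding dft_def cyclic_autocorrelation_def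
    by (simp add: power2_eq_square sum_divide_distrib[symmetric])
      (simp only: sum_distrib_right)
  also have "\<dots> = (\<Sum>j<n. \<Sum>s<n. u ((j + s) mod n) * cnj (u j) * ?e s)" by (rule sum.swap)
  also have "\<dots> = (\<Sum>j<n. \<Sum>s<n. (u ((j + s) mod n) * ?e ((j + s) mod n)) * cnj (u j * ?e j))"
  proof (intro sum.cong refl)
    fix j s
    show "u ((j + s) mod n) * cnj (u j) * ?e s = u ((j + s) mod n) * ?e ((j + s) mod n) * cnj (u j * ?e j)"
      by (subst e[of s j]) (simp only: complex_cnj_mult mult_ac)
  qed
  also have "\<dots> = (\<Sum>j<n. (\<Sum>s<n. u s * ?e s) * cnj (u j * ?e j))"
    by (simp only: sum_distrib_right[symmetric] sum_cyclic_shift[OF n, of "\<lambda>s. u s * ?e s"])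
  also have "\<dots> = (dft n u k * of_nat n) * cnj (dft n u k * of_nat n)"
    using n unfolding dft_def by (simp add: sum_distrib_left[symmetric])
  also have "\<dots> = of_real ((norm (dft n u k))\<^sup>2) * (of_nat n)\<^sup>2"
    unfolding complex_norm_square by (simp add: power2_eq_square)
  finally show ?thesis using n by simp
qed

text \<open>By Parseval for the autocorrelation, its mean square is the sum of the fourth powers of the
  coefficients of \<open>u\<close>; this is at most the largest squared coefficient times the mean square of \<open>u\<close>.\<close>

lemma large_dft_coefficient:
  assumes n: "n > 0" and B: "\<And>j. j < n \<Longrightarrow> norm (u j) \<le> B"
    and c: "c * real n \<le> (\<Sum>s<n. (norm (cyclic_autocorrelation n u s))\<^sup>2)"
  shows "\<exists>k<n. c \<le> (norm (dft n u k))\<^sup>2 * B\<^sup>2"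
proof (rule ccontr)
  assume a: "\<not> ?thesis"
  define X where "X = (MAX k\<in>{..<n}. (norm (dft n u k))\<^sup>2)"
  have le: "(norm (dft n u k))\<^sup>2 \<le> X" if "k < n" for k
    unfolding X_def using that by (intro Max_ge) auto
  have "X \<in> (\<lambda>k. (norm (dft n u k))\<^sup>2) ` {..<n}" unfolding X_def using n by (intro Max_in) auto
  then obtain k where k: "k < n" "X = (norm (dft n u k))\<^sup>2" by auto
  have "c \<le> (\<Sum>s<n. (norm (cyclic_autocorrelation n u s))\<^sup>2) / real n"
    using c n by (simp add: field_simps)
  also have "\<dots> = (\<Sum>k<n. (norm (dft n u k))\<^sup>2 * (norm (dft n u k))\<^sup>2)"
    by (subst dft_parseval[OF n, symmetric]) (simp add: dft_cyclic_autocorrelation[OF n] norm_power norm_mult power2_eq_square)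
  also have "\<dots> \<le> (\<Sum>k<n. X * (norm (dft n u k))\<^sup>2)"
    by (intro sum_mono mult_right_mono le) auto
  also have "\<dots> = X * ((\<Sum>j<n. (norm (u j))\<^sup>2) / real n)"
    by (simp add: dft_parseval[OF n] flip: sum_distrib_left)
  also have "\<dots> \<le> X * B\<^sup>2"
  proof (rule mult_left_mono)
    have "(\<Sum>j<n. (norm (u j))\<^sup>2) \<le> (\<Sum>j<n. B\<^sup>2)"
      using B by (intro sum_mono power_mono) auto
    then show "(\<Sum>j<n. (norm (u j))\<^sup>2) / real n \<le> B\<^sup>2" using n by (simp add: field_simps)
  qed (simp add: k)
  finally show False using a k by auto
qed

section \<open>Characters separate points\<close>

text \<open>Stated with neighbourhoods of \<open>0\<close>, since a topological group carries no metric here.\<close>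

lemma uniform_continuity_compact_group:
  fixes f :: "'g::{topological_ab_group_add, t2_space} \<Rightarrow> complex"
  assumes comp: "compact (UNIV :: 'g set)" and cont: "continuous_on UNIV f" and e: "e > 0"
  obtains U where "open U" "0 \<in> U" "\<And>x u. u \<in> U \<Longrightarrow> norm (f (x + u) - f x) < e"
proof -
  have "\<exists>V W. open V \<and> x \<in> V \<and> open W \<and> 0 \<in> W \<and> (\<forall>y\<in>V. \<forall>u\<in>W. norm (f (y + u) - f x) < e / 2)" for x
  proof -
    have "isCont f x" using cont by (simp add: continuous_on_eq_continuous_at)
    then have "(f \<longlongrightarrow> f (x + 0)) (nhds (x + 0))" by (simp add: isCont_def tendsto_at_iff_tendsto_nhds)
    then have "((\<lambda>p. f (fst p + snd p)) \<longlongrightarrow> f (x + 0)) (nhds x \<times>\<^sub>F nhds 0)"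
      by (rule filterlim_compose[OF _ tendsto_add_Pair])
    then have "eventually (\<lambda>p. dist (f (fst p + snd p)) (f (x + 0)) < e / 2) (nhds x \<times>\<^sub>F nhds 0)"
      using e by (intro tendstoD) auto
    then obtain P Q where PQ: "eventually P (nhds x)" "eventually Q (nhds 0)"
        "\<And>y u. P y \<Longrightarrow> Q u \<Longrightarrow> norm (f (y + u) - f x) < e / 2"
      unfolding eventually_prod_filter dist_norm fst_conv snd_conv add_0_right by blast
    from PQ(1) obtain V where V: "open V" "x \<in> V" "\<forall>y\<in>V. P y" unfolding eventually_nhds by blast
    from PQ(2) obtain W where W: "open W" "0 \<in> W" "\<forall>y\<in>W. Q y" unfolding eventually_nhds by blast
    show ?thesis by (intro exI[of _ V] exI[of _ W] conjI ballI V W PQ(3)) (use V W in auto)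
  qed
  then obtain V W where VW: "\<And>x. open (V x)" "\<And>x. x \<in> V x" "\<And>x. open (W x)" "\<And>x. 0 \<in> W x"
      "\<And>x y u. y \<in> V x \<Longrightarrow> u \<in> W x \<Longrightarrow> norm (f (y + u) - f x) < e / 2"
    by metis
  have "UNIV \<subseteq> (\<Union>x\<in>UNIV. V x)" using VW(2) by auto
  then obtain C where C: "finite C" "UNIV \<subseteq> (\<Union>x\<in>C. V x)"
    using compactE_image[OF comp, of UNIV V] VW(1) by metis
  show ?thesis
  proof
    show "open (\<Inter>x\<in>C. W x)" using C VW(3) by auto
    show "0 \<in> (\<Inter>x\<in>C. W x)" using VW(4) by auto
    fix y u assume u: "u \<in> (\<Inter>x\<in>C. W x)"
    obtain x where x: "x \<in> C" "y \<in> V x" using C by auto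
    have "norm (f (y + u) - f x) < e / 2" by (rule VW(5)[OF x(2)]) (use u x(1) in auto)
    moreover have "norm (f (y + 0) - f x) < e / 2" using VW(5)[OF x(2) VW(4)] .
    ultimately show "norm (f (y + u) - f y) < e"
      using norm_triangle_half_l[of "f (y + u)" "f x" e "f y"] by simp
  qed
qed

lemma open_translate_topological_group:
  fixes U :: "'g::{topological_ab_group_add, t2_space} set"
  assumes "open U"
  shows "open {y. y - x \<in> U}"
proof -
  have "continuous_on UNIV (\<lambda>y. y - x)" by (intro continuous_intros)
  then have "open ((\<lambda>y. y - x) -` U)" using assms continuous_on_open_vimage[of UNIV] by auto
  then show ?thesis by (simp add: vimage_def)
qed

text \<open>Together with the pigeonhole principle this replaces recurrence: every progression visits some
  translate of a given neighbourhood with a positive frequency that does not depend on the progression.\<close>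

lemma finite_translates_cover:
  fixes U :: "'g::{topological_ab_group_add, t2_space} set"
  assumes comp: "compact (UNIV :: 'g set)" and U: "open U" "0 \<in> U"
  obtains C where "finite C" "C \<noteq> {}" "\<And>y. \<exists>x\<in>C. y - x \<in> U"
proof -
  have "UNIV \<subseteq> (\<Union>x\<in>UNIV. {y. y - x \<in> U})"
  proof
    fix y :: 'g
    have "y \<in> {y'. y' - y \<in> U}" using U(2) by simp
    then show "y \<in> (\<Union>x\<in>UNIV. {y. y - x \<in> U})" by blast
  qed
  then obtain C where "finite C" "UNIV \<subseteq> (\<Union>x\<in>C. {y. y - x \<in> U})"
    using compactE_image[OF comp, of UNIV "\<lambda>x. {y. y - x \<in> U}"] open_translate_topological_group[OF U(1)] by auto
  then show ?thesis by (intro that[of C]) auto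
qed

lemma pigeonhole_cover:
  assumes C: "finite C" "C \<noteq> {}" and S: "finite S" and cov: "\<And>j. j \<in> S \<Longrightarrow> \<exists>x\<in>C. P x j"
  shows "\<exists>x\<in>C. card S \<le> card C * card {j \<in> S. P x j}"
proof (rule ccontr)
  assume a: "\<not> ?thesis"
  have "S = (\<Union>x\<in>C. {j \<in> S. P x j})" using cov by auto
  then have "card S \<le> (\<Sum>x\<in>C. card {j \<in> S. P x j})" using card_UN_le[OF C(1)] by metis
  then have "card C * card S \<le> (\<Sum>x\<in>C. card C * card {j \<in> S. P x j})"
    by (metis mult_le_mono2 sum_distrib_left)
  also have "\<dots> < (\<Sum>x\<in>C. card S)" using a C by (intro sum_strict_mono) auto
  finally show False by simp
qed

lemma difference_neighbourhood:
  fixes U :: "'g::{topological_ab_group_add, t2_space} set"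
  assumes U: "open U" "0 \<in> U"
  obtains V where "open V" "0 \<in> V" "\<And>u v. u \<in> V \<Longrightarrow> v \<in> V \<Longrightarrow> u - v \<in> U"
proof -
  have "eventually (\<lambda>p. fst p + snd p \<in> U) (nhds 0 \<times>\<^sub>F nhds (0::'g))"
  proof -
    have "eventually (\<lambda>x. x \<in> U) (nhds (0 + 0))" using U by (simp add: eventually_nhds_in_open)
    then show ?thesis using tendsto_add_Pair[of "0::'g" 0] unfolding filterlim_iff by (elim allE impE)
  qed
  then obtain P Q where PQ: "eventually P (nhds (0::'g))" "eventually Q (nhds (0::'g))"
      "\<And>y u. P y \<Longrightarrow> Q u \<Longrightarrow> y + u \<in> U"
    unfolding eventually_prod_filter by auto
  from PQ(2) have "eventually (\<lambda>x. Q (- x)) (nhds (0::'g))"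
    using tendsto_uminus_nhds[of "0::'g"] by (simp add: filterlim_iff)
  with PQ(1) have "eventually (\<lambda>x. P x \<and> Q (- x)) (nhds (0::'g))" by (rule eventually_conj)
  then obtain V where "open V" "0 \<in> V" "\<And>x. x \<in> V \<Longrightarrow> P x \<and> Q (- x)"
    unfolding eventually_nhds by auto
  moreover have "u - v \<in> U" if "P u" "Q (- v)" for u v
    using PQ(3)[OF that] by simp
  ultimately show ?thesis by (intro that[of V]) auto
qed

text \<open>The point is that \<open>C\<close> depends neither on the progression \<open>c\<close> nor on its length. The mean square
  of \<open>j \<mapsto> f (g + c j)\<close> is bounded below for a suitable \<open>g\<close>, because \<open>c\<close> visits a translate of a
  neighbourhood on which \<open>f\<close> is large. The autocorrelation at a shift \<open>s\<close> is close to this mean square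
  whenever \<open>c s\<close> is close to \<open>0\<close> and \<open>s\<close> is small compared with \<open>n\<close>; differences of visits to one
  translate provide a positive proportion of such shifts. Hence the mean square of the
  autocorrelation is bounded below, and so is some Fourier coefficient.\<close>

lemma dft_lower_bound_on_progressions:
  fixes f :: "'g::{topological_ab_group_add, t2_space} \<Rightarrow> complex"
  assumes comp: "compact (UNIV :: 'g set)" and cont: "continuous_on UNIV f" and x0: "f x0 \<noteq> 0"
  shows "\<exists>C>0. \<forall>c :: nat \<Rightarrow> 'g. \<forall>n>0. (\<forall>j l. c (j + l) = c j + c l) \<longrightarrow>
           (\<exists>g. \<exists>k<n. C \<le> norm (dft n (\<lambda>j. f (g + c j)) k))"
proof -
  have "bounded (range f)" using compact_continuous_image[OF cont comp] by (rule compact_imp_bounded)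
  then obtain B where B: "B > 0" "\<And>x. norm (f x) \<le> B" by (auto simp: bounded_pos)
  define a where "a = norm (f x0)"
  have a: "a > 0" using x0 by (simp add: a_def)
  obtain U1 where U1: "open U1" "0 \<in> U1" "\<And>x u. u \<in> U1 \<Longrightarrow> norm (f (x + u) - f x) < a / 2"
    using uniform_continuity_compact_group[OF comp cont half_gt_zero[OF a]] by metis
  obtain C1 where C1: "finite C1" "C1 \<noteq> {}" "\<And>y. \<exists>x\<in>C1. y - x \<in> U1"
    using finite_translates_cover[OF comp U1(1,2)] by metis
  \<comment> \<open>A lower bound for the mean square of \<open>j \<mapsto> f (g + c j)\<close>: for a suitable \<open>g\<close>, at least one in
    \<open>card C1\<close> of the values has modulus at least \<open>a / 2\<close>.\<close>
  define d where "d = a\<^sup>2 / (4 * card C1)"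
  have K1: "card C1 > 0" using C1 by (simp add: card_gt_0_iff)
  have d: "d > 0" using a K1 by (simp add: d_def)
  define e where "e = d / (4 * B)"
  have e: "e > 0" "e * B = d / 4" using d B by (auto simp: e_def)
  obtain U2 where U2: "open U2" "0 \<in> U2" "\<And>x u. u \<in> U2 \<Longrightarrow> norm (f (x + u) - f x) < e"
    using uniform_continuity_compact_group[OF comp cont e(1)] by metis
  obtain V2 where V2: "open V2" "0 \<in> V2" "\<And>u v. u \<in> V2 \<Longrightarrow> v \<in> V2 \<Longrightarrow> u - v \<in> U2"
    using difference_neighbourhood[OF U2(1,2)] by metis
  obtain C2 where C2: "finite C2" "C2 \<noteq> {}" "\<And>y. \<exists>x\<in>C2. y - x \<in> V2"
    using finite_translates_cover[OF comp V2(1,2)] by metis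
  have K2: "card C2 > 0" using C2 by (simp add: card_gt_0_iff)
  define h where "h = min 1 (d / (8 * B\<^sup>2))"
  have h: "h > 0" "h \<le> 1" "2 * B\<^sup>2 * h \<le> d / 4"
  proof -
    show "h > 0" "h \<le> 1" using d B by (auto simp: h_def)
    have "2 * B\<^sup>2 * h \<le> 2 * B\<^sup>2 * (d / (8 * B\<^sup>2))" by (intro mult_left_mono) (auto simp: h_def)
    also have "\<dots> = d / 4" using B by simp
    finally show "2 * B\<^sup>2 * h \<le> d / 4" .
  qed
  define q where "q = h * (d / 2)\<^sup>2 / card C2"
  have q: "q > 0" using h d K2 by (simp add: q_def)
  show ?thesis
  proof (intro exI[of _ "sqrt q / B"] conjI allI impI)
    show "sqrt q / B > 0" using q B by simp
    fix c :: "nat \<Rightarrow> 'g" and n :: nat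
    assume n: "0 < n" and c: "\<forall>j l. c (j + l) = c j + c l"
    have "\<exists>x\<in>C1. card {..<n} \<le> card C1 * card {j \<in> {..<n}. c j - x \<in> U1}"
      by (rule pigeonhole_cover) (use C1 in auto)
    then obtain x where x: "x \<in> C1" "n \<le> card C1 * card {j \<in> {..<n}. c j - x \<in> U1}" by auto
    define g where "g = x0 - x"
    define u where "u j = f (g + c j)" for j
    have u: "norm (u j) \<le> B" for j using B by (simp add: u_def)
    have big: "a / 2 \<le> norm (u j)" if "c j - x \<in> U1" for j
    proof -
      have "norm (f (x0 + (c j - x)) - f x0) < a / 2" by (rule U1(3)[OF that])
      moreover have "x0 + (c j - x) = g + c j" by (simp add: g_def)
      ultimately show ?thesis using norm_triangle_ineq3[of "u j" "f x0"] a_def u_def by (smt (verit) field_sum_of_halves)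
    qed
    define v where "v = cyclic_autocorrelation n u"
    \<comment> \<open>The value at shift \<open>0\<close> is the mean square of \<open>u\<close>.\<close>
    have v0: "d \<le> norm (v 0)"
    proof -
      have "real n * (a / 2)\<^sup>2 \<le> (card C1 * card {j \<in> {..<n}. c j - x \<in> U1}) * (a / 2)\<^sup>2"
        using x(2) by (intro mult_right_mono) (simp_all flip: of_nat_mult)
      also have "\<dots> = real (card C1) * (\<Sum>j\<in>{j \<in> {..<n}. c j - x \<in> U1}. (a / 2)\<^sup>2)" by simp
      also have "\<dots> \<le> real (card C1) * (\<Sum>j\<in>{j \<in> {..<n}. c j - x \<in> U1}. (norm (u j))\<^sup>2)"
        using a by (intro mult_left_mono sum_mono power_mono big) auto
      also have "\<dots> \<le> real (card C1) * (\<Sum>j<n. (norm (u j))\<^sup>2)"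
        by (intro mult_left_mono sum_mono2) auto
      finally have 1: "real n * (a / 2)\<^sup>2 \<le> real (card C1) * (\<Sum>j<n. (norm (u j))\<^sup>2)" .
      have "v 0 = of_real ((\<Sum>j<n. (norm (u j))\<^sup>2) / real n)"
        by (simp add: v_def cyclic_autocorrelation_def complex_norm_square[symmetric])
      then have "norm (v 0) = (\<Sum>j<n. (norm (u j))\<^sup>2) / real n"
        by (simp only: norm_of_real) (simp add: sum_nonneg)
      then have "real n * (a / 2)\<^sup>2 \<le> real n * (card C1 * norm (v 0))" using 1 n by (simp add: mult.left_commute)
      then have "(a / 2)\<^sup>2 \<le> card C1 * norm (v 0)" using n by simp
      then show ?thesis using K1 by (simp add: d_def field_simps power2_eq_square)
    qed
    \<comment> \<open>Shifts below \<open>h * n\<close>: the wrap-around of the cyclic shift costs at most \<open>2 * B\<^sup>2 * h\<close>.\<close>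
    define S where "S = {..<nat \<lceil>h * real n\<rceil>}"
    have Sn: "s < n" "real s \<le> h * n" if "s \<in> S" for s
    proof -
      have "int s < \<lceil>h * real n\<rceil>" using that unfolding S_def by auto
      then have 1: "real s < h * real n" by (simp add: less_ceiling_iff)
      moreover have "h * real n \<le> 1 * real n" using h by (intro mult_right_mono) auto
      ultimately show "s < n" by simp
      show "real s \<le> h * n" using 1 by simp
    qed
    have cS: "h * real n \<le> card S" unfolding S_def card_lessThan by (rule real_nat_ceiling_ge)
    have "\<exists>x\<in>C2. card S \<le> card C2 * card {j \<in> S. c j - x \<in> V2}"
      by (rule pigeonhole_cover) (use C2 in \<open>auto simp: S_def\<close>)
    then obtain y where y: "y \<in> C2" "card S \<le> card C2 * card {j \<in> S. c j - y \<in> V2}" by auto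
    \<comment> \<open>Subtracting the first visit to \<open>y + V2\<close> from the others gives as many shifts \<open>s\<close> with \<open>c s\<close>
      in the neighbourhood \<open>U2\<close> of \<open>0\<close>.\<close>
    define T where "T = {s \<in> S. c s \<in> U2}"
    have finT: "finite T" by (simp add: T_def S_def)
    have "card {j \<in> S. c j - y \<in> V2} \<le> card T"
    proof (cases "{j \<in> S. c j - y \<in> V2} = {}")
      case False
      define W where "W = {j \<in> S. c j - y \<in> V2}"
      have W: "finite W" "W \<noteq> {}" using False by (auto simp: W_def S_def)
      define s0 where "s0 = Min W"
      have s0: "s0 \<in> W" "\<And>s. s \<in> W \<Longrightarrow> s0 \<le> s" using W by (auto simp: s0_def)
      have "card W = card ((\<lambda>s. s - s0) ` W)"
        by (rule card_image[symmetric]) (auto simp: inj_on_def dest!: s0(2))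
      also have "\<dots> \<le> card T"
      proof (rule card_mono[OF finT], rule image_subsetI)
        fix s assume s: "s \<in> W"
        have "c ((s - s0) + s0) = c (s - s0) + c s0" using c by blast
        then have "c (s - s0) = c s - c s0" using s0(2)[OF s] by simp
        also have "\<dots> = (c s - y) - (c s0 - y)" by simp
        also have "\<dots> \<in> U2" using s s0(1) by (intro V2(3)) (auto simp: W_def)
        finally show "s - s0 \<in> T" using s by (auto simp: T_def S_def W_def)
      qed
      finally show ?thesis by (simp add: W_def)
    next
      case True
      show ?thesis unfolding True by simp
    qed
    then have "card S \<le> card C2 * card T" using y(2) by (meson le_trans mult_le_mono2)
    then have cT: "h * real n \<le> card C2 * card T" using cS by (metis of_nat_le_iff of_nat_mult order_trans)
    have vs: "d / 2 \<le> norm (v s)" if "s \<in> T" for s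
    proof -
      have s: "s \<in> S" "c s \<in> U2" using that by (auto simp: T_def)
      have "norm (v s - v 0) * real n = norm (\<Sum>j<n. (u ((j + s) mod n) - u j) * cnj (u j))"
        using n by (simp add: v_def cyclic_autocorrelation_def left_diff_distrib sum_subtractf norm_divide
            flip: diff_divide_distrib)
      also have "\<dots> \<le> (\<Sum>j<n. norm ((u ((j + s) mod n) - u j) * cnj (u j)))" by (rule norm_sum)
      also have "\<dots> \<le> (\<Sum>j<n. (e + (if j < n - s then 0 else 2 * B)) * B)"
      proof (rule sum_mono)
        fix j assume j: "j \<in> {..<n}"
        have "norm (u ((j + s) mod n) - u j) \<le> e + (if j < n - s then 0 else 2 * B)"
        proof (cases "j < n - s")
          case True
          have "c (j + s) = c j + c s" using c by blast
          then have "norm (u (j + s) - u j) < e" using U2(3)[OF s(2), of "g + c j"] by (simp add: u_def add.assoc)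
          then show ?thesis using True by simp
        next
          case False
          then show ?thesis using norm_triangle_ineq4[of "u ((j + s) mod n)" "u j"] u[of "(j+s) mod n"] u[of j] e(1) by simp
        qed
        then show "norm ((u ((j + s) mod n) - u j) * cnj (u j)) \<le> (e + (if j < n - s then 0 else 2 * B)) * B"
          unfolding norm_mult using u[of j] by (intro mult_mono) (auto intro: order_trans[OF norm_ge_zero])
      qed
      also have "\<dots> = (\<Sum>j<n. e * B) + (\<Sum>j<n. if j < n - s then 0 else 2 * B * B)"
        unfolding sum.distrib[symmetric] by (rule sum.cong) (auto simp: algebra_simps)
      also have "(\<Sum>j<n. if j < n - s then 0 else 2 * B * B) = (\<Sum>j\<in>{n - s..<n}. 2 * B * B)"
        by (rule sum.mono_neutral_cong_right) auto
      also have "(\<Sum>j<n. e * B) + \<dots> = real n * (d / 4) + real s * (2 * B * B)"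
        using Sn(1)[OF s(1)] by (simp add: e(2))
      also have "\<dots> \<le> real n * (d / 4) + (h * n) * (2 * B * B)"
        using Sn(2)[OF s(1)] B by (intro add_left_mono mult_right_mono) auto
      also have "\<dots> = real n * (d / 4 + 2 * B\<^sup>2 * h)" by (simp add: power2_eq_square algebra_simps)
      also have "\<dots> \<le> real n * (d / 2)" using h(3) by (intro mult_left_mono) auto
      finally have "norm (v s - v 0) \<le> d / 2" using n by (simp add: mult.commute)
      then show ?thesis using v0 norm_triangle_ineq3[of "v s" "v 0"] by linarith
    qed
    have "q * real n = (h * real n) * (d / 2)\<^sup>2 / card C2" by (simp add: q_def)
    also have "\<dots> \<le> (card C2 * card T) * (d / 2)\<^sup>2 / card C2"
      by (intro divide_right_mono mult_right_mono cT) auto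
    also have "\<dots> = (\<Sum>s\<in>T. (d / 2)\<^sup>2)" using K2 by simp
    also have "\<dots> \<le> (\<Sum>s\<in>T. (norm (v s))\<^sup>2)" using d by (intro sum_mono power_mono vs) auto
    also have "\<dots> \<le> (\<Sum>s<n. (norm (v s))\<^sup>2)" by (rule sum_mono2) (auto simp: T_def Sn)
    finally have "\<exists>k<n. q \<le> (norm (dft n u k))\<^sup>2 * B\<^sup>2"
      unfolding v_def by (intro large_dft_coefficient n u)
    then obtain k where k: "k < n" "q \<le> (norm (dft n u k) * B)\<^sup>2" by (auto simp: power_mult_distrib)
    then have "sqrt q \<le> norm (dft n u k) * B" using B by (intro real_le_lsqrt) auto
    then have "sqrt q / B \<le> norm (dft n u k)" using B by (simp add: field_simps)
    then show "\<exists>g. \<exists>k<n. sqrt q / B \<le> norm (dft n (\<lambda>j. f (g + c j)) k)"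
      using k unfolding u_def by blast
  qed
qed

lemma Urysohn_compact_Hausdorff:
  fixes S T :: "'a::t2_space set"
  assumes comp: "compact (UNIV :: 'a set)" and ST: "closed S" "closed T" "S \<inter> T = {}"
  obtains f :: "'a \<Rightarrow> real" where "continuous_on UNIV f" "\<And>x. f x \<in> {0..1}"
    "\<And>x. x \<in> S \<Longrightarrow> f x = 0" "\<And>x. x \<in> T \<Longrightarrow> f x = 1"
proof -
  have "compact_space (euclidean :: 'a topology)" using comp by (simp add: compact_space_def)
  moreover have "Hausdorff_space (euclidean :: 'a topology)"
    unfolding Hausdorff_space_def
  proof (intro allI impI)
    fix x y :: 'a assume "x \<in> topspace euclidean \<and> y \<in> topspace euclidean \<and> x \<noteq> y"
    then have "x \<noteq> y" by blast
    from hausdorff[OF this]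
    obtain U V where "open U" "open V" "x \<in> U" "y \<in> V" "U \<inter> V = {}" by metis
    then show "\<exists>U V. openin euclidean U \<and> openin euclidean V \<and> x \<in> U \<and> y \<in> V \<and> disjnt U V"
      by (intro exI[of _ U] exI[of _ V]) (simp add: disjnt_def)
  qed
  ultimately have "normal_space (euclidean :: 'a topology)"
    using compact_Hausdorff_or_regular_imp_normal_space by metis
  moreover have "closedin euclidean S" "closedin euclidean T" "disjnt S T"
    using ST by (simp_all add: disjnt_def)
  ultimately obtain f where f: "continuous_map euclidean (top_of_set {0..1::real}) f" "f ` S \<subseteq> {0}" "f ` T \<subseteq> {1}"
    using Urysohn_lemma zero_le_one by metis
  show ?thesis
  proof
    show "continuous_on UNIV f" "f x \<in> {0..1}" for x
      using f(1) by (auto simp: continuous_map_in_subtopology)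
  qed (use f in auto)
qed

text \<open>Shifting the sequence by \<open>l\<close> multiplies its transform by a unimodular number up to an error from
  the \<open>2 l\<close> terms at the ends of the window.\<close>

lemma dft_shift:
  assumes B: "\<And>j. norm (w j) \<le> B" and n: "n > 0"
  shows "norm (dft n (\<lambda>j. w (j + l)) k * cis (- (2 * pi * real l * real k / real n)) - dft n w k) \<le> 2 * real l * B / real n"
proof -
  let ?e = "\<lambda>j::nat. cis (- (2 * pi * real j * real k / real n))"
  have e: "?e j * ?e l = ?e (j + l)" for j by (simp add: cis_mult add_divide_distrib algebra_simps)
  have 1: "(\<Sum>j<n. w (j + l) * ?e (j + l)) = (\<Sum>j\<in>{l..<n+l}. w j * ?e j)"
    using sum.shift_bounds_nat_ivl[of "\<lambda>j. w j * ?e j" 0 l n] by (simp add: lessThan_atLeast0)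
  have 2: "(\<Sum>j<n. w j * ?e j) + (\<Sum>j\<in>{n..<n+l}. w j * ?e j) = (\<Sum>j<l. w j * ?e j) + (\<Sum>j\<in>{l..<n+l}. w j * ?e j)"
    using sum.atLeastLessThan_concat[of 0 n "n+l" "\<lambda>j. w j * ?e j"] sum.atLeastLessThan_concat[of 0 l "n+l" "\<lambda>j. w j * ?e j"]
    by (simp add: lessThan_atLeast0)
  have "dft n (\<lambda>j. w (j + l)) k * ?e l - dft n w k
      = ((\<Sum>j<n. w (j + l) * ?e (j + l)) - (\<Sum>j<n. w j * ?e j)) / of_nat n"
    unfolding dft_def e[symmetric] by (simp add: sum_distrib_right diff_divide_distrib mult.assoc)
  also have "\<dots> = ((\<Sum>j\<in>{n..<n+l}. w j * ?e j) - (\<Sum>j<l. w j * ?e j)) / of_nat n"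
    unfolding 1 using 2 by (simp add: algebra_simps)
  finally have "norm (dft n (\<lambda>j. w (j + l)) k * ?e l - dft n w k)
      = norm ((\<Sum>j\<in>{n..<n+l}. w j * ?e j) - (\<Sum>j<l. w j * ?e j)) / real n"
    by (simp add: norm_divide)
  also have "norm ((\<Sum>j\<in>{n..<n+l}. w j * ?e j) - (\<Sum>j<l. w j * ?e j)) \<le> real l * B + real l * B"
  proof (rule order_trans[OF norm_triangle_ineq4] add_mono)+
    show "norm (\<Sum>j\<in>{n..<n+l}. w j * ?e j) \<le> real l * B"
      using sum_norm_le[of "{n..<n+l}" "\<lambda>j. w j * ?e j" "\<lambda>_. B"] B by (simp add: norm_mult)
    show "norm (\<Sum>j<l. w j * ?e j) \<le> real l * B"
      using sum_norm_le[of "{..<l}" "\<lambda>j. w j * ?e j" "\<lambda>_. B"] B by (simp add: norm_mult)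
  qed
  finally show ?thesis using n by (simp add: divide_right_mono mult_ac)
qed

lemma norm_dft_le:
  assumes B: "\<And>j. norm (w j) \<le> B" and n: "n > 0"
  shows "norm (dft n w k) \<le> B"
proof -
  have "norm (\<Sum>j<n. w j * cis (- (2 * pi * real j * real k / real n))) \<le> real n * B"
    using sum_norm_le[of "{..<n}" "\<lambda>j. w j * cis (- (2 * pi * real j * real k / real n))" "\<lambda>_. B"] B
    by (simp add: norm_mult)
  then show ?thesis using n by (simp add: dft_def norm_divide field_simps)
qed

lemma dft_diff: "dft n (\<lambda>j. u j - v j) k = dft n u k - dft n v k"
  by (simp add: dft_def left_diff_distrib sum_subtractf diff_divide_distrib)

text \<open>Tychonoff's theorem. A cluster point is described by the closed conditions that it inherits; a
  convergent subsequence need not exist, since the index type is arbitrary.\<close>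

lemma exists_pointwise_cluster_point:
  fixes F :: "nat \<Rightarrow> 'a \<Rightarrow> complex"
  assumes B: "\<And>L x. norm (F L x) \<le> B"
  obtains \<phi> where "\<And>Z. closed Z \<Longrightarrow> eventually (\<lambda>L. F L \<in> Z) sequentially \<Longrightarrow> \<phi> \<in> Z"
proof -
  define K where "K = (PiE UNIV (\<lambda>_. cball 0 B) :: ('a \<Rightarrow> complex) set)"
  have "compactin (product_topology (\<lambda>_. euclidean) UNIV) K"
    unfolding K_def by (subst compactin_PiE) auto
  then have "compact K" by (simp add: euclidean_product_topology)
  moreover have "filtermap F sequentially \<noteq> bot" by (simp add: filtermap_bot_iff)
  moreover have "eventually (\<lambda>x. x \<in> K) (filtermap F sequentially)"
    using B by (simp add: eventually_filtermap K_def PiE_def)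
  ultimately obtain \<phi> where \<phi>: "inf (nhds \<phi>) (filtermap F sequentially) \<noteq> bot"
    unfolding compact_filter by blast
  show ?thesis
  proof (rule that[of \<phi>], rule ccontr)
    fix Z assume Z: "closed Z" "eventually (\<lambda>L. F L \<in> Z) sequentially" "\<phi> \<notin> Z"
    then have "eventually (\<lambda>x. x \<in> - Z) (nhds \<phi>)" by (intro eventually_nhds_in_open) auto
    moreover have "eventually (\<lambda>x. x \<in> Z) (filtermap F sequentially)" using Z by (simp add: eventually_filtermap)
    ultimately have "eventually (\<lambda>x. False) (inf (nhds \<phi>) (filtermap F sequentially))"
      unfolding eventually_inf by (intro exI[of _ "\<lambda>x. x \<in> - Z"] exI[of _ "\<lambda>x. x \<in> Z"]) auto
    then show False using \<phi> by (simp add: eventually_False)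
  qed
qed

text \<open>A value of modulus above \<open>1\<close> would have unbounded powers, and so would the inverse of a value of
  modulus below \<open>1\<close>.\<close>

lemma norm_bounded_multiplicative_eq_1:
  fixes \<xi> :: "'g::group_add \<Rightarrow> complex"
  assumes mult: "\<And>x y. \<xi> (x + y) = \<xi> x * \<xi> y" and one: "\<xi> 0 = 1" and B: "\<And>x. norm (\<xi> x) \<le> B"
  shows "norm (\<xi> x) = 1"
proof -
  have le: "norm (\<xi> x) \<le> 1" for x
  proof (rule ccontr)
    assume "\<not> ?thesis"
    then obtain n where n: "B < norm (\<xi> x) ^ n" using real_arch_pow by force
    have "\<exists>y. \<xi> y = \<xi> x ^ n" for n
    proof (induction n)
      case 0 then show ?case using one by auto
    next
      case (Suc n) then show ?case by (metis mult power_Suc)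
    qed
    then obtain y where "\<xi> y = \<xi> x ^ n" by blast
    then show False using B[of y] n by (simp add: norm_power)
  qed
  have "\<xi> x * \<xi> (- x) = 1" using mult[of x "- x"] one by simp
  then have "norm (\<xi> x) * norm (\<xi> (- x)) = 1" by (metis norm_mult norm_one)
  moreover have "norm (\<xi> x) * norm (\<xi> (- x)) \<le> norm (\<xi> x) * 1" by (intro mult_left_mono le) auto
  ultimately show ?thesis using le[of x] by linarith
qed

text \<open>Apply the lower bound to the difference \<open>f (x + a) - f x\<close> for a continuous \<open>f\<close> with
  \<open>f 0 \<noteq> f a\<close>, along the progressions of step \<open>\<beta> (1 / L!)\<close> and length \<open>(L + 1) L!\<close>. The twisted
  averages \<open>F L\<close> of \<open>f\<close> satisfy \<open>F L (h + k) * F L h' \<approx> F L h * F L (h' + k)\<close> for \<open>k = \<beta> (1 / q)\<close> as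
  soon as \<open>q\<close> divides \<open>L!\<close>. A cluster point \<open>\<phi>\<close> satisfies this equation exactly, for all \<open>k\<close> in a
  closed subgroup that contains \<open>\<beta> (1 / q)\<close> for every \<open>q\<close>, hence for all \<open>k\<close>. Therefore
  \<open>\<phi> (h0 + k) / \<phi> h0\<close> is a character in \<open>k\<close>, and its value at \<open>a\<close> is not \<open>1\<close> because
  \<open>\<phi> a \<noteq> \<phi> 0\<close>.\<close>

theorem characters_separate_points:
  fixes \<beta> :: "real \<Rightarrow> 'g::{topological_ab_group_add, t2_space}" and a :: 'g
  assumes G: "dirichlet_group \<beta>" and a: "a \<noteq> 0"
  obtains \<gamma> where "group_character \<gamma>" "\<gamma> a \<noteq> 1"
proof -
  have comp: "compact (UNIV :: 'g set)" and cont\<beta>: "continuous_on UNIV \<beta>"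
    and add: "\<And>s t. \<beta> (s + t) = \<beta> s + \<beta> t" and dense: "closure (range \<beta>) = UNIV"
    using G by (auto simp: dirichlet_group_def)
  obtain f0 :: "'g \<Rightarrow> real" where f0: "continuous_on UNIV f0" "\<And>x::'g. f0 x \<in> {0..1}"
      "\<And>x::'g. x \<in> {0} \<Longrightarrow> f0 x = 0" "\<And>x::'g. x \<in> {a} \<Longrightarrow> f0 x = 1"
    by (rule Urysohn_compact_Hausdorff[OF comp, of "{0}" "{a}"]) (use a in auto)
  define f where "f x = complex_of_real (f0 x)" for x
  have f: "continuous_on UNIV f" unfolding f_def using f0(1) by (intro continuous_intros)
  have f01: "f 0 = 0" "f a = 1" using f0(3,4) by (auto simp: f_def)
  have B: "norm (f x) \<le> 1" for x using f0(2)[of x] by (simp add: f_def)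
  have fd: "continuous_on UNIV (\<lambda>x. f (x + a) - f x)"
    by (intro continuous_intros continuous_on_compose2[OF f]) auto
  have "f (0 + a) - f 0 \<noteq> 0" using f01 by simp
  from dft_lower_bound_on_progressions[OF comp fd this]
  obtain C where C: "C > 0" and "\<forall>c. \<forall>n>0. (\<forall>j l. c (j + l) = c j + c l) \<longrightarrow>
       (\<exists>g. \<exists>k<n. C \<le> norm (dft n (\<lambda>j. f (g + c j + a) - f (g + c j)) k))"
    by blast
  then have Cb: "\<And>c n. n > 0 \<Longrightarrow> (\<And>j l. c (j + l) = c j + c l) \<Longrightarrow>
       \<exists>g. \<exists>k<n. C \<le> norm (dft n (\<lambda>j. f (g + c j + a) - f (g + c j)) k)"
    by blast
  define c where "c L j = \<beta> (real j / fact L)" for L j :: nat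
  \<comment> \<open>The progression runs through the times below \<open>Suc L\<close>; a fixed time shift moves a fraction of
    order \<open>1 / L\<close> of it.\<close>
  define n where "n L = Suc L * fact L" for L :: nat
  have n: "n L > 0" for L by (simp add: n_def)
  have c: "c L (j + l) = c L j + c L l" for L j l
    unfolding c_def by (simp add: add_divide_distrib add)
  have "\<exists>g k. C \<le> norm (dft (n L) (\<lambda>j. f (g + c L j + a) - f (g + c L j)) k)" for L
    using Cb[OF n, of "c L"] c by blast
  then obtain g k where gk: "\<And>L. C \<le> norm (dft (n L) (\<lambda>j. f (g L + c L j + a) - f (g L + c L j)) (k L))"
    by metis
  define F where "F L h = dft (n L) (\<lambda>j. f (g L + h + c L j)) (k L)" for L h
  have FB: "norm (F L h) \<le> 1" for L h
    unfolding F_def by (rule norm_dft_le[OF B n])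
  have Fa: "C \<le> norm (F L a - F L 0)" for L
    using gk[of L] by (simp add: F_def dft_diff[symmetric] add_ac)
  have Fshift: "norm (F L (h + c L l) * F L h' - F L h * F L (h' + c L l)) \<le> 4 * real l / n L" for L h h' l
  proof -
    define z where "z = cis (- (2 * pi * real l * real (k L) / real (n L)))"
    have A: "norm (F L (x + c L l) * z - F L x) \<le> 2 * real l / n L" for x
      using dft_shift[of "\<lambda>j. f (g L + x + c L j)" 1 "n L" l "k L"] B n
      by (simp add: F_def z_def c add_ac)
    have "F L (h + c L l) * F L h' - F L h * F L (h' + c L l)
      = (1 / z) * ((F L (h + c L l) * z - F L h) * F L h' - F L h * (F L (h' + c L l) * z - F L h'))"
      by (simp add: z_def field_simps)
    then have "norm (F L (h + c L l) * F L h' - F L h * F L (h' + c L l))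
      = norm ((F L (h + c L l) * z - F L h) * F L h' - F L h * (F L (h' + c L l) * z - F L h'))"
      by (simp add: norm_mult norm_divide z_def)
    also have "\<dots> \<le> norm (F L (h + c L l) * z - F L h) * norm (F L h') + norm (F L h) * norm (F L (h' + c L l) * z - F L h')"
      unfolding norm_mult[symmetric] by (rule norm_triangle_ineq4)
    also have "\<dots> \<le> (2 * real l / n L) * 1 + 1 * (2 * real l / n L)"
      by (intro add_mono mult_mono A FB) auto
    finally show ?thesis by simp
  qed
  obtain \<phi> where \<phi>: "\<And>Z. closed Z \<Longrightarrow> eventually (\<lambda>L. F L \<in> Z) sequentially \<Longrightarrow> \<phi> \<in> Z"
    using exists_pointwise_cluster_point[of F 1] FB by blast
  have coord: "continuous_on UNIV (\<lambda>\<phi>. \<phi> x)" for x :: 'g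
    by (rule continuous_on_product_coordinates)
  have \<phi>B: "norm (\<phi> x) \<le> 1" for x
  proof -
    have "\<phi> \<in> {\<phi>. norm (\<phi> x) \<le> 1}"
      by (rule \<phi>) (auto intro!: closed_Collect_le continuous_intros coord simp: FB)
    then show ?thesis by simp
  qed
  have \<phi>a: "C \<le> norm (\<phi> a - \<phi> 0)"
  proof -
    have "\<phi> \<in> {\<phi>. C \<le> norm (\<phi> a - \<phi> 0)}"
      by (rule \<phi>) (auto intro!: closed_Collect_le continuous_intros coord simp: Fa)
    then show ?thesis by simp
  qed
  have equi: "\<exists>U. open U \<and> 0 \<in> U \<and> (\<forall>h. \<forall>u\<in>U. norm (\<phi> (h + u) - \<phi> h) \<le> e)" if e: "e > 0" for e
  proof -
    obtain U where U: "open U" "0 \<in> U" "\<And>x u. u \<in> U \<Longrightarrow> norm (f (x + u) - f x) < e"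
      using uniform_continuity_compact_group[OF comp f e] by metis
    have "norm (\<phi> (h + u) - \<phi> h) \<le> e" if u: "u \<in> U" for h u
    proof -
      have "norm (F L (h + u) - F L h) \<le> e" for L
        unfolding F_def dft_diff[symmetric]
      proof (rule norm_dft_le[OF _ n])
        fix j show "norm (f (g L + (h + u) + c L j) - f (g L + h + c L j)) \<le> e"
          using U(3)[OF u, of "g L + h + c L j"] by (simp add: add_ac)
      qed
      then have "\<phi> \<in> {\<phi>. norm (\<phi> (h + u) - \<phi> h) \<le> e}"
        by (intro \<phi>) (auto intro!: closed_Collect_le continuous_intros coord)
      then show ?thesis by simp
    qed
    then show ?thesis using U by blast
  qed
  have cont\<phi>: "continuous_on UNIV \<phi>"
    unfolding continuous_on_eq_continuous_at[OF open_UNIV] isCont_def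
  proof (intro ballI tendstoI)
    fix x and e :: real assume e: "e > 0"
    obtain U where U: "open U" "0 \<in> U" "\<And>h u. u \<in> U \<Longrightarrow> norm (\<phi> (h + u) - \<phi> h) \<le> e / 2"
      using equi[of "e / 2"] e by auto
    have "eventually (\<lambda>y. y \<in> {y. y - x \<in> U}) (nhds x)"
      using open_translate_topological_group[OF U(1)] U(2) by (intro eventually_nhds_in_open) auto
    then have "eventually (\<lambda>y. dist (\<phi> y) (\<phi> x) < e) (nhds x)"
    proof (rule eventually_mono)
      fix y assume "y \<in> {y. y - x \<in> U}"
      then have "norm (\<phi> (x + (y - x)) - \<phi> x) \<le> e / 2" by (intro U(3)) auto
      then show "dist (\<phi> y) (\<phi> x) < e" using e by (simp add: dist_norm)
    qed
    then show "eventually (\<lambda>y. dist (\<phi> y) (\<phi> x) < e) (at x)"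
      by (simp add: eventually_at_filter eventually_mono)
  qed
  define P where "P = {k. \<forall>h h'. \<phi> (h + k) * \<phi> h' = \<phi> h * \<phi> (h' + k)}"
  have Pclosed: "closed P"
  proof -
    have "P = (\<Inter>h. \<Inter>h'. {k. \<phi> (h + k) * \<phi> h' = \<phi> h * \<phi> (h' + k)})" by (auto simp: P_def)
    moreover have "closed {k. \<phi> (h + k) * \<phi> h' = \<phi> h * \<phi> (h' + k)}" for h h'
      by (intro closed_Collect_eq continuous_intros continuous_on_compose2[OF cont\<phi>]) auto
    ultimately show ?thesis by auto
  qed
  have Padd: "k + l \<in> P" if "k \<in> P" "l \<in> P" for k l
  proof -
    have "\<phi> (h + (k + l)) * \<phi> h' = \<phi> h * \<phi> (h' + (k + l))" for h h'
    proof -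
      have "\<phi> ((h + l) + k) * \<phi> h' = \<phi> (h + l) * \<phi> (h' + k)" using that(1) unfolding P_def by blast
      also have "\<dots> = \<phi> h * \<phi> ((h' + k) + l)" using that(2) unfolding P_def by blast
      finally show ?thesis by (simp add: add_ac)
    qed
    then show ?thesis by (simp add: P_def)
  qed
  have Pminus: "- k \<in> P" if "k \<in> P" for k
  proof -
    have "\<phi> (h - k) * \<phi> h' = \<phi> h * \<phi> (h' - k)" for h h'
    proof -
      have "\<phi> ((h - k) + k) * \<phi> (h' - k) = \<phi> (h - k) * \<phi> ((h' - k) + k)" using that unfolding P_def by blast
      then show ?thesis by simp
    qed
    then show ?thesis by (simp add: P_def)
  qed
  have Pnat: "\<beta> (1 / real q) \<in> P" if q: "q > 0" for q :: nat
  proof -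
    have "norm (\<phi> (h + \<beta> (1 / q)) * \<phi> h' - \<phi> h * \<phi> (h' + \<beta> (1 / q))) \<le> 0 + e" if e: "e > 0" for h h' e
    proof -
      obtain L0 :: nat where L0: "4 / e < real L0" using reals_Archimedean2 by blast
      have "norm (F L (h + \<beta> (1 / q)) * F L h' - F L h * F L (h' + \<beta> (1 / q))) \<le> e" if L: "L \<ge> max q L0" for L
      proof -
        have "q dvd fact L" using q L by (intro dvd_fact) auto
        then obtain m where "fact L = q * m" by auto
        then have m: "fact L = real q * real m" by (metis of_nat_fact of_nat_mult)
        have "real m \<noteq> 0" using m fact_nonzero[of L, where 'a = real] by auto
        then have "real m / fact L = 1 / q" unfolding m by simp
        then have cq: "c L m = \<beta> (1 / q)" by (simp only: c_def)
        have "1 * real m \<le> real q * real m" using q by (intro mult_right_mono) auto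
        then have "4 * real m / n L \<le> 4 * fact L / n L"
          by (intro divide_right_mono mult_left_mono) (auto simp: m)
        also have "\<dots> = 4 / real (Suc L)" unfolding n_def of_nat_mult by simp
        also have "\<dots> \<le> e" using L L0 e by (simp add: field_simps) (smt (verit) mult_left_mono of_nat_mono)
        finally show ?thesis using Fshift[of L h m h'] by (simp add: cq)
      qed
      then have "eventually (\<lambda>L. F L \<in> {\<phi>. norm (\<phi> (h + \<beta> (1 / q)) * \<phi> h' - \<phi> h * \<phi> (h' + \<beta> (1 / q))) \<le> e}) sequentially"
        by (intro eventually_sequentiallyI[of "max q L0"]) auto
      then have "\<phi> \<in> {\<phi>. norm (\<phi> (h + \<beta> (1 / q)) * \<phi> h' - \<phi> h * \<phi> (h' + \<beta> (1 / q))) \<le> e}"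
        by (rule \<phi>[rotated]) (intro closed_Collect_le continuous_intros coord)
      then show ?thesis by simp
    qed
    then have "norm (\<phi> (h + \<beta> (1 / q)) * \<phi> h' - \<phi> h * \<phi> (h' + \<beta> (1 / q))) \<le> 0" for h h'
      by (rule field_le_epsilon)
    then show ?thesis by (simp add: P_def)
  qed
  have P0: "0 \<in> P" by (simp add: P_def)
  have \<beta>0: "\<beta> 0 = 0" using add[of 0 0] by simp
  have \<beta>minus: "\<beta> (- t) = - \<beta> t" for t using add[of t "- t"] \<beta>0 by (simp add: eq_neg_iff_add_eq_0 add.commute)
  have Prat: "\<beta> (real m / real q) \<in> P" if q: "q > 0" for m q :: nat
  proof (induction m)
    case 0 then show ?case using P0 \<beta>0 by simp
  next
    case (Suc m)
    have "\<beta> (real (Suc m) / real q) = \<beta> (real m / real q) + \<beta> (1 / real q)"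
      by (simp add: add[symmetric] add_divide_distrib add.commute)
    then show ?case using Padd Suc Pnat[OF q] by simp
  qed
  have "r \<in> \<rat> \<Longrightarrow> r \<in> \<beta> -` P" for r
  proof -
    assume r: "r \<in> \<rat>"
    then have "\<bar>r\<bar> \<in> \<rat>" by simp
    then obtain m q where "q \<noteq> 0" "\<bar>r\<bar> = real m / real q" by (metis Rats_abs_nat_div_natE abs_idempotent)
    then have 1: "\<beta> \<bar>r\<bar> \<in> P" using Prat by simp
    show ?thesis
    proof (cases "r \<ge> 0")
      case True then show ?thesis using 1 by simp
    next
      case False
      then have "\<beta> r = - \<beta> \<bar>r\<bar>" by (simp flip: \<beta>minus)
      then show ?thesis using Pminus[OF 1] by simp
    qed
  qed
  moreover have "closed (\<beta> -` P)" using Pclosed cont\<beta> by (rule closed_vimage)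
  ultimately have "closure \<rat> \<subseteq> \<beta> -` P" by (intro closure_minimal) auto
  then have "range \<beta> \<subseteq> P" by (auto simp: Rats_closure_real)
  then have "closure (range \<beta>) \<subseteq> P" using Pclosed by (rule closure_minimal)
  then have P: "\<phi> (h + k) * \<phi> h' = \<phi> h * \<phi> (h' + k)" for h k h' using dense by (auto simp: P_def)
  obtain h0 where h0: "\<phi> h0 \<noteq> 0"
  proof (cases "\<phi> 0 = 0")
    case True then show ?thesis using \<phi>a C by (intro that[of a]) auto
  qed (use that in auto)
  define \<gamma> where "\<gamma> k = \<phi> (h0 + k) / \<phi> h0" for k
  have mult: "\<gamma> (k + l) = \<gamma> k * \<gamma> l" for k l
  proof -
    have "\<phi> (h0 + (k + l)) * \<phi> h0 = \<phi> (h0 + k) * \<phi> (h0 + l)"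
      using P[of "h0 + k" l h0] by (simp add: add.assoc)
    then show ?thesis using h0 by (simp add: \<gamma>_def field_simps)
  qed
  have one: "\<gamma> 0 = 1" using h0 by (simp add: \<gamma>_def)
  have "norm (\<gamma> x) = 1" for x
    using mult one
  proof (rule norm_bounded_multiplicative_eq_1)
    show "norm (\<gamma> x) \<le> 1 / norm (\<phi> h0)" for x
      unfolding \<gamma>_def norm_divide by (intro divide_right_mono \<phi>B) auto
  qed
  moreover have "continuous_on UNIV \<gamma>"
    unfolding \<gamma>_def by (intro continuous_intros continuous_on_compose2[OF cont\<phi>] h0) (use h0 in auto)
  ultimately have "group_character \<gamma>" using mult by (simp add: group_character_def)
  moreover have "\<gamma> a \<noteq> 1"
  proof
    assume "\<gamma> a = 1"
    then have "\<phi> (h0 + a) = \<phi> h0" using h0 by (simp add: \<gamma>_def field_simps)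
    then have "\<phi> a = \<phi> 0" using P[of 0 a h0] h0 by simp
    then show False using \<phi>a C by simp
  qed
  ultimately show ?thesis by (rule that)
qed

section \<open>Stone-Weierstrass and determination of complex measures\<close>

text \<open>The complex linear span of a set of functions, generated step by step so that closure properties
  follow by induction.\<close>

inductive_set complex_span :: "('a \<Rightarrow> complex) set \<Rightarrow> ('a \<Rightarrow> complex) set" for A where
  zero: "(\<lambda>x. 0) \<in> complex_span A"
| step: "p \<in> complex_span A \<Longrightarrow> \<gamma> \<in> A \<Longrightarrow> (\<lambda>x. c * \<gamma> x + p x) \<in> complex_span A"

lemma complex_span_base: "\<gamma> \<in> A \<Longrightarrow> \<gamma> \<in> complex_span A"
  using complex_span.step[OF complex_span.zero, of \<gamma> A 1] by simp

lemma complex_span_add: "p \<in> complex_span A \<Longrightarrow> q \<in> complex_span A \<Longrightarrow> (\<lambda>x. p x + q x) \<in> complex_span A"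
proof (induction rule: complex_span.induct)
  case (step p \<gamma> c)
  then show ?case using complex_span.step[of "\<lambda>x. p x + q x" A \<gamma> c] by (simp add: add.assoc)
qed simp

lemma complex_span_scale: "p \<in> complex_span A \<Longrightarrow> (\<lambda>x. c * p x) \<in> complex_span A"
proof (induction rule: complex_span.induct)
  case (step p \<gamma> d)
  then show ?case using complex_span.step[of "\<lambda>x. c * p x" A \<gamma> "c * d"] by (simp add: algebra_simps)
qed (simp add: complex_span.zero)

lemma complex_span_mult:
  assumes A: "\<And>\<gamma> \<delta>. \<gamma> \<in> A \<Longrightarrow> \<delta> \<in> A \<Longrightarrow> (\<lambda>x. \<gamma> x * \<delta> x) \<in> A"
    and p: "p \<in> complex_span A" and q: "q \<in> complex_span A"
  shows "(\<lambda>x. p x * q x) \<in> complex_span A"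
proof -
  have one: "(\<lambda>x. \<gamma> x * q x) \<in> complex_span A" if "\<gamma> \<in> A" for \<gamma>
    using q
  proof (induction rule: complex_span.induct)
    case (step q \<delta> c)
    then show ?case using complex_span.step[of "\<lambda>x. \<gamma> x * q x" A "\<lambda>x. \<gamma> x * \<delta> x" c] A[OF that]
      by (simp add: algebra_simps)
  qed (simp add: complex_span.zero)
  show ?thesis using p
  proof (induction rule: complex_span.induct)
    case (step p \<gamma> c)
    from complex_span_add[OF complex_span_scale[OF one[OF step.hyps(2)], of c] step.IH]
    show ?case by (simp add: algebra_simps)
  qed (simp add: complex_span.zero)
qed

lemma complex_span_continuous:
  assumes "\<And>\<gamma>. \<gamma> \<in> A \<Longrightarrow> continuous_on S \<gamma>" and "p \<in> complex_span A"
  shows "continuous_on S p"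
  using assms(2)
proof (induction rule: complex_span.induct)
  case (step p \<gamma> c)
  have "continuous_on S \<gamma>" using assms(1) step.hyps(2) .
  then show ?case using step.IH by (intro continuous_intros)
qed simp

text \<open>Reduces to the real theorem: the real functions whose complexification lies in the span form a
  function ring, and this ring contains the real and imaginary parts of the members of \<open>A\<close> because
  \<open>A\<close> is closed under conjugation.\<close>

theorem complex_Stone_Weierstrass:
  fixes S :: "'a::t2_space set"
  assumes S: "compact S" and cont: "\<And>\<gamma>. \<gamma> \<in> A \<Longrightarrow> continuous_on S \<gamma>"
    and one: "(\<lambda>x. 1) \<in> A"
    and mult: "\<And>\<gamma> \<delta>. \<gamma> \<in> A \<Longrightarrow> \<delta> \<in> A \<Longrightarrow> (\<lambda>x. \<gamma> x * \<delta> x) \<in> A"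
    and cnj: "\<And>\<gamma>. \<gamma> \<in> A \<Longrightarrow> (\<lambda>x. cnj (\<gamma> x)) \<in> A"
    and sep: "\<And>x y. x \<in> S \<Longrightarrow> y \<in> S \<Longrightarrow> x \<noteq> y \<Longrightarrow> \<exists>\<gamma>\<in>A. \<gamma> x \<noteq> \<gamma> y"
    and u: "continuous_on S u" and e: "e > 0"
  shows "\<exists>p\<in>complex_span A. \<forall>x\<in>S. norm (u x - p x) < e"
proof -
  define R where "R = {r. continuous_on S r \<and> (\<lambda>x. complex_of_real (r x)) \<in> complex_span A}"
  have ReIm: "(\<lambda>x. Re (\<gamma> x)) \<in> R" "(\<lambda>x. Im (\<gamma> x)) \<in> R" if "\<gamma> \<in> A" for \<gamma>
  proof -
    have m: "\<gamma> \<in> complex_span A" "(\<lambda>x. cnj (\<gamma> x)) \<in> complex_span A"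
      using that cnj by (auto intro: complex_span_base)
    have "(\<lambda>x. 1/2 * \<gamma> x + 1/2 * cnj (\<gamma> x)) \<in> complex_span A"
      by (intro complex_span_add complex_span_scale m)
    moreover have "(\<lambda>x. 1/2 * \<gamma> x + 1/2 * cnj (\<gamma> x)) = (\<lambda>x. complex_of_real (Re (\<gamma> x)))"
      by (auto simp: complex_eq_iff)
    ultimately show "(\<lambda>x. Re (\<gamma> x)) \<in> R" using cont[OF that] by (auto simp: R_def intro!: continuous_intros)
    have "(\<lambda>x. -\<i>/2 * \<gamma> x + \<i>/2 * cnj (\<gamma> x)) \<in> complex_span A"
      by (intro complex_span_add complex_span_scale m)
    moreover have "(\<lambda>x. -\<i>/2 * \<gamma> x + \<i>/2 * cnj (\<gamma> x)) = (\<lambda>x. complex_of_real (Im (\<gamma> x)))"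
      by (auto simp: complex_eq_iff)
    ultimately show "(\<lambda>x. Im (\<gamma> x)) \<in> R" using cont[OF that] by (auto simp: R_def intro!: continuous_intros)
  qed
  interpret function_ring_on R S
  proof
    show "compact S" by fact
    show "continuous_on S f" if "f \<in> R" for f using that by (simp add: R_def)
    show "(\<lambda>x. f x + g x) \<in> R" if "f \<in> R" "g \<in> R" for f g
      using that complex_span_add[of "\<lambda>x. complex_of_real (f x)" A "\<lambda>x. complex_of_real (g x)"]
      by (auto simp: R_def intro: continuous_intros)
    show "(\<lambda>x. f x * g x) \<in> R" if "f \<in> R" "g \<in> R" for f g
    proof -
      have fg: "continuous_on S f" "continuous_on S g"
        "(\<lambda>x. complex_of_real (f x)) \<in> complex_span A" "(\<lambda>x. complex_of_real (g x)) \<in> complex_span A"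
        using that by (simp_all add: R_def)
      have "(\<lambda>x. complex_of_real (f x) * complex_of_real (g x)) \<in> complex_span A"
        by (rule complex_span_mult[OF _ fg(3,4)]) (rule mult)
      then show ?thesis using fg(1,2) by (simp add: R_def continuous_on_mult)
    qed
    show "(\<lambda>x. c) \<in> R" for c
      using complex_span_scale[OF complex_span_base[OF one], of "of_real c"] by (simp add: R_def)
    show "\<exists>f\<in>R. f x \<noteq> f y" if xy: "x \<in> S" "y \<in> S" "x \<noteq> y" for x y
    proof -
      obtain \<gamma> where "\<gamma> \<in> A" "\<gamma> x \<noteq> \<gamma> y" using sep[OF xy] by blast
      then have "Re (\<gamma> x) \<noteq> Re (\<gamma> y) \<or> Im (\<gamma> x) \<noteq> Im (\<gamma> y)" by (simp add: complex_eq_iff)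
      then show ?thesis
      proof
        assume "Re (\<gamma> x) \<noteq> Re (\<gamma> y)"
        then show ?thesis by (rule bexI[OF _ ReIm(1)[OF \<open>\<gamma> \<in> A\<close>]])
      next
        assume "Im (\<gamma> x) \<noteq> Im (\<gamma> y)"
        then show ?thesis by (rule bexI[OF _ ReIm(2)[OF \<open>\<gamma> \<in> A\<close>]])
      qed
    qed
  qed
  have approx: "\<exists>r\<in>R. \<forall>x\<in>S. \<bar>v x - r x\<bar> < e / 2" if v: "continuous_on S v" for v
    by (rule Stone_Weierstrass_basic[OF v half_gt_zero[OF e]])
  from approx[OF continuous_on_Re[OF u]]
  obtain r where r: "r \<in> R" "\<forall>x\<in>S. \<bar>Re (u x) - r x\<bar> < e / 2" by (rule bexE)
  from approx[OF continuous_on_Im[OF u]]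
  obtain s where s: "s \<in> R" "\<forall>x\<in>S. \<bar>Im (u x) - s x\<bar> < e / 2" by (rule bexE)
  show ?thesis
  proof (intro bexI ballI)
    fix x assume x: "x \<in> S"
    have "norm (u x - (of_real (r x) + \<i> * of_real (s x)))
        \<le> \<bar>Re (u x - (of_real (r x) + \<i> * of_real (s x)))\<bar> + \<bar>Im (u x - (of_real (r x) + \<i> * of_real (s x)))\<bar>"
      by (rule cmod_le)
    then show "norm (u x - (of_real (r x) + \<i> * of_real (s x))) < e"
      using bspec[OF r(2) x] bspec[OF s(2) x] by simp
  next
    have "(\<lambda>x. complex_of_real (r x)) \<in> complex_span A" "(\<lambda>x. complex_of_real (s x)) \<in> complex_span A"
      using r(1) s(1) unfolding R_def by blast+
    then show "(\<lambda>x. of_real (r x) + \<i> * of_real (s x)) \<in> complex_span A"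
      by (intro complex_span_add complex_span_scale)
  qed
qed

lemma integrable_mult_bounded:
  fixes h v :: "'a \<Rightarrow> complex"
  assumes "integrable M h" "v \<in> borel_measurable M" "\<And>x. x \<in> space M \<Longrightarrow> norm (v x) \<le> B"
  shows "integrable M (\<lambda>x. h x * v x)"
proof (rule Bochner_Integration.integrable_bound)
  show "integrable M (\<lambda>x. B * norm (h x))" using assms(1) by auto
  show "AE x in M. norm (h x * v x) \<le> norm (B * norm (h x))"
  proof (rule AE_I2)
    fix x assume "x \<in> space M"
    then have "norm (v x) * norm (h x) \<le> B * norm (h x)" by (intro mult_right_mono assms(3)) auto
    then show "norm (h x * v x) \<le> norm (B * norm (h x))" by (simp add: norm_mult mult.commute)
  qed
qed (use assms in measurable)

text \<open>Two densities on possibly different spaces, each mapped to the compact set \<open>S\<close>, are compared. With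
  \<open>h2 = 0\<close> this is a uniqueness statement for one density, with \<open>h1 = h2 = 1\<close> one for image measures.\<close>

lemma integral_determined_by_separating_family:
  fixes S :: "'b::t2_space set" and \<Phi>1 :: "'a \<Rightarrow> 'b" and \<Phi>2 :: "'c \<Rightarrow> 'b"
    and h1 :: "'a \<Rightarrow> complex" and h2 :: "'c \<Rightarrow> complex"
  assumes S: "compact S" and cont: "\<And>\<gamma>. \<gamma> \<in> A \<Longrightarrow> continuous_on UNIV \<gamma>"
    and one: "(\<lambda>x. 1) \<in> A"
    and mult: "\<And>\<gamma> \<delta>. \<gamma> \<in> A \<Longrightarrow> \<delta> \<in> A \<Longrightarrow> (\<lambda>x. \<gamma> x * \<delta> x) \<in> A"
    and cnj: "\<And>\<gamma>. \<gamma> \<in> A \<Longrightarrow> (\<lambda>x. cnj (\<gamma> x)) \<in> A"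
    and sep: "\<And>x y. x \<in> S \<Longrightarrow> y \<in> S \<Longrightarrow> x \<noteq> y \<Longrightarrow> \<exists>\<gamma>\<in>A. \<gamma> x \<noteq> \<gamma> y"
    and \<Phi>1: "\<Phi>1 \<in> M1 \<rightarrow>\<^sub>M borel" "\<And>x. x \<in> space M1 \<Longrightarrow> \<Phi>1 x \<in> S"
    and \<Phi>2: "\<Phi>2 \<in> M2 \<rightarrow>\<^sub>M borel" "\<And>x. x \<in> space M2 \<Longrightarrow> \<Phi>2 x \<in> S"
    and h: "integrable M1 h1" "integrable M2 h2"
    and eq: "\<And>\<gamma>. \<gamma> \<in> A \<Longrightarrow> (\<integral>x. h1 x * \<gamma> (\<Phi>1 x) \<partial>M1) = (\<integral>x. h2 x * \<gamma> (\<Phi>2 x) \<partial>M2)"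
    and u: "continuous_on UNIV u"
  shows "(\<integral>x. h1 x * u (\<Phi>1 x) \<partial>M1) = (\<integral>x. h2 x * u (\<Phi>2 x) \<partial>M2)"
proof -
  have int: "integrable M (\<lambda>x. h x * v (\<Phi> x))"
    if "integrable M h" "\<Phi> \<in> M \<rightarrow>\<^sub>M borel" "\<And>x. x \<in> space M \<Longrightarrow> \<Phi> x \<in> S" "continuous_on UNIV v"
    for M :: "'d measure" and h \<Phi> and v :: "'b \<Rightarrow> complex"
  proof -
    have "bounded (v ` S)"
      using compact_continuous_image[OF continuous_on_subset[OF that(4)] S] by (intro compact_imp_bounded) auto
    then obtain B where B: "\<And>x. x \<in> S \<Longrightarrow> norm (v x) \<le> B" unfolding bounded_iff by blast
    have vm: "(\<lambda>x. v (\<Phi> x)) \<in> borel_measurable M"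
      using borel_measurable_continuous_onI[OF that(4)] that(2) by (rule measurable_compose[rotated])
    show ?thesis by (rule integrable_mult_bounded[OF that(1) vm]) (rule B[OF that(3)])
  qed
  have spanc: "continuous_on UNIV p" if "p \<in> complex_span A" for p
    using cont that by (rule complex_span_continuous)
  have eqspan: "(\<integral>x. h1 x * p (\<Phi>1 x) \<partial>M1) = (\<integral>x. h2 x * p (\<Phi>2 x) \<partial>M2)" if "p \<in> complex_span A" for p
    using that
  proof (induction rule: complex_span.induct)
    case (step p \<gamma> c)
    have "(\<integral>x. h1 x * (c * \<gamma> (\<Phi>1 x) + p (\<Phi>1 x)) \<partial>M1) = c * (\<integral>x. h1 x * \<gamma> (\<Phi>1 x) \<partial>M1) + (\<integral>x. h1 x * p (\<Phi>1 x) \<partial>M1)"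
      using int[OF h(1) \<Phi>1 cont[OF step.hyps(2)]] int[OF h(1) \<Phi>1 spanc[OF step.hyps(1)]]
      by (simp add: distrib_left mult.left_commute)
    also have "\<dots> = c * (\<integral>x. h2 x * \<gamma> (\<Phi>2 x) \<partial>M2) + (\<integral>x. h2 x * p (\<Phi>2 x) \<partial>M2)"
      using eq[OF step.hyps(2)] step.IH by simp
    also have "\<dots> = (\<integral>x. h2 x * (c * \<gamma> (\<Phi>2 x) + p (\<Phi>2 x)) \<partial>M2)"
      using int[OF h(2) \<Phi>2 cont[OF step.hyps(2)]] int[OF h(2) \<Phi>2 spanc[OF step.hyps(1)]]
      by (simp add: distrib_left mult.left_commute)
    finally show ?case .
  qed simp
  define H where "H = (\<integral>x. norm (h1 x) \<partial>M1) + (\<integral>x. norm (h2 x) \<partial>M2)"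
  have H: "H \<ge> 0" by (simp add: H_def)
  have err: "norm ((\<integral>x. h x * u (\<Phi> x) \<partial>M) - (\<integral>x. h x * p (\<Phi> x) \<partial>M)) \<le> e * (\<integral>x. norm (h x) \<partial>M)"
    if M: "integrable M h" "\<Phi> \<in> M \<rightarrow>\<^sub>M borel" "\<And>x. x \<in> space M \<Longrightarrow> \<Phi> x \<in> S"
      and p: "p \<in> complex_span A" "\<And>x. x \<in> S \<Longrightarrow> norm (u x - p x) < e"
    for M :: "'d measure" and h \<Phi> p e
  proof -
    have "(\<integral>x. h x * u (\<Phi> x) \<partial>M) - (\<integral>x. h x * p (\<Phi> x) \<partial>M) = (\<integral>x. h x * (u (\<Phi> x) - p (\<Phi> x)) \<partial>M)"
      using int[OF M u] int[OF M spanc[OF p(1)]] by (simp add: right_diff_distrib)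
    also have "norm \<dots> \<le> (\<integral>x. e * norm (h x) \<partial>M)"
    proof (rule order_trans[OF Bochner_Integration.integral_norm_bound integral_mono])
      show "integrable M (\<lambda>x. norm (h x * (u (\<Phi> x) - p (\<Phi> x))))"
        using int[OF M u] int[OF M spanc[OF p(1)]] by (intro integrable_norm) (simp add: right_diff_distrib)
      show "integrable M (\<lambda>x. e * norm (h x))" using M(1) by auto
      fix x assume "x \<in> space M"
      then have "norm (u (\<Phi> x) - p (\<Phi> x)) * norm (h x) \<le> e * norm (h x)"
        by (intro mult_right_mono less_imp_le[OF p(2)] M(3)) auto
      then show "norm (h x * (u (\<Phi> x) - p (\<Phi> x))) \<le> e * norm (h x)" by (simp add: norm_mult mult.commute)
    qed
    finally show ?thesis by simp
  qed
  have "norm ((\<integral>x. h1 x * u (\<Phi>1 x) \<partial>M1) - (\<integral>x. h2 x * u (\<Phi>2 x) \<partial>M2)) \<le> 0 + e" if e: "e > 0" for e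
  proof -
    define d where "d = e / (H + 1)"
    have d: "d > 0" "d * H \<le> e"
    proof -
      show "d > 0" using e H by (simp add: d_def)
      have "d * H \<le> d * (H + 1)" using \<open>d > 0\<close> by (intro mult_left_mono) auto
      then show "d * H \<le> e" using H by (simp add: d_def)
    qed
    have "\<exists>p\<in>complex_span A. \<forall>x\<in>S. norm (u x - p x) < d"
      by (rule complex_Stone_Weierstrass[OF S continuous_on_subset[OF cont subset_UNIV] one mult cnj sep
            continuous_on_subset[OF u subset_UNIV] d(1)])
    then obtain p where p: "p \<in> complex_span A" "\<And>x. x \<in> S \<Longrightarrow> norm (u x - p x) < d" by blast
    have "(\<integral>x. h1 x * u (\<Phi>1 x) \<partial>M1) - (\<integral>x. h2 x * u (\<Phi>2 x) \<partial>M2)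
      = ((\<integral>x. h1 x * u (\<Phi>1 x) \<partial>M1) - (\<integral>x. h1 x * p (\<Phi>1 x) \<partial>M1)) -
        ((\<integral>x. h2 x * u (\<Phi>2 x) \<partial>M2) - (\<integral>x. h2 x * p (\<Phi>2 x) \<partial>M2))"
      using eqspan[OF p(1)] by simp
    also have "norm \<dots> \<le> d * (\<integral>x. norm (h1 x) \<partial>M1) + d * (\<integral>x. norm (h2 x) \<partial>M2)"
      by (rule order_trans[OF norm_triangle_ineq4 add_mono[OF err[OF h(1) \<Phi>1 p] err[OF h(2) \<Phi>2 p]]])
    finally show ?thesis using d(2) by (simp add: H_def distrib_left)
  qed
  then have "norm ((\<integral>x. h1 x * u (\<Phi>1 x) \<partial>M1) - (\<integral>x. h2 x * u (\<Phi>2 x) \<partial>M2)) \<le> 0"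
    by (rule field_le_epsilon)
  then show ?thesis by simp
qed

lemma integral_mult_dominated_limit:
  fixes h :: "'a \<Rightarrow> complex" and v :: "nat \<Rightarrow> 'a \<Rightarrow> complex"
  assumes h: "integrable M h" and v: "\<And>n. v n \<in> borel_measurable M" "w \<in> borel_measurable M"
    and B: "\<And>n x. norm (v n x) \<le> 1"
    and lim: "AE x in M. (\<lambda>n. v n x) \<longlonglongrightarrow> w x"
  shows "(\<lambda>n. \<integral>x. h x * v n x \<partial>M) \<longlonglongrightarrow> (\<integral>x. h x * w x \<partial>M)"
proof (rule integral_dominated_convergence)
  show "integrable M (\<lambda>x. norm (h x))" using h by auto
  show "AE x in M. (\<lambda>n. h x * v n x) \<longlonglongrightarrow> h x * w x"
    using lim by eventually_elim (intro tendsto_intros)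
  show "AE x in M. norm (h x * v n x) \<le> norm (h x)" for n
    using B[of n] by (intro AE_I2) (simp add: norm_mult mult_left_le)
qed (use h v in measurable)

text \<open>The sets with the claimed property form a Dynkin system, and the open sets are a generator that is
  stable under intersection.\<close>

lemma integral_indicator_determined_by_open_sets:
  fixes \<Phi>1 :: "'a \<Rightarrow> 'b::topological_space" and \<Phi>2 :: "'c \<Rightarrow> 'b"
    and h1 :: "'a \<Rightarrow> complex" and h2 :: "'c \<Rightarrow> complex"
  assumes \<Phi>[measurable]: "\<Phi>1 \<in> M1 \<rightarrow>\<^sub>M borel" "\<Phi>2 \<in> M2 \<rightarrow>\<^sub>M borel"
    and h: "integrable M1 h1" "integrable M2 h2"
    and eq: "\<And>U. open U \<Longrightarrow> (\<integral>x. h1 x * indicator U (\<Phi>1 x) \<partial>M1) = (\<integral>x. h2 x * indicator U (\<Phi>2 x) \<partial>M2)"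
    and A: "A \<in> sets borel"
  shows "(\<integral>x. h1 x * indicator A (\<Phi>1 x) \<partial>M1) = (\<integral>x. h2 x * indicator A (\<Phi>2 x) \<partial>M2)"
proof -
  have int: "integrable M (\<lambda>x. h x * indicator B (\<Phi> x))"
    if [measurable]: "integrable M h" "\<Phi> \<in> M \<rightarrow>\<^sub>M borel" "B \<in> sets borel" for M :: "'d measure" and h :: "'d \<Rightarrow> complex" and \<Phi> and B :: "'b set"
    by (rule integrable_mult_bounded[where B = 1]) (use that in \<open>auto simp: indicator_def\<close>)
  have lim: "(\<lambda>n. \<integral>x. h x * indicator (\<Union>i<n. B i) (\<Phi> x) \<partial>M) \<longlonglongrightarrow> (\<integral>x. h x * indicator (\<Union>i. B i) (\<Phi> x) \<partial>M)"
    if [measurable]: "integrable M h" "\<Phi> \<in> M \<rightarrow>\<^sub>M borel" "\<And>i. B i \<in> sets borel"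
    for M :: "'d measure" and h :: "'d \<Rightarrow> complex" and \<Phi> and B :: "nat \<Rightarrow> 'b set"
  proof (rule integral_mult_dominated_limit)
    show "AE x in M. (\<lambda>n. indicator (\<Union>i<n. B i) (\<Phi> x)) \<longlonglongrightarrow> (indicator (\<Union>i. B i) (\<Phi> x) :: complex)"
      by (intro AE_I2 LIMSEQ_indicator_UN)
  qed (use that in \<open>auto simp: indicator_def\<close>)
  have fin: "(\<integral>x. h x * indicator (\<Union>i<n. B i) (\<Phi> x) \<partial>M) = (\<Sum>i<n. \<integral>x. h x * indicator (B i) (\<Phi> x) \<partial>M)"
    if "integrable M h" "\<Phi> \<in> M \<rightarrow>\<^sub>M borel" "\<And>i. B i \<in> sets borel" "disjoint_family B"
    for M :: "'d measure" and h :: "'d \<Rightarrow> complex" and \<Phi> and B :: "nat \<Rightarrow> 'b set" and n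
  proof -
    have "indicator (\<Union>i<n. B i) y = (\<Sum>i<n. indicator (B i) y :: complex)" for y
      by (rule indicator_UN_disjoint) (use that(4) in \<open>auto simp: disjoint_family_on_def\<close>)
    then have "(\<integral>x. h x * indicator (\<Union>i<n. B i) (\<Phi> x) \<partial>M) = (\<integral>x. (\<Sum>i<n. h x * indicator (B i) (\<Phi> x)) \<partial>M)"
      by (simp only: sum_distrib_left)
    also have "\<dots> = (\<Sum>i<n. \<integral>x. h x * indicator (B i) (\<Phi> x) \<partial>M)"
      by (rule Bochner_Integration.integral_sum) (rule int[OF that(1,2,3)])
    finally show ?thesis .
  qed
  have sets: "sets borel = sigma_sets UNIV {S :: 'b set. open S}" by (simp add: borel_def)
  have "Int_stable {S :: 'b set. open S}" "{S :: 'b set. open S} \<subseteq> Pow UNIV" by (auto simp: Int_stable_def)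
  from this A[unfolded sets] show ?thesis
  proof (induction rule: sigma_sets_induct_disjoint)
    case (basic A) then show ?case by (simp add: eq)
  next
    case empty then show ?case by simp
  next
    case (compl A)
    then have A: "A \<in> sets borel" by (simp add: sets)
    have *: "indicator (UNIV - A) y = (1 - indicator A y :: complex)" for y by (simp add: indicator_def)
    show ?case
      using compl.IH eq[of UNIV] int[OF h(1) \<Phi>(1) A] int[OF h(2) \<Phi>(2) A] h
      by (simp add: * right_diff_distrib)
  next
    case (union B)
    then have B: "B i \<in> sets borel" for i by (auto simp: sets)
    have "(\<integral>x. h1 x * indicator (\<Union>i<n. B i) (\<Phi>1 x) \<partial>M1) = (\<Sum>i<n. \<integral>x. h1 x * indicator (B i) (\<Phi>1 x) \<partial>M1)" for n
      by (rule fin[OF h(1) \<Phi>(1)]) (rule B union.hyps(1))+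
    moreover have "(\<integral>x. h2 x * indicator (\<Union>i<n. B i) (\<Phi>2 x) \<partial>M2) = (\<Sum>i<n. \<integral>x. h2 x * indicator (B i) (\<Phi>2 x) \<partial>M2)" for n
      by (rule fin[OF h(2) \<Phi>(2)]) (rule B union.hyps(1))+
    ultimately have eqn: "(\<lambda>n. \<integral>x. h1 x * indicator (\<Union>i<n. B i) (\<Phi>1 x) \<partial>M1)
        = (\<lambda>n. \<integral>x. h2 x * indicator (\<Union>i<n. B i) (\<Phi>2 x) \<partial>M2)"
      by (simp only: union.IH)
    have "(\<lambda>n. \<integral>x. h1 x * indicator (\<Union>i<n. B i) (\<Phi>1 x) \<partial>M1) \<longlonglongrightarrow> (\<integral>x. h1 x * indicator (\<Union>i. B i) (\<Phi>1 x) \<partial>M1)"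
      by (rule lim[OF h(1) \<Phi>(1)]) (rule B)
    moreover have "(\<lambda>n. \<integral>x. h1 x * indicator (\<Union>i<n. B i) (\<Phi>1 x) \<partial>M1) \<longlonglongrightarrow> (\<integral>x. h2 x * indicator (\<Union>i. B i) (\<Phi>2 x) \<partial>M2)"
      unfolding eqn by (rule lim[OF h(2) \<Phi>(2)]) (rule B)
    ultimately show ?case by (rule LIMSEQ_unique)
  qed
qed

text \<open>The indicator of \<open>U\<close> has to be a limit only almost everywhere: in a compact group that is not
  metrizable an open set is approximated through the regularity of the measure.\<close>

lemma integral_open_determined_by_continuous:
  fixes \<Phi>1 :: "'a \<Rightarrow> 'b::topological_space" and \<Phi>2 :: "'c \<Rightarrow> 'b"
    and h1 :: "'a \<Rightarrow> complex" and h2 :: "'c \<Rightarrow> complex" and u :: "nat \<Rightarrow> 'b \<Rightarrow> real"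
  assumes \<Phi>[measurable]: "\<Phi>1 \<in> M1 \<rightarrow>\<^sub>M borel" "\<Phi>2 \<in> M2 \<rightarrow>\<^sub>M borel"
    and h: "integrable M1 h1" "integrable M2 h2"
    and eq: "\<And>u. continuous_on UNIV u \<Longrightarrow> (\<integral>x. h1 x * u (\<Phi>1 x) \<partial>M1) = (\<integral>x. h2 x * u (\<Phi>2 x) \<partial>M2)"
    and U: "open U"
    and u: "\<And>n. continuous_on UNIV (u n)" "\<And>n y. u n y \<in> {0..1}"
    and lim: "AE x in M1. (\<lambda>n. u n (\<Phi>1 x)) \<longlonglongrightarrow> indicator U (\<Phi>1 x)"
      "AE x in M2. (\<lambda>n. u n (\<Phi>2 x)) \<longlonglongrightarrow> indicator U (\<Phi>2 x)"
  shows "(\<integral>x. h1 x * indicator U (\<Phi>1 x) \<partial>M1) = (\<integral>x. h2 x * indicator U (\<Phi>2 x) \<partial>M2)"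
proof -
  have [measurable]: "u n \<in> borel_measurable borel" for n using u(1) by (rule borel_measurable_continuous_onI)
  have [measurable]: "U \<in> sets borel" using U by simp
  have L: "(\<lambda>n. \<integral>x. h x * complex_of_real (u n (\<Phi> x)) \<partial>M) \<longlonglongrightarrow> (\<integral>x. h x * indicator U (\<Phi> x) \<partial>M)"
    if [measurable]: "integrable M h" "\<Phi> \<in> M \<rightarrow>\<^sub>M borel" and l: "AE x in M. (\<lambda>n. u n (\<Phi> x)) \<longlonglongrightarrow> indicator U (\<Phi> x)"
    for M :: "'d measure" and h :: "'d \<Rightarrow> complex" and \<Phi>
  proof (rule integral_mult_dominated_limit)
    show "AE x in M. (\<lambda>n. complex_of_real (u n (\<Phi> x))) \<longlonglongrightarrow> indicator U (\<Phi> x)"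
      using l
    proof eventually_elim
      case (elim x)
      from tendsto_of_real[OF this, where 'a = complex] show ?case by (auto simp: indicator_def)
    qed
    show "norm (complex_of_real (u n (\<Phi> x))) \<le> 1" for n x using u(2)[of n "\<Phi> x"] by simp
  qed (use that in auto)
  have "(\<lambda>n. \<integral>x. h1 x * complex_of_real (u n (\<Phi>1 x)) \<partial>M1) = (\<lambda>n. \<integral>x. h2 x * complex_of_real (u n (\<Phi>2 x)) \<partial>M2)"
    by (intro ext eq continuous_on_of_real u)
  with L[OF h(1) \<Phi>(1) lim(1)]
  have "(\<lambda>n. \<integral>x. h2 x * complex_of_real (u n (\<Phi>2 x)) \<partial>M2) \<longlonglongrightarrow> (\<integral>x. h1 x * indicator U (\<Phi>1 x) \<partial>M1)"
    by (simp only:)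
  then show ?thesis using L[OF h(2) \<Phi>(2) lim(2)] by (rule LIMSEQ_unique)
qed

lemma open_indicator_limit_of_continuous:
  fixes U :: "'a::metric_space set"
  assumes "open U"
  obtains u :: "nat \<Rightarrow> 'a \<Rightarrow> real" where "\<And>n. continuous_on UNIV (u n)" "\<And>n y. u n y \<in> {0..1}"
    "\<And>y. (\<lambda>n. u n y) \<longlonglongrightarrow> indicator U y"
proof (cases "U = UNIV")
  case True
  then show ?thesis by (intro that[of "\<lambda>_ _. 1"]) auto
next
  case False
  define u where "u n y = min 1 (real n * infdist y (- U))" for n y
  show ?thesis
  proof (rule that[of u])
    show "continuous_on UNIV (u n)" for n unfolding u_def by (intro continuous_intros)
    show "u n y \<in> {0..1}" for n y by (simp add: u_def infdist_nonneg)
    fix y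
    show "(\<lambda>n. u n y) \<longlonglongrightarrow> indicator U y"
    proof (cases "y \<in> U")
      case True
      then have pos: "infdist y (- U) > 0"
        using assms False by (intro infdist_pos_not_in_closed) auto
      obtain k :: nat where k: "1 / infdist y (- U) < real k" using reals_Archimedean2 by blast
      have "u n y = 1" if "n \<ge> k" for n
      proof -
        have "1 / infdist y (- U) \<le> real n" using k that by linarith
        then show ?thesis using pos by (simp add: u_def field_simps)
      qed
      then have "eventually (\<lambda>n. u n y = 1) sequentially" by (rule eventually_sequentiallyI)
      then show ?thesis using True by (simp add: tendsto_eventually)
    qed (simp add: u_def)
  qed
qed

section \<open>Moments on the infinite torus\<close>

lemma indices_infinity [simp]: "indices \<infinity> = UNIV"
  by (simp add: indices_def)

lemma multi_indices_zero: "(\<lambda>j. 0) \<in> multi_indices N"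
  by (simp add: multi_indices_def)

lemma multi_indices_add:
  assumes "k \<in> multi_indices N" "l \<in> multi_indices N"
  shows "(\<lambda>j. k j + l j) \<in> multi_indices N"
proof -
  have "{j. k j + l j \<noteq> 0} \<subseteq> {j. k j \<noteq> 0} \<union> {j. l j \<noteq> 0}" by auto
  then show ?thesis using assms by (auto simp: multi_indices_def intro: finite_subset)
qed

lemma multi_indices_uminus: "k \<in> multi_indices N \<Longrightarrow> (\<lambda>j. - k j) \<in> multi_indices N"
  by (simp add: multi_indices_def)

lemma multi_indices_single: "n \<in> indices N \<Longrightarrow> (\<lambda>j. if j = n then c else 0) \<in> multi_indices N"
  by (auto simp: multi_indices_def intro: finite_subset[of _ "{n}"])

lemma monomial_eq_prod:
  assumes "finite J" "{j. k j \<noteq> 0} \<subseteq> J"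
  shows "monomial k w = (\<Prod>j\<in>J. w j powi k j)"
  unfolding monomial_def by (rule prod.mono_neutral_left) (use assms in auto)

lemma monomial_zero [simp]: "monomial (\<lambda>j. 0) w = 1"
  by (simp add: monomial_def)

lemma monomial_single: "monomial (\<lambda>j. if j = n then 1 else 0) w = w n"
  by (subst monomial_eq_prod[of "{n}"]) auto

lemma monomial_add:
  assumes k: "k \<in> multi_indices N" and l: "l \<in> multi_indices N" and w: "\<And>j. j \<in> indices N \<Longrightarrow> w j \<noteq> 0"
  shows "monomial (\<lambda>j. k j + l j) w = monomial k w * monomial l w"
proof -
  define J where "J = {j. k j \<noteq> 0} \<union> {j. l j \<noteq> 0}"
  have J: "finite J" "J \<subseteq> indices N" using k l by (auto simp: J_def multi_indices_def)
  have "monomial (\<lambda>j. k j + l j) w = (\<Prod>j\<in>J. w j powi (k j + l j))"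
    by (rule monomial_eq_prod[OF J(1)]) (auto simp: J_def)
  also have "\<dots> = (\<Prod>j\<in>J. w j powi k j * w j powi l j)"
    using J w by (intro prod.cong refl power_int_add) auto
  also have "\<dots> = monomial k w * monomial l w"
    unfolding prod.distrib by (intro arg_cong2[where f = times] monomial_eq_prod[symmetric] J(1)) (auto simp: J_def)
  finally show ?thesis .
qed

lemma norm_monomial:
  assumes "k \<in> multi_indices N" "\<And>j. j \<in> indices N \<Longrightarrow> norm (w j) = 1"
  shows "norm (monomial k w) = 1"
proof -
  have "norm (w j powi k j) = 1" if "j \<in> {j. k j \<noteq> 0}" for j
    using assms that by (auto simp: multi_indices_def norm_power_int)
  then show ?thesis by (simp add: monomial_def prod_norm[symmetric])
qed

text \<open>On the unit torus inverse and conjugate coincide.\<close>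

lemma monomial_uminus:
  assumes k: "k \<in> multi_indices N" and w: "\<And>j. j \<in> indices N \<Longrightarrow> norm (w j) = 1"
  shows "monomial (\<lambda>j. - k j) w = cnj (monomial k w)"
proof -
  have nz: "w j \<noteq> 0" if "j \<in> indices N" for j using w[OF that] by auto
  have "monomial (\<lambda>j. - k j) w * monomial k w = 1"
    using monomial_add[OF multi_indices_uminus[OF k] k nz] by simp
  moreover have "cnj (monomial k w) * monomial k w = 1"
    using norm_monomial[OF k w] by (simp add: complex_norm_square[symmetric] mult.commute)
  ultimately show ?thesis
    by (metis mult_cancel_right zero_neq_one mult_zero_right)
qed

lemma monomial_eq_iff_quotient:
  assumes k: "k \<in> multi_indices N" and l: "l \<in> multi_indices N" and w: "\<And>j. j \<in> indices N \<Longrightarrow> norm (w j) = 1"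
  shows "monomial k w = monomial l w \<longleftrightarrow> monomial (\<lambda>j. k j + - l j) w = 1"
proof -
  have nz: "w j \<noteq> 0" if "j \<in> indices N" for j using w[OF that] by auto
  have 1: "monomial (\<lambda>j. k j + - l j) w = monomial k w * monomial (\<lambda>j. - l j) w"
    by (rule monomial_add[OF k multi_indices_uminus[OF l]]) (rule nz)
  have 2: "monomial (\<lambda>j. - l j) w = cnj (monomial l w)"
    by (rule monomial_uminus[OF l]) (rule w)
  have 3: "norm (monomial l w) = 1"
    by (rule norm_monomial[OF l]) (rule w)
  then have "monomial l w \<noteq> 0" by auto
  then show ?thesis unfolding 1 2 divide_conv_cnj[OF 3, symmetric] by simp
qed

lemma compact_infinite_torus: "compact {w :: nat \<Rightarrow> complex. \<forall>j. norm (w j) = 1}"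
proof -
  have "{w :: nat \<Rightarrow> complex. \<forall>j. norm (w j) = 1} = PiE UNIV (\<lambda>_. sphere 0 1)"
    by (auto simp: PiE_def)
  moreover have "compactin (product_topology (\<lambda>_. euclidean) UNIV) (PiE UNIV (\<lambda>_. sphere 0 1) :: (nat \<Rightarrow> complex) set)"
    by (subst compactin_PiE) auto
  ultimately show ?thesis by (simp add: euclidean_product_topology)
qed

text \<open>The trigonometric monomials span a separating algebra on the compact infinite torus. They are
  discontinuous where a coordinate vanishes, so the family \<open>\<A>\<close> consists of continuous functions
  that agree with a monomial on the torus.\<close>

theorem torus_moments_determine_measure:
  fixes \<Phi>1 :: "'a \<Rightarrow> nat \<Rightarrow> complex" and \<Phi>2 :: "'c \<Rightarrow> nat \<Rightarrow> complex"
    and h1 :: "'a \<Rightarrow> complex" and h2 :: "'c \<Rightarrow> complex"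
  assumes \<Phi>1: "\<Phi>1 \<in> M1 \<rightarrow>\<^sub>M borel" "\<And>x j. x \<in> space M1 \<Longrightarrow> norm (\<Phi>1 x j) = 1"
    and \<Phi>2: "\<Phi>2 \<in> M2 \<rightarrow>\<^sub>M borel" "\<And>x j. x \<in> space M2 \<Longrightarrow> norm (\<Phi>2 x j) = 1"
    and h: "integrable M1 h1" "integrable M2 h2"
    and eq: "\<And>k. k \<in> multi_indices \<infinity> \<Longrightarrow>
        (\<integral>x. h1 x * monomial k (\<Phi>1 x) \<partial>M1) = (\<integral>x. h2 x * monomial k (\<Phi>2 x) \<partial>M2)"
    and A: "A \<in> sets borel"
  shows "(\<integral>x. h1 x * indicator A (\<Phi>1 x) \<partial>M1) = (\<integral>x. h2 x * indicator A (\<Phi>2 x) \<partial>M2)"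
proof -
  define T where "T = {w :: nat \<Rightarrow> complex. \<forall>j. norm (w j) = 1}"
  have nz: "w j \<noteq> 0" if "w \<in> T" for w j
  proof -
    have "norm (w j) = 1" using that by (simp add: T_def)
    then show ?thesis by auto
  qed
  define \<A> where "\<A> = {\<gamma>. continuous_on UNIV \<gamma> \<and> (\<exists>k\<in>multi_indices \<infinity>. \<forall>w\<in>T. \<gamma> w = monomial k w)}"
  have cont_eq: "(\<integral>x. h1 x * u (\<Phi>1 x) \<partial>M1) = (\<integral>x. h2 x * u (\<Phi>2 x) \<partial>M2)" if u: "continuous_on UNIV u" for u
  proof (rule integral_determined_by_separating_family[where S = T and A = \<A> and ?\<Phi>1.0 = \<Phi>1 and ?\<Phi>2.0 = \<Phi>2])
    show "compact T" using compact_infinite_torus by (simp add: T_def)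
    show "(\<lambda>x. 1) \<in> \<A>" unfolding \<A>_def by (auto intro!: bexI[OF _ multi_indices_zero])
    show "continuous_on UNIV \<gamma>" if "\<gamma> \<in> \<A>" for \<gamma> using that by (simp add: \<A>_def)
    show "(\<lambda>x. \<gamma> x * \<delta> x) \<in> \<A>" if mem: "\<gamma> \<in> \<A>" "\<delta> \<in> \<A>" for \<gamma> \<delta>
    proof -
      obtain k l where k: "k \<in> multi_indices \<infinity>" "l \<in> multi_indices \<infinity>"
        "\<forall>w\<in>T. \<gamma> w = monomial k w" "\<forall>w\<in>T. \<delta> w = monomial l w" using mem unfolding \<A>_def by blast
      have "\<forall>w\<in>T. \<gamma> w * \<delta> w = monomial (\<lambda>j. k j + l j) w"
      proof
        fix w assume w: "w \<in> T"
        have "monomial (\<lambda>j. k j + l j) w = monomial k w * monomial l w"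
          by (rule monomial_add[OF k(1,2)]) (rule nz[OF w])
        then show "\<gamma> w * \<delta> w = monomial (\<lambda>j. k j + l j) w" using k(3,4) w by simp
      qed
      then show ?thesis using mem multi_indices_add[OF k(1,2)] by (auto simp: \<A>_def intro: continuous_on_mult)
    qed
    show "(\<lambda>x. cnj (\<gamma> x)) \<in> \<A>" if mem: "\<gamma> \<in> \<A>" for \<gamma>
    proof -
      obtain k where k: "k \<in> multi_indices \<infinity>" "\<forall>w\<in>T. \<gamma> w = monomial k w" using mem unfolding \<A>_def by blast
      have "\<forall>w\<in>T. cnj (\<gamma> w) = monomial (\<lambda>j. - k j) w"
        using k(2) monomial_uminus[OF k(1)] by (simp add: T_def)
      then show ?thesis using mem multi_indices_uminus[OF k(1)] by (auto simp: \<A>_def intro: continuous_on_cnj)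
    qed
    show "\<exists>\<gamma>\<in>\<A>. \<gamma> x \<noteq> \<gamma> y" if xy: "x \<noteq> y" for x y
    proof -
      obtain j where j: "x j \<noteq> y j" using xy by auto
      have "(\<lambda>w. w j) \<in> \<A>"
        unfolding \<A>_def using multi_indices_single[of j \<infinity> 1] monomial_single[of j]
        by (auto intro!: bexI[of _ "\<lambda>i. if i = j then 1 else 0"] continuous_on_product_coordinates)
      then show ?thesis using j by (intro bexI[of _ "\<lambda>w. w j"])
    qed
    show "(\<integral>x. h1 x * \<gamma> (\<Phi>1 x) \<partial>M1) = (\<integral>x. h2 x * \<gamma> (\<Phi>2 x) \<partial>M2)" if \<gamma>: "\<gamma> \<in> \<A>" for \<gamma>
    proof -
      obtain k where k: "k \<in> multi_indices \<infinity>" "\<And>w. w \<in> T \<Longrightarrow> \<gamma> w = monomial k w" using \<gamma> unfolding \<A>_def by blast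
      have "(\<integral>x. h1 x * \<gamma> (\<Phi>1 x) \<partial>M1) = (\<integral>x. h1 x * monomial k (\<Phi>1 x) \<partial>M1)"
        by (rule Bochner_Integration.integral_cong) (simp_all add: k(2) T_def \<Phi>1)
      moreover have "(\<integral>x. h2 x * \<gamma> (\<Phi>2 x) \<partial>M2) = (\<integral>x. h2 x * monomial k (\<Phi>2 x) \<partial>M2)"
        by (rule Bochner_Integration.integral_cong) (simp_all add: k(2) T_def \<Phi>2)
      ultimately show ?thesis using eq[OF k(1)] by simp
    qed
  qed (use \<Phi>1 \<Phi>2 h u in \<open>simp_all add: T_def\<close>)
  show ?thesis
  proof (rule integral_indicator_determined_by_open_sets[OF \<Phi>1(1) \<Phi>2(1) h _ A])
    fix U :: "(nat \<Rightarrow> complex) set" assume U: "open U"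
    obtain u :: "nat \<Rightarrow> (nat \<Rightarrow> complex) \<Rightarrow> real" where u: "\<And>n. continuous_on UNIV (u n)" "\<And>n y. u n y \<in> {0..1}"
        "\<And>y. (\<lambda>n. u n y) \<longlonglongrightarrow> indicator U y"
      by (rule open_indicator_limit_of_continuous[OF U]) (rule that)
    show "(\<integral>x. h1 x * indicator U (\<Phi>1 x) \<partial>M1) = (\<integral>x. h2 x * indicator U (\<Phi>2 x) \<partial>M2)"
      by (rule integral_open_determined_by_continuous[OF \<Phi>1(1) \<Phi>2(1) h _ U u(1,2)])
        (auto intro!: cont_eq continuous_on_of_real u(3))
  qed
qed

section \<open>Fourier coefficients on a Dirichlet group\<close>

lemma group_character_mult:
  "group_character \<gamma> \<Longrightarrow> group_character \<delta> \<Longrightarrow> group_character (\<lambda>x. \<gamma> x * \<delta> x)"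
  by (auto simp: group_character_def norm_mult mult_ac intro: continuous_on_mult)

lemma group_character_cnj: "group_character \<gamma> \<Longrightarrow> group_character (\<lambda>x. cnj (\<gamma> x))"
  by (auto simp: group_character_def intro: continuous_on_cnj)

lemma group_character_one: "group_character (\<lambda>x. 1)"
  by (simp add: group_character_def)

lemma group_character_diff:
  assumes \<gamma>: "group_character \<gamma>" and xy: "\<gamma> (x - y) \<noteq> 1"
  shows "\<gamma> x \<noteq> \<gamma> y"
proof
  assume eq: "\<gamma> x = \<gamma> y"
  have "\<gamma> ((x - y) + y) = \<gamma> (x - y) * \<gamma> y" using \<gamma> unfolding group_character_def by blast
  moreover have "norm (\<gamma> y) = 1" using \<gamma> unfolding group_character_def by blast
  then have "\<gamma> y \<noteq> 0" by auto
  ultimately show False using eq xy by simp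
qed

lemma borel_measurable_group_character:
  assumes "sets m = sets borel" "group_character \<gamma>"
  shows "\<gamma> \<in> borel_measurable m"
proof -
  have "\<gamma> \<in> borel_measurable borel"
    using assms(2) by (intro borel_measurable_continuous_onI) (simp add: group_character_def)
  then show ?thesis unfolding measurable_cong_sets[OF assms(1) refl, of borel] .
qed

text \<open>The characters separate points, so \<open>f\<close> integrates to \<open>0\<close> against every continuous function. An
  open set is filled up to a null set by countably many compact subsets, and Urysohn functions
  for these converge almost everywhere to its indicator; hence \<open>f\<close> integrates to \<open>0\<close> over every Borel
  set.\<close>

theorem group_fourier_coefficients_determine:
  fixes \<beta> :: "real \<Rightarrow> 'g::{topological_ab_group_add, t2_space}" and m :: "'g measure"
  assumes G: "dirichlet_group \<beta>" and m: "normalized_haar m" and f: "integrable m f"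
    and coeff: "\<And>\<gamma>. group_character \<gamma> \<Longrightarrow> (\<integral>x. f x * \<gamma> x \<partial>m) = 0"
  shows "AE x in m. f x = 0"
proof -
  have sets: "sets m = sets borel" and prob: "prob_space m"
    and reg: "\<And>A. A \<in> sets m \<Longrightarrow> emeasure m A = (SUP K \<in> {K. compact K \<and> K \<subseteq> A}. emeasure m K)"
    using m by (auto simp: normalized_haar_def)
  interpret prob_space m by fact
  have comp: "compact (UNIV :: 'g set)" using G by (simp add: dirichlet_group_def)
  have id: "(\<lambda>x. x) \<in> m \<rightarrow>\<^sub>M borel" using sets by (simp add: measurable_ident_sets)
  have zero: "integrable m (\<lambda>x. 0 :: complex)" by simp
  have cont_zero: "(\<integral>x. f x * u x \<partial>m) = (\<integral>x. 0 * u x \<partial>m)" if "continuous_on UNIV u" for u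
  proof (rule integral_determined_by_separating_family[where S = UNIV and A = "Collect group_character" and ?\<Phi>1.0 = "\<lambda>x. x" and ?\<Phi>2.0 = "\<lambda>x. x"])
    fix x y :: 'g assume "x \<noteq> y"
    then have "x - y \<noteq> 0" by simp
    from characters_separate_points[OF G this] obtain \<gamma> where "group_character \<gamma>" "\<gamma> (x - y) \<noteq> 1" .
    then show "\<exists>\<gamma>\<in>Collect group_character. \<gamma> x \<noteq> \<gamma> y" using group_character_diff by blast
  next
    show "continuous_on UNIV \<gamma>" if "\<gamma> \<in> Collect group_character" for \<gamma> :: "'g \<Rightarrow> complex"
      using that by (simp add: group_character_def)
  qed (use comp id f coeff that in \<open>auto simp: group_character_mult group_character_cnj group_character_one\<close>)
  have open_zero: "(\<integral>x. f x * indicator U x \<partial>m) = (\<integral>x. 0 * indicator U x \<partial>m)" if U: "open U" for U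
  proof -
    have Um: "U \<in> sets m" using U sets by simp
    have "\<exists>K. compact K \<and> K \<subseteq> U \<and> emeasure m U < emeasure m K + ennreal (1 / real (Suc n))" for n
    proof -
      show ?thesis
      proof (rule ccontr)
        assume a: "\<not> ?thesis"
        let ?I = "{K. compact K \<and> K \<subseteq> U}" and ?e = "ennreal (1 / real (Suc n))"
        have "{} \<in> ?I" by simp
        then have ne: "?I \<noteq> {}" by blast
        have "(SUP K\<in>?I. emeasure m K) + ?e = (SUP K\<in>?I. emeasure m K + ?e)"
          by (rule ennreal_SUP_add_left[OF ne, symmetric])
        also have "\<dots> \<le> emeasure m U" using a by (intro SUP_least) (auto simp: not_less)
        finally have "emeasure m U + ?e \<le> emeasure m U + 0" unfolding reg[OF Um, symmetric] by (simp only: add_0_right)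
        then have "?e \<le> 0" by (simp add: ennreal_add_left_cancel_le emeasure_eq_measure)
        then show False by (simp add: ennreal_eq_0_iff)
      qed
    qed
    then obtain K where K: "\<And>n. compact (K n)" "\<And>n. K n \<subseteq> U"
      "\<And>n. emeasure m U < emeasure m (K n) + ennreal (1 / real (Suc n))" by metis
    define L where "L n = (\<Union>i\<le>n. K i)" for n
    have L: "closed (L n)" "L n \<subseteq> U" for n using K by (auto simp: L_def compact_imp_closed)
    have "\<exists>u :: 'g \<Rightarrow> real. continuous_on UNIV u \<and> (\<forall>x. u x \<in> {0..1}) \<and> (\<forall>x\<in>- U. u x = 0) \<and> (\<forall>x\<in>L n. u x = 1)" for n
    proof -
      obtain u :: "'g \<Rightarrow> real" where "continuous_on UNIV u" "\<And>x. u x \<in> {0..1}" "\<And>x. x \<in> - U \<Longrightarrow> u x = 0" "\<And>x. x \<in> L n \<Longrightarrow> u x = 1"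
        by (rule Urysohn_compact_Hausdorff[OF comp, of "- U" "L n"]) (use U L[of n] in auto)
      then show ?thesis by blast
    qed
    then obtain u :: "nat \<Rightarrow> 'g \<Rightarrow> real" where u: "\<And>n. continuous_on UNIV (u n)" "\<And>n x. u n x \<in> {0..1}"
      "\<And>n x. x \<in> - U \<Longrightarrow> u n x = 0" "\<And>n x. x \<in> L n \<Longrightarrow> u n x = 1" by metis
    have Km: "K n \<in> sets m" for n using K(1)[of n] sets by (simp add: compact_imp_closed)
    \<comment> \<open>The sets \<open>K n\<close> exhaust \<open>U\<close> up to the null set \<open>Z\<close>, and \<open>u n\<close> is \<open>1\<close> on \<open>K i\<close> for \<open>i \<le> n\<close>.\<close>
    define Z where "Z = U - (\<Union>n. K n)"
    have Zm: "Z \<in> sets m" using Um Km by (auto simp: Z_def)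
    have "emeasure m Z \<le> 0 + ennreal e" if e: "e > 0" for e
    proof -
      obtain n where n: "1 / real (Suc n) < e" using e nat_approx_posE by blast
      have "emeasure m Z + emeasure m (K n) = emeasure m (Z \<union> K n)"
        by (rule plus_emeasure) (use Zm Km in \<open>auto simp: Z_def\<close>)
      also have "\<dots> \<le> emeasure m U" by (rule emeasure_mono) (use K(2) Um in \<open>auto simp: Z_def\<close>)
      also have "\<dots> \<le> ennreal (1 / real (Suc n)) + emeasure m (K n)" using less_imp_le[OF K(3)[of n]] by (subst add.commute)
      finally have "emeasure m (K n) + emeasure m Z \<le> emeasure m (K n) + ennreal (1 / real (Suc n))"
        by (subst (1 2) add.commute)
      then have "emeasure m Z \<le> ennreal (1 / real (Suc n))"
        using emeasure_finite[of "K n"] by (simp only: ennreal_add_left_cancel_le) (simp add: infinity_ennreal_def)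
      also have "\<dots> \<le> ennreal e" using n by (intro ennreal_leI) simp
      finally show ?thesis by simp
    qed
    then have "emeasure m Z \<le> 0" by (rule ennreal_le_epsilon)
    then have "Z \<in> null_sets m" using Zm by auto
    then have "AE x in m. x \<notin> Z" by (rule AE_not_in)
    then have lim: "AE x in m. (\<lambda>n. u n x) \<longlonglongrightarrow> indicator U x"
    proof eventually_elim
      fix x assume x: "x \<notin> Z"
      show "(\<lambda>n. u n x) \<longlonglongrightarrow> indicator U x"
      proof (cases "x \<in> U")
        case True
        then obtain k where k: "x \<in> K k" using x by (auto simp: Z_def)
        have "u n x = 1" if "n \<ge> k" for n using that k by (intro u(4)) (auto simp: L_def)
        then have "eventually (\<lambda>n. u n x = 1) sequentially" by (rule eventually_sequentiallyI)
        then show ?thesis using True by (simp add: tendsto_eventually)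
      qed (simp add: u(3))
    qed
    show ?thesis
      by (rule integral_open_determined_by_continuous[where ?\<Phi>1.0 = "\<lambda>x. x" and ?\<Phi>2.0 = "\<lambda>x. x", OF id id f zero _ U u(1,2) lim lim])
        (intro cont_zero continuous_on_of_real)
  qed
  show ?thesis
  proof (rule density_zero[OF f])
    fix A assume A: "A \<in> sets m"
    have "(\<integral>x. f x * indicator A x \<partial>m) = (\<integral>x. 0 * indicator A x \<partial>m)"
      by (rule integral_indicator_determined_by_open_sets[where ?\<Phi>1.0 = "\<lambda>x. x" and ?\<Phi>2.0 = "\<lambda>x. x", OF id id f zero open_zero])
        (use A sets in auto)
    moreover have "indicator A x *\<^sub>R f x = f x * indicator A x" for x by (simp add: indicator_def)
    ultimately show "set_lebesgue_integral m A f = 0" by (simp add: set_lebesgue_integral_def)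
  qed
qed

section \<open>Classes in \<open>L\<^sub>p\<close>\<close>

lemma ae_class_cong:
  assumes "f \<in> borel_measurable M" "g \<in> borel_measurable M" "AE x in M. f x = g x"
  shows "ae_class M f = ae_class M g"
proof -
  have "(AE x in M. h x = f x) \<longleftrightarrow> (AE x in M. h x = g x)" for h
    by (rule eventually_subst) (use assms(3) in eventually_elim, simp)
  then show ?thesis by (simp add: ae_class_def)
qed

lemma rep_ae_class:
  assumes "f \<in> borel_measurable M"
  shows "rep (ae_class M f) \<in> borel_measurable M" "AE x in M. rep (ae_class M f) x = f x"
proof -
  have "f \<in> ae_class M f" using assms by (simp add: ae_class_def)
  then have "rep (ae_class M f) \<in> ae_class M f" unfolding rep_def by (rule someI[where P = "\<lambda>g. g \<in> ae_class M f"])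
  then show "rep (ae_class M f) \<in> borel_measurable M" "AE x in M. rep (ae_class M f) x = f x"
    by (simp_all add: ae_class_def)
qed

lemma Lp_functionals_cong_AE:
  assumes f: "f \<in> borel_measurable M" "g \<in> borel_measurable M" and eq: "AE x in M. f x = g x"
  shows "mem_Lp p M f \<longleftrightarrow> mem_Lp p M g" "fun_Lp_norm p M f = fun_Lp_norm p M g"
proof -
  have "AE x in M. ennreal (norm (f x)) = ennreal (norm (g x))" using eq by eventually_elim simp
  then have 1: "esssup M (\<lambda>x. ennreal (norm (f x))) = esssup M (\<lambda>x. ennreal (norm (g x)))"
    using f by (intro esssup_AE_cong) auto
  have ae: "AE x in M. norm (f x) powr enn2real p = norm (g x) powr enn2real p" using eq by eventually_elim simp
  have m: "(\<lambda>x. norm (f x) powr enn2real p) \<in> borel_measurable M" "(\<lambda>x. norm (g x) powr enn2real p) \<in> borel_measurable M"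
    using f by measurable
  show "mem_Lp p M f \<longleftrightarrow> mem_Lp p M g"
    using f 1 integrable_cong_AE[OF m ae] by (simp add: mem_Lp_def)
  show "fun_Lp_norm p M f = fun_Lp_norm p M g"
    using 1 integral_cong_AE[OF m ae] by (simp add: fun_Lp_norm_def)
qed

lemma ae_class_in_Lp: "mem_Lp p M f \<Longrightarrow> ae_class M f \<in> Lp p M"
  by (simp add: Lp_def)

lemma rep_Lp:
  assumes "F \<in> Lp p M"
  shows "rep F \<in> borel_measurable M" "mem_Lp p M (rep F)" "ae_class M (rep F) = F"
proof -
  obtain f where f: "F = ae_class M f" "mem_Lp p M f" using assms by (auto simp: Lp_def)
  have fm: "f \<in> borel_measurable M" using f(2) by (simp add: mem_Lp_def)
  note r = rep_ae_class[OF fm, folded f(1)]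
  show "rep F \<in> borel_measurable M" by (rule r(1))
  show "mem_Lp p M (rep F)" using Lp_functionals_cong_AE(1)[OF r(1) fm r(2)] f(2) by simp
  show "ae_class M (rep F) = F" using ae_class_cong[OF r(1) fm r(2)] f(1) by simp
qed

text \<open>The \<open>L\<^sub>p\<close> norm of \<open>g \<circ> \<Phi>\<close> depends only on the distribution of \<open>\<Phi>\<close>. This is where the
  isometry comes from.\<close>

lemma Lp_functionals_distr:
  assumes \<Phi>: "\<Phi> \<in> M \<rightarrow>\<^sub>M N" and g: "g \<in> borel_measurable N"
  shows "mem_Lp p M (\<lambda>x. g (\<Phi> x)) \<longleftrightarrow> mem_Lp p (distr M N \<Phi>) g"
    "fun_Lp_norm p M (\<lambda>x. g (\<Phi> x)) = fun_Lp_norm p (distr M N \<Phi>) g"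
proof -
  have gm: "(\<lambda>x. g (\<Phi> x)) \<in> borel_measurable M" using \<Phi> g by measurable
  have "(AE y in distr M N \<Phi>. ennreal (norm (g y)) \<le> z) \<longleftrightarrow> (AE x in M. ennreal (norm (g (\<Phi> x))) \<le> z)" for z
    using \<Phi> g by (subst AE_distr_iff) auto
  then have 1: "esssup M (\<lambda>x. ennreal (norm (g (\<Phi> x)))) = esssup (distr M N \<Phi>) (\<lambda>x. ennreal (norm (g x)))"
    using gm g by (simp add: esssup_eq_AE)
  have m: "(\<lambda>x. norm (g x) powr enn2real p) \<in> borel_measurable N" using g by measurable
  show "mem_Lp p M (\<lambda>x. g (\<Phi> x)) \<longleftrightarrow> mem_Lp p (distr M N \<Phi>) g"
    using gm g 1 integrable_distr_eq[OF \<Phi> m] by (simp add: mem_Lp_def)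
  show "fun_Lp_norm p M (\<lambda>x. g (\<Phi> x)) = fun_Lp_norm p (distr M N \<Phi>) g"
    using 1 integral_distr[OF \<Phi> m] by (simp add: fun_Lp_norm_def)
qed

lemma mem_Lp_infinity_AE_bounded:
  assumes "mem_Lp \<infinity> M f"
  obtains B where "B \<ge> 0" "AE x in M. norm (f x) \<le> B"
proof -
  let ?s = "esssup M (\<lambda>x. ennreal (norm (f x)))"
  have fin: "?s < \<infinity>" using assms by (simp add: mem_Lp_def)
  have "AE x in M. ennreal (norm (f x)) \<le> ?s" by (rule esssup_AE)
  then have "AE x in M. norm (f x) \<le> enn2real ?s"
  proof eventually_elim
    fix x assume "ennreal (norm (f x)) \<le> ?s"
    then have "enn2real (ennreal (norm (f x))) \<le> enn2real ?s" using fin by (intro enn2real_mono) auto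
    then show "norm (f x) \<le> enn2real ?s" by simp
  qed
  then show ?thesis by (intro that[of "enn2real ?s"]) auto
qed

lemma mem_Lp_infinityI:
  assumes "f \<in> borel_measurable M" "AE x in M. norm (f x) \<le> B"
  shows "mem_Lp \<infinity> M f"
proof -
  have "esssup M (\<lambda>x. ennreal (norm (f x))) \<le> ennreal B"
    by (rule esssup_I) (use assms in \<open>auto elim!: eventually_mono intro: ennreal_leI\<close>)
  also have "\<dots> < \<infinity>" by simp
  finally show ?thesis using assms(1) by (simp add: mem_Lp_def)
qed

lemma enn2real_ge_1: "1 \<le> p \<Longrightarrow> p \<noteq> \<infinity> \<Longrightarrow> 1 \<le> enn2real p"
  using enn2real_mono[of 1 p] by (simp add: less_top)

lemma (in prob_space) mem_Lp_integrable:
  assumes p: "1 \<le> p" and f: "mem_Lp p M f"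
  shows "integrable M f"
proof (cases "p = \<infinity>")
  case True
  obtain B where "AE x in M. norm (f x) \<le> B" using mem_Lp_infinity_AE_bounded f True by metis
  then show ?thesis using f by (intro integrable_const_bound[of _ B]) (auto simp: mem_Lp_def)
next
  case False
  define q where "q = enn2real p"
  have q: "1 \<le> q" using enn2real_ge_1[OF p False] by (simp add: q_def)
  have m: "f \<in> borel_measurable M" and i: "integrable M (\<lambda>x. norm (f x) powr q)"
    using f False by (auto simp: mem_Lp_def q_def)
  show ?thesis
  proof (rule Bochner_Integration.integrable_bound)
    show "integrable M (\<lambda>x. 1 + norm (f x) powr q)" using i by simp
    show "AE x in M. norm (f x) \<le> norm (1 + norm (f x) powr q)"
    proof (rule AE_I2)
      fix x
      have "norm (f x) \<le> 1 + norm (f x) powr q"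
      proof (cases "norm (f x) \<le> 1")
        case True
        then show ?thesis using powr_ge_zero[of "norm (f x)" q] by linarith
      next
        case False
        then have "norm (f x) powr 1 \<le> norm (f x) powr q" using q by (intro powr_mono) auto
        then show ?thesis by simp
      qed
      then show "norm (f x) \<le> norm (1 + norm (f x) powr q)" by simp
    qed
  qed (rule m)
qed

lemma mem_Lp_add:
  assumes p: "1 \<le> p" and f: "mem_Lp p M f" and g: "mem_Lp p M g"
  shows "mem_Lp p M (\<lambda>x. f x + g x)"
proof (cases "p = \<infinity>")
  case True
  obtain A where A: "AE x in M. norm (f x) \<le> A" using mem_Lp_infinity_AE_bounded f True by metis
  obtain B where B: "AE x in M. norm (g x) \<le> B" using mem_Lp_infinity_AE_bounded g True by metis
  have "AE x in M. norm (f x + g x) \<le> A + B" using A B by eventually_elim (rule norm_triangle_mono)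
  then show ?thesis using f g unfolding True by (intro mem_Lp_infinityI[of _ _ "A + B"]) (auto simp: mem_Lp_def)
next
  case False
  define q where "q = enn2real p"
  have q: "1 \<le> q" using enn2real_ge_1[OF p False] by (simp add: q_def)
  have m[measurable]: "f \<in> borel_measurable M" "g \<in> borel_measurable M"
    and i: "integrable M (\<lambda>x. norm (f x) powr q)" "integrable M (\<lambda>x. norm (g x) powr q)"
    using f g False by (auto simp: mem_Lp_def q_def)
  have "integrable M (\<lambda>x. norm (f x + g x) powr q)"
  proof (rule Bochner_Integration.integrable_bound)
    show "integrable M (\<lambda>x. 2 powr q * (norm (f x) powr q + norm (g x) powr q))" using i by simp
    show "AE x in M. norm (norm (f x + g x) powr q) \<le> norm (2 powr q * (norm (f x) powr q + norm (g x) powr q))"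
    proof (rule AE_I2)
      fix x
      define a where "a = max (norm (f x)) (norm (g x))"
      have "norm (f x + g x) \<le> 2 * a" using norm_triangle_ineq[of "f x" "g x"] by (simp add: a_def)
      then have "norm (f x + g x) powr q \<le> (2 * a) powr q" using q by (intro powr_mono2) auto
      also have "\<dots> = 2 powr q * a powr q" by (simp add: powr_mult a_def)
      also have "a powr q \<le> norm (f x) powr q + norm (g x) powr q" by (auto simp: a_def max_def)
      finally show "norm (norm (f x + g x) powr q) \<le> norm (2 powr q * (norm (f x) powr q + norm (g x) powr q))"
        by (simp add: mult_left_mono)
    qed
  qed measurable
  then show ?thesis using False m by (simp add: mem_Lp_def q_def)
qed

lemma mem_Lp_scale:
  assumes f: "mem_Lp p M f"
  shows "mem_Lp p M (\<lambda>x. c * f x)"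
proof (cases "p = \<infinity>")
  case True
  obtain B where B: "AE x in M. norm (f x) \<le> B" using mem_Lp_infinity_AE_bounded f True by metis
  have "AE x in M. norm (c * f x) \<le> norm c * B" using B by eventually_elim (simp add: norm_mult mult_left_mono)
  then show ?thesis using f unfolding True by (intro mem_Lp_infinityI[of _ _ "norm c * B"]) (auto simp: mem_Lp_def)
qed (use f in \<open>auto simp: mem_Lp_def norm_mult powr_mult\<close>)

section \<open>Systems of characters and their Hardy spaces\<close>

text \<open>The image under \<open>\<Phi>\<close> of the measure with density \<open>f\<close> is absolutely continuous with respect to the
  distribution of \<open>\<Phi>\<close>; the function \<open>D\<close> is the Radon-Nikodym derivative. In probabilistic terms
  \<open>D \<circ> \<Phi>\<close> is the conditional expectation of \<open>f\<close> given \<open>\<Phi>\<close>.\<close>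

lemma (in prob_space) image_density_nonneg:
  assumes \<Phi>[measurable]: "\<Phi> \<in> M \<rightarrow>\<^sub>M N" and f: "integrable M f" "\<And>x. 0 \<le> (f x :: real)"
  obtains D :: "'b \<Rightarrow> real" where "integrable (distr M N \<Phi>) D"
    "\<And>v :: 'b \<Rightarrow> complex. v \<in> borel_measurable N \<Longrightarrow>
       (\<integral>y. of_real (D y) * v y \<partial>distr M N \<Phi>) = (\<integral>x. of_real (f x) * v (\<Phi> x) \<partial>M)"
proof -
  have [measurable]: "f \<in> borel_measurable M" using f by auto
  define \<mu> where "\<mu> = distr M N \<Phi>"
  define \<nu> where "\<nu> = distr (density M f) N \<Phi>"
  interpret mu: prob_space \<mu> unfolding \<mu>_def by (rule prob_space_distr) fact
  have ac: "absolutely_continuous \<mu> \<nu>"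
    unfolding absolutely_continuous_def
  proof
    fix A assume "A \<in> null_sets \<mu>"
    then have A: "A \<in> sets N" "emeasure M (\<Phi> -` A \<inter> space M) = 0"
      by (auto simp: null_sets_def \<mu>_def emeasure_distr)
    then have "\<Phi> -` A \<inter> space M \<in> null_sets M" using \<Phi> by (auto simp: null_sets_def)
    then have "\<Phi> -` A \<inter> space M \<in> null_sets (density M f)"
      using absolutely_continuousI_density[of f M] by (auto simp: absolutely_continuous_def)
    then show "A \<in> null_sets \<nu>"
      using A(1) by (auto simp: null_sets_def \<nu>_def emeasure_distr)
  qed
  obtain F where F[measurable]: "F \<in> borel_measurable \<mu>" and dens: "density \<mu> F = \<nu>"
    using mu.Radon_Nikodym[OF ac] by (auto simp: \<mu>_def \<nu>_def)
  have "(\<integral>\<^sup>+y. F y \<partial>\<mu>) = emeasure \<nu> (space \<nu>)"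
    unfolding dens[symmetric] by (subst emeasure_density) (auto intro!: nn_integral_cong)
  also have "\<dots> = emeasure (density M f) (space M)"
    unfolding \<nu>_def by (subst emeasure_distr) (auto intro!: arg_cong2[where f = emeasure] measurable_space[OF \<Phi>])
  also have "\<dots> = (\<integral>\<^sup>+x. f x \<partial>M)" by (subst emeasure_density) (auto intro!: nn_integral_cong)
  also have "\<dots> < \<infinity>" using f by (simp add: nn_integral_eq_integral)
  finally have fin: "(\<integral>\<^sup>+y. F y \<partial>\<mu>) < \<infinity>" .
  have "AE y in \<mu>. F y \<noteq> \<infinity>" by (rule nn_integral_noteq_infinite) (use fin in auto)
  then have FD: "AE y in \<mu>. ennreal (enn2real (F y)) = F y"
    by eventually_elim (simp add: top.not_eq_extremum)
  define D where "D y = enn2real (F y)" for y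
  have Dm: "D \<in> borel_measurable \<mu>" unfolding D_def by measurable
  have densD: "density \<mu> (\<lambda>y. ennreal (D y)) = \<nu>"
    unfolding dens[symmetric] by (rule density_cong) (use FD in \<open>auto simp: D_def\<close>)
  show ?thesis
  proof
    have "(\<integral>\<^sup>+y. ennreal (D y) \<partial>\<mu>) = (\<integral>\<^sup>+y. F y \<partial>\<mu>)"
      by (rule nn_integral_cong_AE) (use FD in \<open>simp add: D_def\<close>)
    then show "integrable (distr M N \<Phi>) D"
      unfolding \<mu>_def[symmetric] using Dm fin by (intro integrableI_nonneg) (auto simp: D_def)
    fix v :: "'b \<Rightarrow> complex" assume v[measurable]: "v \<in> borel_measurable N"
    have "(\<integral>y. of_real (D y) * v y \<partial>\<mu>) = (\<integral>y. v y \<partial>\<nu>)"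
      unfolding densD[symmetric] by (subst integral_density) (use Dm in \<open>auto simp: D_def scaleR_conv_of_real \<mu>_def\<close>)
    also have "\<dots> = (\<integral>x. v (\<Phi> x) \<partial>density M f)"
      unfolding \<nu>_def by (rule integral_distr) auto
    also have "\<dots> = (\<integral>x. of_real (f x) * v (\<Phi> x) \<partial>M)"
      by (subst integral_density) (use f in \<open>auto simp: scaleR_conv_of_real\<close>)
    finally show "(\<integral>y. of_real (D y) * v y \<partial>distr M N \<Phi>) = (\<integral>x. of_real (f x) * v (\<Phi> x) \<partial>M)"
      by (simp add: \<mu>_def)
  qed
qed

lemma (in prob_space) image_density:
  fixes f :: "'a \<Rightarrow> complex"
  assumes \<Phi>[measurable]: "\<Phi> \<in> M \<rightarrow>\<^sub>M N" and f: "integrable M f"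
  shows "\<exists>g :: 'b \<Rightarrow> complex. integrable (distr M N \<Phi>) g \<and>
    (\<forall>v :: 'b \<Rightarrow> complex. v \<in> borel_measurable N \<longrightarrow> (\<forall>y. norm (v y) \<le> 1) \<longrightarrow>
       (\<integral>y. g y * v y \<partial>distr M N \<Phi>) = (\<integral>x. f x * v (\<Phi> x) \<partial>M))"
proof -
  \<comment> \<open>The positive and negative parts of the real and the imaginary part.\<close>
  define part where "part i x = max 0 (if i = 0 then Re (f x) else if i = 1 then - Re (f x) else
    if i = 2 then Im (f x) else - Im (f x))" for i :: nat and x
  have part: "integrable M (part i)" "0 \<le> part i x" for i x
  proof -
    have "part i = (\<lambda>x. max 0 (if i = 0 then Re (f x) else if i = 1 then - Re (f x) else
        if i = 2 then Im (f x) else - Im (f x)))" by (rule ext) (rule part_def)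
    moreover have "integrable M (\<lambda>x. if i = 0 then Re (f x) else if i = 1 then - Re (f x) else
        if i = 2 then Im (f x) else - Im (f x))"
      using f by (cases "i = 0"; cases "i = 1"; cases "i = 2") auto
    ultimately show "integrable M (part i)" by (simp only: integrable_max integrable_zero)
    show "0 \<le> part i x" by (simp add: part_def)
  qed
  have "\<exists>D :: 'b \<Rightarrow> real. integrable (distr M N \<Phi>) D \<and> (\<forall>v :: 'b \<Rightarrow> complex. v \<in> borel_measurable N \<longrightarrow>
       (\<integral>y. of_real (D y) * v y \<partial>distr M N \<Phi>) = (\<integral>x. of_real (part i x) * v (\<Phi> x) \<partial>M))" for i
    by (rule image_density_nonneg[OF \<Phi> part]) blast
  then obtain D :: "nat \<Rightarrow> 'b \<Rightarrow> real" where D: "\<And>i. integrable (distr M N \<Phi>) (D i)"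
    "\<And>i v. v \<in> borel_measurable N \<Longrightarrow>
       (\<integral>y. of_real (D i y) * (v y :: complex) \<partial>distr M N \<Phi>) = (\<integral>x. of_real (part i x) * v (\<Phi> x) \<partial>M)"
    by metis
  define comb where "comb u = complex_of_real (u 0) - of_real (u 1) + \<i> * of_real (u 2) - \<i> * of_real (u 3)" for u :: "nat \<Rightarrow> real"
  have f_eq: "f x = comb (\<lambda>i. part i x)" for x
    by (simp add: comb_def part_def complex_eq_iff max_def)
  have comb: "(\<integral>x. comb (\<lambda>i. u i x) * v x \<partial>L) = (\<integral>x. of_real (u 0 x) * v x \<partial>L) - (\<integral>x. of_real (u 1 x) * v x \<partial>L)
      + \<i> * (\<integral>x. of_real (u 2 x) * v x \<partial>L) - \<i> * (\<integral>x. of_real (u 3 x) * v x \<partial>L)"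
    if u: "\<And>i. integrable L (u i)" and v: "v \<in> borel_measurable L" "\<And>x. norm (v x) \<le> 1"
    for L :: "'d measure" and u :: "nat \<Rightarrow> 'd \<Rightarrow> real" and v :: "'d \<Rightarrow> complex"
  proof -
    have int: "integrable L (\<lambda>x. complex_of_real (u i x) * v x)" for i
      by (rule integrable_mult_bounded[OF _ v(1), of _ 1]) (use u v in auto)
    have "comb (\<lambda>i. u i x) * v x = of_real (u 0 x) * v x - of_real (u 1 x) * v x
        + \<i> * (of_real (u 2 x) * v x) - \<i> * (of_real (u 3 x) * v x)" for x
      by (simp add: comb_def algebra_simps)
    then show ?thesis using int by simp
  qed
  show ?thesis
  proof (intro exI[of _ "\<lambda>y. comb (\<lambda>i. D i y)"] conjI allI impI)
    show "integrable (distr M N \<Phi>) (\<lambda>y. comb (\<lambda>i. D i y))"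
      unfolding comb_def using D(1) by (intro Bochner_Integration.integrable_add Bochner_Integration.integrable_diff integrable_mult_right integrable_of_real)
    fix v :: "'b \<Rightarrow> complex" assume v: "v \<in> borel_measurable N" "\<forall>y. norm (v y) \<le> 1"
    have "(\<integral>y. comb (\<lambda>i. D i y) * v y \<partial>distr M N \<Phi>) = (\<integral>x. comb (\<lambda>i. part i x) * v (\<Phi> x) \<partial>M)"
      using v \<Phi> by (subst (1 2) comb) (auto simp: D(2) intro: D(1) part)
    then show "(\<integral>y. comb (\<lambda>i. D i y) * v y \<partial>distr M N \<Phi>) = (\<integral>x. f x * v (\<Phi> x) \<partial>M)"
      by (simp add: f_eq)
  qed
qed

lemma borel_measurable_cnj [measurable (raw)]:
  "f \<in> borel_measurable M \<Longrightarrow> (\<lambda>x. cnj (f x)) \<in> borel_measurable M"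
  by (rule measurable_compose[OF _ borel_measurable_continuous_onI]) (auto intro: continuous_intros)

lemma (in finite_measure) integral_complex_indicator:
  assumes "A \<in> sets M"
  shows "(\<integral>x. indicator A x \<partial>M) = complex_of_real (measure M A)"
proof -
  have "(indicator A x :: complex) = of_real (indicator A x)" for x by (simp add: indicator_def)
  then have "(\<integral>x. indicator A x \<partial>M) = complex_of_real (\<integral>x. indicator A x \<partial>M)"
    by (simp only: integral_complex_of_real)
  then show ?thesis using assms by simp
qed

text \<open>What is used of the dual group of a compact abelian group: an orthonormal and complete family of
  unimodular functions, closed under products and conjugates. Characters matter only through their
  values on the space of the measure; \<open>cong_char\<close> allows changing them elsewhere, which is needed for
  the torus, whose points are extensional functions.\<close>

locale character_system = prob_space +
  fixes C :: "('a \<Rightarrow> complex) set"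
  assumes measurable_char: "\<gamma> \<in> C \<Longrightarrow> \<gamma> \<in> borel_measurable M"
    and norm_char: "\<gamma> \<in> C \<Longrightarrow> x \<in> space M \<Longrightarrow> norm (\<gamma> x) = 1"
    and one_char: "(\<lambda>x. 1) \<in> C"
    and mult_char: "\<gamma> \<in> C \<Longrightarrow> \<delta> \<in> C \<Longrightarrow> (\<lambda>x. \<gamma> x * \<delta> x) \<in> C"
    and cnj_char: "\<gamma> \<in> C \<Longrightarrow> (\<lambda>x. cnj (\<gamma> x)) \<in> C"
    and cong_char: "\<gamma> \<in> C \<Longrightarrow> (\<And>x. x \<in> space M \<Longrightarrow> \<delta> x = \<gamma> x) \<Longrightarrow> \<delta> \<in> C"
    and orthogonal_char: "\<gamma> \<in> C \<Longrightarrow> x \<in> space M \<Longrightarrow> \<gamma> x \<noteq> 1 \<Longrightarrow> (\<integral>x. \<gamma> x \<partial>M) = 0"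
    and complete_char: "integrable M f \<Longrightarrow> (\<And>\<gamma>. \<gamma> \<in> C \<Longrightarrow> (\<integral>x. f x * cnj (\<gamma> x) \<partial>M) = 0) \<Longrightarrow> AE x in M. f x = 0"
begin

lemma integral_char:
  assumes "\<gamma> \<in> C"
  shows "(\<integral>x. \<gamma> x \<partial>M) = (if \<forall>x\<in>space M. \<gamma> x = 1 then 1 else 0)"
proof (cases "\<forall>x\<in>space M. \<gamma> x = 1")
  case True
  then have "(\<integral>x. \<gamma> x \<partial>M) = (\<integral>x. 1 \<partial>M)" by (intro Bochner_Integration.integral_cong) auto
  then show ?thesis using True by (simp add: prob_space)
next
  case False
  then show ?thesis using orthogonal_char[OF assms] by auto
qed

lemma power_int_char:
  assumes "\<gamma> \<in> C"
  shows "(\<lambda>x. \<gamma> x powi c) \<in> C"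
proof -
  have pow: "(\<lambda>x. \<delta> x ^ n) \<in> C" if "\<delta> \<in> C" for \<delta> n
    by (induction n) (use that mult_char one_char in auto)
  show ?thesis
  proof (cases "c \<ge> 0")
    case True
    then show ?thesis using pow[OF assms, of "nat c"] by (simp add: power_int_def)
  next
    case False
    show ?thesis
    proof (rule cong_char[OF pow[OF cnj_char[OF assms], of "nat (- c)"]])
      fix x assume "x \<in> space M"
      then have "inverse (\<gamma> x) = cnj (\<gamma> x)"
        using norm_char[OF assms] by (metis divide_conv_cnj inverse_eq_divide mult_1)
      then show "\<gamma> x powi c = cnj (\<gamma> x) ^ nat (- c)" using False by (simp add: power_int_def)
    qed
  qed
qed

lemma monomial_char:
  assumes h: "\<And>n. h n \<in> C" and k: "k \<in> multi_indices N"
  shows "(\<lambda>x. monomial k (\<lambda>n. h n x)) \<in> C"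
proof -
  have "(\<lambda>x. \<Prod>j\<in>J. h j x powi k j) \<in> C" if "finite J" for J
    using that
  proof induction
    case empty then show ?case using one_char by simp
  next
    case (insert j J)
    then show ?case using mult_char[OF power_int_char[OF h, of j "k j"] insert.IH] by simp
  qed
  then show ?thesis using k by (simp add: monomial_def multi_indices_def)
qed

end

lemma borel_measurable_monomial: "monomial k \<in> borel_measurable borel"
proof -
  have [measurable]: "(\<lambda>w :: nat \<Rightarrow> complex. w j) \<in> borel_measurable borel" for j
    by (rule borel_measurable_continuous_onI) (rule continuous_on_product_coordinates)
  have [measurable]: "(\<lambda>w :: nat \<Rightarrow> complex. w j powi c) \<in> borel_measurable borel" for j c
    by (cases "c \<ge> 0") (simp_all add: power_int_def)
  show ?thesis unfolding monomial_def[abs_def] by measurable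
qed

lemma infinite_torus_borel: "{w :: nat \<Rightarrow> complex. \<forall>j. norm (w j) = 1} \<in> sets borel"
  using compact_infinite_torus by (intro borel_closed compact_imp_closed)

text \<open>Such a sequence is a random point of the infinite torus.\<close>

locale character_sequence = character_system +
  fixes h :: "nat \<Rightarrow> 'a \<Rightarrow> complex"
  assumes sequence_char: "h n \<in> C"
begin

definition torus_map :: "'a \<Rightarrow> nat \<Rightarrow> complex" where
  "torus_map x = (\<lambda>n. h n x)"

lemma measurable_torus_map [measurable]: "torus_map \<in> M \<rightarrow>\<^sub>M borel"
  unfolding torus_map_def[abs_def]
  by (rule measurable_coordinatewise_then_product) (rule measurable_char[OF sequence_char])

lemma norm_torus_map: "x \<in> space M \<Longrightarrow> norm (torus_map x j) = 1"
  unfolding torus_map_def by (rule norm_char[OF sequence_char])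

lemma monomial_torus_map_char: "k \<in> multi_indices N \<Longrightarrow> (\<lambda>x. monomial k (torus_map x)) \<in> C"
  unfolding torus_map_def by (rule monomial_char[OF sequence_char])

lemma coeff_of_composition_eq:
  assumes g: "g \<in> borel_measurable borel" and \<gamma>: "\<And>x. x \<in> space M \<Longrightarrow> \<gamma> x = monomial k (torus_map x)"
  shows "(\<integral>x. g (torus_map x) * cnj (\<gamma> x) \<partial>M) = (\<integral>y. g y * cnj (monomial k y) \<partial>distr M borel torus_map)"
proof -
  have [measurable]: "monomial k \<in> borel_measurable borel" by (rule borel_measurable_monomial)
  have "(\<integral>x. g (torus_map x) * cnj (\<gamma> x) \<partial>M) = (\<integral>x. g (torus_map x) * cnj (monomial k (torus_map x)) \<partial>M)"
    by (rule Bochner_Integration.integral_cong) (simp_all add: \<gamma>)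
  also have "\<dots> = (\<integral>y. g y * cnj (monomial k y) \<partial>distr M borel torus_map)"
    using g by (intro integral_distr[symmetric]) auto
  finally show ?thesis .
qed

text \<open>A character outside the group generated by the sequence is orthogonal to that group, hence to all
  functions of \<open>torus_map\<close>: first to indicators, since moments determine densities, then to integrable
  functions by approximation.\<close>

lemma coeff_of_composition_zero:
  assumes g: "integrable (distr M borel torus_map) g" and \<gamma>: "\<gamma> \<in> C"
    and off: "\<And>k. k \<in> multi_indices \<infinity> \<Longrightarrow> \<exists>x\<in>space M. \<gamma> x \<noteq> monomial k (torus_map x)"
  shows "(\<integral>x. g (torus_map x) * cnj (\<gamma> x) \<partial>M) = 0"
proof -
  have \<gamma>m[measurable]: "\<gamma> \<in> borel_measurable M" using \<gamma> by (rule measurable_char)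
  have int\<gamma>: "integrable M (\<lambda>x. cnj (\<gamma> x))"
    by (rule integrable_const_bound[of _ 1]) (auto simp: norm_char[OF \<gamma>])
  have moment: "(\<integral>x. cnj (\<gamma> x) * monomial k (torus_map x) \<partial>M) = 0" if k: "k \<in> multi_indices \<infinity>" for k
  proof -
    obtain x where x: "x \<in> space M" "\<gamma> x \<noteq> monomial k (torus_map x)" using off[OF k] by blast
    have "\<gamma> x * cnj (\<gamma> x) = 1" using norm_char[OF \<gamma> x(1)] by (simp add: complex_norm_square[symmetric])
    then have "cnj (\<gamma> x) * monomial k (torus_map x) \<noteq> 1"
      using x(2) by (metis mult.assoc mult.commute mult_1)
    then show ?thesis
      using orthogonal_char[OF mult_char[OF cnj_char[OF \<gamma>] monomial_torus_map_char[OF k]] x(1)] by simp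
  qed
  have ind: "(\<integral>x. cnj (\<gamma> x) * indicator A (torus_map x) \<partial>M) = 0" if A: "A \<in> sets borel" for A
  proof -
    have "(\<integral>x. cnj (\<gamma> x) * indicator A (torus_map x) \<partial>M) = (\<integral>x. 0 * indicator A (torus_map x) \<partial>M)"
      by (rule torus_moments_determine_measure[OF measurable_torus_map norm_torus_map measurable_torus_map norm_torus_map int\<gamma> _ _ A])
        (simp_all add: moment)
    then show ?thesis by simp
  qed
  have comp: "integrable M (\<lambda>x. f (torus_map x) * cnj (\<gamma> x))" if "integrable (distr M borel torus_map) f" for f :: "(nat \<Rightarrow> complex) \<Rightarrow> complex"
    by (rule integrable_mult_bounded[where B = 1]) (use that integrable_distr[OF measurable_torus_map] in \<open>auto simp: norm_char[OF \<gamma>]\<close>)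
  from g show ?thesis
  proof (induction rule: integrable_induct)
    case (base A c)
    have "(\<integral>x. (indicator A (torus_map x) *\<^sub>R c) * cnj (\<gamma> x) \<partial>M) = (\<integral>x. c * (cnj (\<gamma> x) * indicator A (torus_map x)) \<partial>M)"
      by (rule Bochner_Integration.integral_cong) (auto simp: indicator_def)
    also have "\<dots> = c * (\<integral>x. cnj (\<gamma> x) * indicator A (torus_map x) \<partial>M)" by simp
    finally show ?case using ind base by simp
  next
    case (add f g)
    then show ?case using comp[OF add.hyps(1)] comp[OF add.hyps(2)] by (simp add: distrib_right)
  next
    case (lim f s)
    have "(\<lambda>i. \<integral>x. s i (torus_map x) * cnj (\<gamma> x) \<partial>M) \<longlonglongrightarrow> (\<integral>x. f (torus_map x) * cnj (\<gamma> x) \<partial>M)"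
    proof (rule integral_dominated_convergence)
      show "integrable M (\<lambda>x. 2 * norm (f (torus_map x)))"
        using lim.hyps(4) integrable_distr[OF measurable_torus_map] by auto
      show "AE x in M. (\<lambda>i. s i (torus_map x) * cnj (\<gamma> x)) \<longlonglongrightarrow> f (torus_map x) * cnj (\<gamma> x)"
        using lim.hyps(2) by (intro AE_I2 tendsto_intros) auto
      show "AE x in M. norm (s i (torus_map x) * cnj (\<gamma> x)) \<le> 2 * norm (f (torus_map x))" for i
        using lim.hyps(3) by (intro AE_I2) (auto simp: norm_mult norm_char[OF \<gamma>])
    qed (use comp[OF lim.hyps(1)] comp[OF lim.hyps(4)] in auto)
    then show ?case using lim.IH by (simp add: LIMSEQ_const_iff)
  qed
qed

text \<open>The function \<open>g\<close> is the density of the image measure. The coefficients of \<open>f\<close> and \<open>g \<circ> torus_map\<close>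
  at products of members of the sequence agree by the defining property of \<open>g\<close>; at all other characters
  both vanish, by assumption and by \<open>coeff_of_composition_zero\<close>. Completeness gives equality.\<close>

lemma factorization:
  assumes f: "integrable M f"
    and spec: "\<And>\<gamma>. \<gamma> \<in> C \<Longrightarrow> (\<integral>x. f x * cnj (\<gamma> x) \<partial>M) \<noteq> 0 \<Longrightarrow>
      \<exists>k\<in>multi_indices \<infinity>. \<forall>x\<in>space M. \<gamma> x = monomial k (torus_map x)"
  obtains g where "g \<in> borel_measurable borel" "integrable (distr M borel torus_map) g"
    "AE x in M. f x = g (torus_map x)"
proof -
  let ?\<mu> = "distr M borel torus_map" and ?T = "{w :: nat \<Rightarrow> complex. \<forall>j. norm (w j) = 1}"
  obtain g :: "(nat \<Rightarrow> complex) \<Rightarrow> complex" where g: "integrable ?\<mu> g"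
    and gv: "\<And>v :: (nat \<Rightarrow> complex) \<Rightarrow> complex. v \<in> borel_measurable borel \<Longrightarrow> (\<And>y. norm (v y) \<le> 1) \<Longrightarrow>
       (\<integral>y. g y * v y \<partial>?\<mu>) = (\<integral>x. f x * v (torus_map x) \<partial>M)"
    using image_density[OF measurable_torus_map f] by blast
  have gm: "g \<in> borel_measurable borel" using g by auto
  have gi: "integrable M (\<lambda>x. g (torus_map x))" using g by (rule integrable_distr[OF measurable_torus_map])
  have bounded: "integrable M (\<lambda>x. u x * cnj (\<gamma> x))" if "integrable M u" "\<gamma> \<in> C" for u \<gamma>
    by (rule integrable_mult_bounded[where B = 1]) (use that measurable_char norm_char in auto)
  have "AE x in M. f x - g (torus_map x) = 0"
  proof (rule complete_char)
    fix \<gamma> assume \<gamma>: "\<gamma> \<in> C"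
    have "(\<integral>x. f x * cnj (\<gamma> x) \<partial>M) = (\<integral>x. g (torus_map x) * cnj (\<gamma> x) \<partial>M)"
    proof (cases "\<exists>k\<in>multi_indices \<infinity>. \<forall>x\<in>space M. \<gamma> x = monomial k (torus_map x)")
      case True
      then obtain k where k: "k \<in> multi_indices \<infinity>" "\<And>x. x \<in> space M \<Longrightarrow> \<gamma> x = monomial k (torus_map x)" by blast
      \<comment> \<open>Cut off outside the torus to have a bounded test function.\<close>
      define v where "v y = cnj (monomial k y) * indicator ?T y" for y
      have [measurable]: "monomial k \<in> borel_measurable borel" "?T \<in> sets borel"
        by (rule borel_measurable_monomial infinite_torus_borel)+
      have vm: "v \<in> borel_measurable borel" unfolding v_def by measurable
      have vT: "v (torus_map x) = cnj (\<gamma> x)" if "x \<in> space M" for x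
        using k(2)[OF that] norm_torus_map[OF that] by (simp add: v_def)
      have "norm (v y) \<le> 1" for y
        using norm_monomial[OF k(1), of y] by (auto simp: v_def indicator_def norm_mult)
      note gv[OF vm this]
      also have "(\<integral>x. f x * v (torus_map x) \<partial>M) = (\<integral>x. f x * cnj (\<gamma> x) \<partial>M)"
        by (rule Bochner_Integration.integral_cong) (simp_all add: vT)
      finally have "(\<integral>x. f x * cnj (\<gamma> x) \<partial>M) = (\<integral>y. g y * v y \<partial>?\<mu>)" by simp
      also have "\<dots> = (\<integral>x. g (torus_map x) * v (torus_map x) \<partial>M)"
        using gm vm by (intro integral_distr) auto
      also have "\<dots> = (\<integral>x. g (torus_map x) * cnj (\<gamma> x) \<partial>M)"
        by (rule Bochner_Integration.integral_cong) (simp_all add: vT)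
      finally show ?thesis .
    next
      case False
      then have "(\<integral>x. f x * cnj (\<gamma> x) \<partial>M) = 0" using spec[OF \<gamma>] by blast
      moreover have "(\<integral>x. g (torus_map x) * cnj (\<gamma> x) \<partial>M) = 0"
        by (rule coeff_of_composition_zero[OF g \<gamma>]) (use False in blast)
      ultimately show ?thesis by simp
    qed
    then show "(\<integral>x. (f x - g (torus_map x)) * cnj (\<gamma> x) \<partial>M) = 0"
      using bounded[OF f \<gamma>] bounded[OF gi \<gamma>] by (simp add: left_diff_distrib)
  qed (use f gi in auto)
  then have "AE x in M. f x = g (torus_map x)" by eventually_elim simp
  then show ?thesis using that[OF gm g] by blast
qed

end

text \<open>Each mixed moment of the sequence is the integral of a character, hence \<open>1\<close> or \<open>0\<close> according to
  whether this character is trivial; so equal relations give equal moments.\<close>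

lemma distr_torus_map_eq:
  assumes 1: "character_sequence M1 C1 h1" and 2: "character_sequence M2 C2 h2"
    and rel: "\<And>k. k \<in> multi_indices \<infinity> \<Longrightarrow> (\<forall>x\<in>space M1. monomial k (\<lambda>n. h1 n x) = 1) \<longleftrightarrow> (\<forall>x\<in>space M2. monomial k (\<lambda>n. h2 n x) = 1)"
  shows "distr M1 borel (character_sequence.torus_map h1) = distr M2 borel (character_sequence.torus_map h2)"
proof -
  interpret A: character_sequence M1 C1 h1 by fact
  interpret B: character_sequence M2 C2 h2 by fact
  show ?thesis
  proof (rule measure_eqI)
    fix Y assume "Y \<in> sets (distr M1 borel A.torus_map)"
    then have Y: "Y \<in> sets borel" by simp
    have eqI: "(\<integral>x. 1 * indicator Y (A.torus_map x) \<partial>M1) = (\<integral>x. 1 * (indicator Y (B.torus_map x) :: complex) \<partial>M2)"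
    proof (rule torus_moments_determine_measure[OF A.measurable_torus_map A.norm_torus_map B.measurable_torus_map B.norm_torus_map _ _ _ Y])
      fix k assume k: "k \<in> multi_indices \<infinity>"
      show "(\<integral>x. 1 * monomial k (A.torus_map x) \<partial>M1) = (\<integral>x. 1 * monomial k (B.torus_map x) \<partial>M2)"
        using rel[OF k] A.integral_char[OF A.monomial_torus_map_char[OF k]] B.integral_char[OF B.monomial_torus_map_char[OF k]]
        by (simp add: A.torus_map_def B.torus_map_def)
    qed auto
    interpret dA: prob_space "distr M1 borel A.torus_map" by (rule A.prob_space_distr) simp
    interpret dB: prob_space "distr M2 borel B.torus_map" by (rule B.prob_space_distr) simp
    have "(\<integral>x. 1 * (indicator Y (A.torus_map x) :: complex) \<partial>M1) = measure (distr M1 borel A.torus_map) Y"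
      using dA.integral_complex_indicator[of Y] Y integral_distr[OF A.measurable_torus_map, of "indicator Y :: _ \<Rightarrow> complex"] by simp
    moreover have "(\<integral>x. 1 * (indicator Y (B.torus_map x) :: complex) \<partial>M2) = measure (distr M2 borel B.torus_map) Y"
      using dB.integral_complex_indicator[of Y] Y integral_distr[OF B.measurable_torus_map, of "indicator Y :: _ \<Rightarrow> complex"] by simp
    ultimately have "measure (distr M1 borel A.torus_map) Y = measure (distr M2 borel B.torus_map) Y"
      using eqI by (simp only: of_real_eq_iff)
    then show "emeasure (distr M1 borel A.torus_map) Y = emeasure (distr M2 borel B.torus_map) Y"
      by (simp only: dA.emeasure_eq_measure dB.emeasure_eq_measure)
  qed simp
qed

text \<open>The common form of the two Hardy spaces.\<close>

definition spectral_Hardy ::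
  "ennreal \<Rightarrow> 'a measure \<Rightarrow> ('a \<Rightarrow> complex) set \<Rightarrow> (nat \<Rightarrow> 'a \<Rightarrow> complex) \<Rightarrow> ('a \<Rightarrow> complex) set set" where
  "spectral_Hardy p M C h =
     {F \<in> Lp p M. \<forall>\<gamma>\<in>C. group_coeff M F \<gamma> \<noteq> 0 \<longrightarrow> (\<exists>n. \<forall>x\<in>space M. \<gamma> x = h n x)}"

lemma group_coeff_ae_class:
  assumes "f \<in> borel_measurable M" "\<gamma> \<in> borel_measurable M"
  shows "group_coeff M (ae_class M f) \<gamma> = (\<integral>x. f x * cnj (\<gamma> x) \<partial>M)"
  unfolding group_coeff_def
proof (rule integral_cong_AE)
  show "AE x in M. rep (ae_class M f) x * cnj (\<gamma> x) = f x * cnj (\<gamma> x)"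
    using rep_ae_class(2)[OF assms(1)] by eventually_elim simp
qed (use assms rep_ae_class(1)[OF assms(1)] in measurable)

lemma Lp_norm_ae_class:
  assumes "f \<in> borel_measurable M"
  shows "Lp_norm p M (ae_class M f) = fun_Lp_norm p M f"
  unfolding Lp_norm_def by (rule Lp_functionals_cong_AE(2)[OF rep_ae_class(1)[OF assms] assms rep_ae_class(2)[OF assms]])

context character_system
begin

lemma integrable_mult_cnj_char:
  "integrable M f \<Longrightarrow> \<gamma> \<in> C \<Longrightarrow> integrable M (\<lambda>x. f x * cnj (\<gamma> x))"
  by (rule integrable_mult_bounded[where B = 1]) (use measurable_char norm_char in auto)

lemma Lp_integrable: "1 \<le> p \<Longrightarrow> F \<in> Lp p M \<Longrightarrow> integrable M (rep F)"
  by (rule mem_Lp_integrable[OF _ rep_Lp(2)])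

lemma Lp_add_coeff:
  assumes p: "1 \<le> p" and F: "F \<in> Lp p M" and G: "G \<in> Lp p M"
  shows "Lp_add M F G \<in> Lp p M"
    "\<gamma> \<in> C \<Longrightarrow> group_coeff M (Lp_add M F G) \<gamma> = group_coeff M F \<gamma> + group_coeff M G \<gamma>"
proof -
  show "Lp_add M F G \<in> Lp p M"
    unfolding Lp_add_def by (intro ae_class_in_Lp mem_Lp_add p rep_Lp(2) F G)
  have m: "(\<lambda>x. rep F x + rep G x) \<in> borel_measurable M"
    using rep_Lp(1)[OF F] rep_Lp(1)[OF G] by measurable
  assume \<gamma>: "\<gamma> \<in> C"
  show "group_coeff M (Lp_add M F G) \<gamma> = group_coeff M F \<gamma> + group_coeff M G \<gamma>"
    unfolding Lp_add_def group_coeff_ae_class[OF m measurable_char[OF \<gamma>]]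
    using integrable_mult_cnj_char[OF Lp_integrable[OF p F] \<gamma>] integrable_mult_cnj_char[OF Lp_integrable[OF p G] \<gamma>]
    by (simp add: group_coeff_def distrib_right)
qed

lemma Lp_scale_coeff:
  assumes F: "F \<in> Lp p M"
  shows "Lp_scale M c F \<in> Lp p M"
    "\<gamma> \<in> C \<Longrightarrow> group_coeff M (Lp_scale M c F) \<gamma> = c * group_coeff M F \<gamma>"
proof -
  show "Lp_scale M c F \<in> Lp p M"
    unfolding Lp_scale_def by (intro ae_class_in_Lp mem_Lp_scale rep_Lp(2) F)
  have m: "(\<lambda>x. c * rep F x) \<in> borel_measurable M"
    using rep_Lp(1)[OF F] by measurable
  assume \<gamma>: "\<gamma> \<in> C"
  show "group_coeff M (Lp_scale M c F) \<gamma> = c * group_coeff M F \<gamma>"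
    unfolding Lp_scale_def group_coeff_ae_class[OF m measurable_char[OF \<gamma>]]
    by (simp add: group_coeff_def mult.assoc)
qed

end

context character_sequence
begin

lemma group_coeff_on_space:
  assumes "\<And>x. x \<in> space M \<Longrightarrow> \<gamma> x = \<delta> x"
  shows "group_coeff M F \<gamma> = group_coeff M F \<delta>"
  unfolding group_coeff_def by (rule Bochner_Integration.integral_cong) (simp_all add: assms)

lemma spectral_Hardy_add:
  assumes p: "1 \<le> p" and F: "F \<in> spectral_Hardy p M C h" and G: "G \<in> spectral_Hardy p M C h"
  shows "Lp_add M F G \<in> spectral_Hardy p M C h"
proof -
  have FG: "F \<in> Lp p M" "G \<in> Lp p M" using F G by (auto simp: spectral_Hardy_def)
  have "\<exists>n. \<forall>x\<in>space M. \<gamma> x = h n x" if \<gamma>: "\<gamma> \<in> C" "group_coeff M (Lp_add M F G) \<gamma> \<noteq> 0" for \<gamma>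
  proof -
    have "group_coeff M F \<gamma> \<noteq> 0 \<or> group_coeff M G \<gamma> \<noteq> 0" using \<gamma> Lp_add_coeff(2)[OF p FG \<gamma>(1)] by auto
    then show ?thesis using F G \<gamma>(1) unfolding spectral_Hardy_def by blast
  qed
  then show ?thesis using Lp_add_coeff(1)[OF p FG] by (simp add: spectral_Hardy_def)
qed

lemma spectral_Hardy_scale:
  assumes F: "F \<in> spectral_Hardy p M C h"
  shows "Lp_scale M c F \<in> spectral_Hardy p M C h"
proof -
  have F': "F \<in> Lp p M" using F by (simp add: spectral_Hardy_def)
  have "\<exists>n. \<forall>x\<in>space M. \<gamma> x = h n x" if \<gamma>: "\<gamma> \<in> C" "group_coeff M (Lp_scale M c F) \<gamma> \<noteq> 0" for \<gamma>
  proof -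
    have "group_coeff M F \<gamma> \<noteq> 0" using \<gamma> Lp_scale_coeff(2)[OF F' \<gamma>(1)] by auto
    then show ?thesis using F \<gamma>(1) unfolding spectral_Hardy_def by blast
  qed
  then show ?thesis using Lp_scale_coeff(1)[OF F'] by (simp add: spectral_Hardy_def)
qed

text \<open>All coefficients outside the sequence vanish on both sides, so completeness applies to the
  difference.\<close>

lemma spectral_Hardy_eqI:
  assumes p: "1 \<le> p" and F: "F \<in> spectral_Hardy p M C h" and G: "G \<in> spectral_Hardy p M C h"
    and eq: "\<And>n. group_coeff M F (h n) = group_coeff M G (h n)"
  shows "F = G"
proof -
  have FG: "F \<in> Lp p M" "G \<in> Lp p M" using F G by (auto simp: spectral_Hardy_def)
  note int = Lp_integrable[OF p FG(1)] Lp_integrable[OF p FG(2)]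
  have "AE x in M. rep F x - rep G x = 0"
  proof (rule complete_char)
    fix \<gamma> assume \<gamma>: "\<gamma> \<in> C"
    have "group_coeff M F \<gamma> = group_coeff M G \<gamma>"
    proof (cases "group_coeff M F \<gamma> = 0 \<and> group_coeff M G \<gamma> = 0")
      case False
      then obtain n where "\<forall>x\<in>space M. \<gamma> x = h n x" using F G \<gamma> unfolding spectral_Hardy_def by blast
      then have "group_coeff M F' \<gamma> = group_coeff M F' (h n)" for F' by (intro group_coeff_on_space) auto
      then show ?thesis using eq by simp
    qed simp
    then show "(\<integral>x. (rep F x - rep G x) * cnj (\<gamma> x) \<partial>M) = 0"
      using integrable_mult_cnj_char[OF int(1) \<gamma>] integrable_mult_cnj_char[OF int(2) \<gamma>]
      by (simp add: group_coeff_def left_diff_distrib)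
  qed (use int in auto)
  then have "AE x in M. rep F x = rep G x" by eventually_elim simp
  from ae_class_cong[OF rep_Lp(1)[OF FG(1)] rep_Lp(1)[OF FG(2)] this]
  show ?thesis by (simp add: rep_Lp(3)[OF FG(1)] rep_Lp(3)[OF FG(2)])
qed

lemma monomial_torus_map_eq_iff:
  assumes k: "k \<in> multi_indices \<infinity>" and l: "l \<in> multi_indices \<infinity>"
  shows "(\<forall>x\<in>space M. monomial k (torus_map x) = monomial l (torus_map x)) \<longleftrightarrow>
    (\<forall>x\<in>space M. monomial (\<lambda>j. k j + - l j) (torus_map x) = 1)"
  by (intro ball_cong refl monomial_eq_iff_quotient[OF k l] norm_torus_map)

end

text \<open>Write \<open>F\<close> as \<open>g \<circ> torus_map\<close> for the first sequence and let \<open>G\<close> be the class of \<open>g \<circ> torus_map\<close>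
  for the second one. Norms and coefficients are integrals with respect to the common distribution. A
  character in the spectrum of \<open>G\<close> is a product of members of the second sequence; the same product
  of members of the first one is in the spectrum of \<open>F\<close> and therefore equals some \<open>h1 n\<close>. This is a
  relation, so it holds for the second sequence too.\<close>

theorem spectral_Hardy_transfer:
  assumes 1: "character_sequence M1 C1 h1" and 2: "character_sequence M2 C2 h2"
    and rel: "\<And>k. k \<in> multi_indices \<infinity> \<Longrightarrow> (\<forall>x\<in>space M1. monomial k (\<lambda>n. h1 n x) = 1) \<longleftrightarrow> (\<forall>x\<in>space M2. monomial k (\<lambda>n. h2 n x) = 1)"
    and p: "1 \<le> p" and F: "F \<in> spectral_Hardy p M1 C1 h1"
  shows "\<exists>G\<in>spectral_Hardy p M2 C2 h2. (\<lambda>n. group_coeff M2 G (h2 n)) = (\<lambda>n. group_coeff M1 F (h1 n)) \<and>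
    Lp_norm p M2 G = Lp_norm p M1 F"
proof -
  interpret A: character_sequence M1 C1 h1 by fact
  interpret B: character_sequence M2 C2 h2 by fact
  let ?single = "\<lambda>n j. if j = n then 1 else (0::int)"
  have single: "?single n \<in> multi_indices \<infinity>" for n by (rule multi_indices_single) simp
  define \<mu> where "\<mu> = distr M1 borel A.torus_map"
  have \<mu>: "\<mu> = distr M2 borel B.torus_map" unfolding \<mu>_def by (rule distr_torus_map_eq[OF 1 2 rel])
  have FL: "F \<in> Lp p M1" using F by (simp add: spectral_Hardy_def)
  have Fm: "rep F \<in> borel_measurable M1" and Fi: "integrable M1 (rep F)" and Fp: "mem_Lp p M1 (rep F)"
    using rep_Lp[OF FL] A.Lp_integrable[OF p FL] by auto
  obtain g where g': "g \<in> borel_measurable borel" "integrable (distr M1 borel A.torus_map) g"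
    and gF: "AE x in M1. rep F x = g (A.torus_map x)"
  proof (rule A.factorization[OF Fi])
    fix \<gamma> assume "\<gamma> \<in> C1" "(\<integral>x. rep F x * cnj (\<gamma> x) \<partial>M1) \<noteq> 0"
    then obtain n where "\<forall>x\<in>space M1. \<gamma> x = h1 n x"
      using F by (auto simp: spectral_Hardy_def group_coeff_def)
    then show "\<exists>k\<in>multi_indices \<infinity>. \<forall>x\<in>space M1. \<gamma> x = monomial k (A.torus_map x)"
      using single[of n] by (intro bexI[of _ "?single n"]) (simp_all add: monomial_single A.torus_map_def)
  qed (rule that)
  have g: "g \<in> borel_measurable borel" "integrable \<mu> g" using g' by (simp_all add: \<mu>_def)
  have gA: "(\<lambda>x. g (A.torus_map x)) \<in> borel_measurable M1" using g(1) by measurable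
  have gB: "(\<lambda>x. g (B.torus_map x)) \<in> borel_measurable M2" using g(1) by measurable
  note FA = Lp_functionals_cong_AE[OF Fm gA gF]
  note A\<mu> = Lp_functionals_distr[OF A.measurable_torus_map g(1), folded \<mu>_def]
  note B\<mu> = Lp_functionals_distr[OF B.measurable_torus_map g(1), folded \<mu>]
  define G where "G = ae_class M2 (\<lambda>x. g (B.torus_map x))"
  have GL: "G \<in> Lp p M2" unfolding G_def by (rule ae_class_in_Lp) (use Fp FA(1) A\<mu>(1) B\<mu>(1) in blast)
  have Gnorm: "Lp_norm p M2 G = Lp_norm p M1 F"
    unfolding G_def Lp_norm_ae_class[OF gB] using FA(2) A\<mu>(2) B\<mu>(2) by (simp add: Lp_norm_def)
  have coeff: "group_coeff M2 G (\<lambda>x. monomial k (B.torus_map x)) = group_coeff M1 F (\<lambda>x. monomial k (A.torus_map x))"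
    if k: "k \<in> multi_indices \<infinity>" for k
  proof -
    have mA: "(\<lambda>x. monomial k (A.torus_map x)) \<in> borel_measurable M1"
      by (rule A.measurable_char[OF A.monomial_torus_map_char[OF k]])
    have mB: "(\<lambda>x. monomial k (B.torus_map x)) \<in> borel_measurable M2"
      by (rule B.measurable_char[OF B.monomial_torus_map_char[OF k]])
    have "group_coeff M2 G (\<lambda>x. monomial k (B.torus_map x)) = (\<integral>y. g y * cnj (monomial k y) \<partial>\<mu>)"
      unfolding G_def group_coeff_ae_class[OF gB mB] \<mu> by (rule B.coeff_of_composition_eq[OF g(1)]) simp
    also have "\<dots> = (\<integral>x. g (A.torus_map x) * cnj (monomial k (A.torus_map x)) \<partial>M1)"
      unfolding \<mu>_def by (rule A.coeff_of_composition_eq[OF g(1), symmetric]) simp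
    also have "\<dots> = group_coeff M1 F (\<lambda>x. monomial k (A.torus_map x))"
      unfolding group_coeff_ae_class[OF gA mA, symmetric] ae_class_cong[OF Fm gA gF, symmetric] rep_Lp(3)[OF FL] ..
    finally show ?thesis .
  qed
  have coeff_h: "group_coeff M2 G (h2 n) = group_coeff M1 F (h1 n)" for n
    using coeff[OF single[of n]] by (simp add: monomial_single A.torus_map_def B.torus_map_def)
  have "\<exists>n. \<forall>x\<in>space M2. \<gamma> x = h2 n x" if \<gamma>: "\<gamma> \<in> C2" "group_coeff M2 G \<gamma> \<noteq> 0" for \<gamma>
  proof -
    have "(\<integral>x. g (B.torus_map x) * cnj (\<gamma> x) \<partial>M2) \<noteq> 0"
      using \<gamma>(2) unfolding G_def group_coeff_ae_class[OF gB B.measurable_char[OF \<gamma>(1)]] .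
    then obtain k where k: "k \<in> multi_indices \<infinity>" "\<forall>x\<in>space M2. \<gamma> x = monomial k (B.torus_map x)"
      using B.coeff_of_composition_zero[OF g(2)[unfolded \<mu>] \<gamma>(1)] by blast
    have "group_coeff M1 F (\<lambda>x. monomial k (A.torus_map x)) \<noteq> 0"
      using \<gamma>(2) coeff[OF k(1)] B.group_coeff_on_space[of \<gamma> "\<lambda>x. monomial k (B.torus_map x)" G] k(2) by simp
    then obtain n where n: "\<forall>x\<in>space M1. monomial k (A.torus_map x) = h1 n x"
      using F A.monomial_torus_map_char[OF k(1)] unfolding spectral_Hardy_def by blast
    then have "\<forall>x\<in>space M1. monomial k (A.torus_map x) = monomial (?single n) (A.torus_map x)"
      by (simp add: monomial_single A.torus_map_def)
    then have "\<forall>x\<in>space M1. monomial (\<lambda>j. k j + - ?single n j) (A.torus_map x) = 1"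
      by (rule A.monomial_torus_map_eq_iff[OF k(1) single, THEN iffD1])
    then have "\<forall>x\<in>space M2. monomial (\<lambda>j. k j + - ?single n j) (B.torus_map x) = 1"
      using rel[OF multi_indices_add[OF k(1) multi_indices_uminus[OF single[of n]]]]
      by (simp only: A.torus_map_def B.torus_map_def)
    then have "\<forall>x\<in>space M2. monomial k (B.torus_map x) = monomial (?single n) (B.torus_map x)"
      by (rule B.monomial_torus_map_eq_iff[OF k(1) single, THEN iffD2])
    then show ?thesis using k(2) by (auto simp: monomial_single B.torus_map_def)
  qed
  then have "G \<in> spectral_Hardy p M2 C2 h2" using GL by (simp add: spectral_Hardy_def)
  then show ?thesis using coeff_h Gnorm by (intro bexI[of _ G]) auto
qed

section \<open>The torus\<close>

lemma space_circle: "space circle_measure = sphere 0 1"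
  by (simp add: circle_measure_def space_restrict_space)

lemma sets_circle: "sets circle_measure = sets (restrict_space borel (sphere 0 1))"
  by (simp add: circle_measure_def)

lemma measurable_cis_circle: "cis \<in> uniform_measure lborel {0..2 * pi} \<rightarrow>\<^sub>M restrict_space borel (sphere 0 1)"
proof (rule measurable_restrict_space2)
  have "cis \<in> borel_measurable borel"
    by (rule borel_measurable_continuous_onI) (simp add: continuous_on_cis continuous_on_id)
  moreover have s: "sets (uniform_measure lborel {0..2 * pi}) = sets borel" by simp
  ultimately show "cis \<in> borel_measurable (uniform_measure lborel {0..2 * pi})"
    unfolding measurable_cong_sets[OF s refl, of "borel :: complex measure"] by simp
qed auto

lemma prob_space_circle: "prob_space circle_measure"
  unfolding circle_measure_def
  by (intro prob_space.prob_space_distr prob_space_uniform_measure measurable_cis_circle) auto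

lemma integral_circle_powi:
  assumes k: "k \<noteq> 0"
  shows "(\<integral>z. z powi k \<partial>circle_measure) = 0"
proof -
  have m: "(\<lambda>z :: complex. z powi k) \<in> borel_measurable (restrict_space borel (sphere 0 1))"
    by (rule measurable_restrict_space1) (cases "k \<ge> 0"; simp add: power_int_def)
  have cm: "(\<lambda>t. cis (real_of_int k * t)) \<in> borel_measurable borel"
    by (rule borel_measurable_continuous_onI) (intro continuous_intros)
  have "(\<integral>z. z powi k \<partial>circle_measure) = (\<integral>t. cis t powi k \<partial>uniform_measure lborel {0..2 * pi})"
    unfolding circle_measure_def by (rule integral_distr[OF measurable_cis_circle m])
  also have "\<dots> = (\<integral>t. cis (real_of_int k * t) \<partial>uniform_measure lborel {0..2 * pi})"
    by (simp add: cis_power_int)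
  also have "\<dots> = (\<integral>t. (indicator {0..2 * pi} t / (2 * pi)) *\<^sub>R cis (real_of_int k * t) \<partial>lborel)"
  proof -
    have "uniform_measure lborel {0..2 * pi} = density lborel (\<lambda>t. ennreal (indicator {0..2 * pi} t / (2 * pi)))"
      unfolding uniform_measure_def
      by (rule density_cong) (auto simp: indicator_def divide_ennreal ennreal_1[symmetric] simp del: ennreal_1)
    then show ?thesis using cm by (subst (1) \<open>uniform_measure _ _ = _\<close>) (rule integral_density; auto)
  qed
  also have "\<dots> = (\<integral>t. indicator {0..2 * pi} t *\<^sub>R (cis (real_of_int k * t) / (2 * pi)) \<partial>lborel)"
    by (rule Bochner_Integration.integral_cong) (auto simp: indicator_def scaleR_conv_of_real)
  also have "\<dots> = (cis (real_of_int k * (2 * pi)) / (\<i> * k * 2 * pi)) - (cis (real_of_int k * 0) / (\<i> * k * 2 * pi))"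
  proof (rule has_bochner_integral_integral_eq, rule has_bochner_integral_FTC_Icc)
    fix t :: real
    have "((\<lambda>z. exp (\<i> * of_int k * z) / (\<i> * k * 2 * pi)) has_field_derivative
        exp (\<i> * of_int k * of_real t) / (2 * pi)) (at (of_real t))"
      using k by (auto intro!: derivative_eq_intros)
    from has_vector_derivative_real_field[OF this]
    show "((\<lambda>t. cis (real_of_int k * t) / (\<i> * k * 2 * pi)) has_vector_derivative cis (real_of_int k * t) / (2 * pi)) (at t within {0..2 * pi})"
      by (simp add: cis_conv_exp mult_ac)
  next
    show "continuous_on {0..2 * pi} (\<lambda>t. cis (real_of_int k * t) / complex_of_real (2 * pi))"
      by (intro continuous_intros) auto
  qed simp
  also have "cis (real_of_int k * (2 * pi)) = 1"
    using cis_multiple_2pi[of "real_of_int k"] by (simp add: mult.commute)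
  finally show ?thesis by simp
qed

lemma space_torus: "space (torus_measure N) = PiE (indices N) (\<lambda>_. sphere 0 1)"
  by (simp add: torus_measure_def space_PiM space_circle)

lemma norm_torus: "w \<in> space (torus_measure N) \<Longrightarrow> j \<in> indices N \<Longrightarrow> norm (w j) = 1"
  by (auto simp: space_torus PiE_def Pi_def)

lemma prob_space_torus: "prob_space (torus_measure N)"
  unfolding torus_measure_def by (intro prob_space_PiM prob_space_circle)

lemma measurable_torus_coordinate:
  assumes "j \<in> indices N"
  shows "(\<lambda>w. w j) \<in> borel_measurable (torus_measure N)"
proof -
  have "(\<lambda>w. w j) \<in> torus_measure N \<rightarrow>\<^sub>M circle_measure"
    unfolding torus_measure_def by (rule measurable_component_singleton[OF assms])
  then have "(\<lambda>w. w j) \<in> torus_measure N \<rightarrow>\<^sub>M restrict_space borel (sphere 0 1)"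
    by (simp add: measurable_cong_sets[OF refl sets_circle])
  then show ?thesis by (simp add: measurable_restrict_space2_iff)
qed

lemma measurable_torus_monomial:
  assumes "\<alpha> \<in> multi_indices N"
  shows "monomial \<alpha> \<in> borel_measurable (torus_measure N)"
proof -
  have "(\<lambda>w. w j powi \<alpha> j) \<in> borel_measurable (torus_measure N)" if "j \<in> {j. \<alpha> j \<noteq> 0}" for j
  proof -
    have [measurable]: "(\<lambda>w. w j) \<in> borel_measurable (torus_measure N)"
      using that assms by (intro measurable_torus_coordinate) (auto simp: multi_indices_def)
    show ?thesis by (cases "\<alpha> j \<ge> 0") (simp_all add: power_int_def)
  qed
  then show ?thesis unfolding monomial_def[abs_def] by (rule borel_measurable_prod)
qed

lemma integral_torus_monomial:
  assumes \<alpha>: "\<alpha> \<in> multi_indices N" "\<alpha> \<noteq> (\<lambda>j. 0)"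
  shows "(\<integral>w. monomial \<alpha> w \<partial>torus_measure N) = 0"
proof -
  interpret c: prob_space circle_measure by (rule prob_space_circle)
  interpret P: product_prob_space "\<lambda>_. circle_measure" "indices N" ..
  define J where "J = {j. \<alpha> j \<noteq> 0}"
  have J: "finite J" "J \<subseteq> indices N" using \<alpha>(1) by (auto simp: J_def multi_indices_def)
  have res: "(\<lambda>w. restrict w J) \<in> torus_measure N \<rightarrow>\<^sub>M PiM J (\<lambda>_. circle_measure)"
    unfolding torus_measure_def by (rule measurable_restrict_subset[OF J(2)])
  have pm: "(\<lambda>z :: complex. z powi k) \<in> borel_measurable circle_measure" for k
  proof -
    have "(\<lambda>z :: complex. z powi k) \<in> borel_measurable (restrict_space borel (sphere 0 1))"
      by (rule measurable_restrict_space1) (cases "k \<ge> 0"; simp add: power_int_def)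
    then show ?thesis by (simp add: measurable_cong_sets[OF sets_circle refl])
  qed
  have m: "(\<lambda>w. \<Prod>j\<in>J. w j powi \<alpha> j) \<in> borel_measurable (PiM J (\<lambda>_. circle_measure))"
  proof (rule borel_measurable_prod)
    fix j assume "j \<in> J"
    from measurable_component_singleton[OF this]
    show "(\<lambda>w. w j powi \<alpha> j) \<in> borel_measurable (PiM J (\<lambda>_. circle_measure))"
      by (rule measurable_compose) (rule pm)
  qed
  have "(\<integral>w. monomial \<alpha> w \<partial>torus_measure N) = (\<integral>w. (\<Prod>j\<in>J. restrict w J j powi \<alpha> j) \<partial>torus_measure N)"
    unfolding monomial_def J_def[symmetric] by (intro Bochner_Integration.integral_cong prod.cong) auto
  also have "\<dots> = (\<integral>w. (\<Prod>j\<in>J. w j powi \<alpha> j) \<partial>distr (torus_measure N) (PiM J (\<lambda>_. circle_measure)) (\<lambda>w. restrict w J))"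
    by (rule integral_distr[OF res m, symmetric])
  also have "distr (torus_measure N) (PiM J (\<lambda>_. circle_measure)) (\<lambda>w. restrict w J) = PiM J (\<lambda>_. circle_measure)"
    unfolding torus_measure_def by (rule P.distr_PiM_restrict_finite[OF J])
  also have "(\<integral>w. (\<Prod>j\<in>J. w j powi \<alpha> j) \<partial>PiM J (\<lambda>_. circle_measure)) = (\<Prod>j\<in>J. \<integral>z. z powi \<alpha> j \<partial>circle_measure)"
  proof (rule P.product_integral_prod[OF J(1)])
    show "integrable circle_measure (\<lambda>z. z powi \<alpha> j)" for j
      by (rule c.integrable_const_bound[of _ 1]) (use pm in \<open>auto simp: space_circle norm_power_int\<close>)
  qed
  also have "\<dots> = 0"
  proof -
    obtain j where "\<alpha> j \<noteq> 0" using \<alpha>(2) by auto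
    then show ?thesis using J(1) integral_circle_powi by (intro prod_zero) (auto simp: J_def)
  qed
  finally show ?thesis .
qed

definition torus_chars :: "enat \<Rightarrow> ((nat \<Rightarrow> complex) \<Rightarrow> complex) set" where
  "torus_chars N = {\<gamma>. \<exists>\<alpha>\<in>multi_indices N. \<forall>w\<in>space (torus_measure N). \<gamma> w = monomial \<alpha> w}"

lemma monomial_in_torus_chars: "\<alpha> \<in> multi_indices N \<Longrightarrow> monomial \<alpha> \<in> torus_chars N"
  by (auto simp: torus_chars_def)

text \<open>An embedding into the infinite torus, where moments determine densities.\<close>

definition extend_torus :: "enat \<Rightarrow> (nat \<Rightarrow> complex) \<Rightarrow> nat \<Rightarrow> complex" where
  "extend_torus N w j = (if j \<in> indices N then w j else 1)"

lemma measurable_extend_torus: "extend_torus N \<in> torus_measure N \<rightarrow>\<^sub>M borel"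
proof (rule measurable_coordinatewise_then_product)
  fix j
  show "(\<lambda>w. extend_torus N w j) \<in> borel_measurable (torus_measure N)"
    using measurable_torus_coordinate[of j N] by (cases "j \<in> indices N") (simp_all add: extend_torus_def)
qed

text \<open>Lets the uniqueness theorem for the infinite torus, which speaks of Borel sets, reach every
  measurable set of the product measure.\<close>

lemma sets_torus_extend:
  assumes X: "X \<in> sets (torus_measure N)"
  obtains A where "A \<in> sets borel" "X = extend_torus N -` A \<inter> space (torus_measure N)"
proof -
  let ?V = "vimage_algebra (space (torus_measure N)) (extend_torus N) borel"
  have sp: "space ?V = space (torus_measure N)" by simp
  have "(\<lambda>w. w) \<in> ?V \<rightarrow>\<^sub>M torus_measure N"
    unfolding torus_measure_def
  proof (rule measurable_PiM_single')
    show "(\<lambda>w. w) \<in> space (vimage_algebra (space (PiM (indices N) (\<lambda>_. circle_measure))) (extend_torus N) borel) \<rightarrow> (\<Pi>\<^sub>E i\<in>indices N. space circle_measure)"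
      by (auto simp: space_PiM)
    fix i assume i: "i \<in> indices N"
    have "(\<lambda>w. w i) \<in> ?V \<rightarrow>\<^sub>M restrict_space borel (sphere 0 1)"
    proof (rule measurable_restrict_space2)
      show "(\<lambda>w. w i) \<in> space ?V \<rightarrow> sphere 0 1" using norm_torus[OF _ i] by auto
      have e: "extend_torus N \<in> ?V \<rightarrow>\<^sub>M borel" by (rule measurable_vimage_algebra1) auto
      have "(\<lambda>w :: nat \<Rightarrow> complex. w i) \<in> borel_measurable borel"
        by (rule borel_measurable_continuous_onI) (rule continuous_on_product_coordinates)
      from measurable_compose[OF e this] show "(\<lambda>w. w i) \<in> borel_measurable ?V"
        using i by (simp add: extend_torus_def)
    qed
    then show "(\<lambda>w. w i) \<in> vimage_algebra (space (PiM (indices N) (\<lambda>_. circle_measure))) (extend_torus N) borel \<rightarrow>\<^sub>M circle_measure"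
      by (simp add: measurable_cong_sets[OF refl sets_circle] torus_measure_def)
  qed
  from measurable_sets[OF this X] have "X \<in> sets ?V"
    using sets.sets_into_space[OF X] by (simp add: Int_absorb2)
  then show ?thesis using that by (subst (asm) sets_vimage_algebra2) auto
qed

text \<open>Completeness holds because the Fourier coefficients of \<open>f\<close> become moments on the infinite torus
  under \<open>extend_torus\<close>.\<close>

lemma character_system_torus: "character_system (torus_measure N) (torus_chars N)"
proof -
  interpret prob_space "torus_measure N" by (rule prob_space_torus)
  show ?thesis
  proof
    fix \<gamma> assume \<gamma>: "\<gamma> \<in> torus_chars N"
    obtain \<alpha> where \<alpha>: "\<alpha> \<in> multi_indices N" "\<And>w. w \<in> space (torus_measure N) \<Longrightarrow> \<gamma> w = monomial \<alpha> w"
      using \<gamma> by (auto simp: torus_chars_def)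
    show "\<gamma> \<in> borel_measurable (torus_measure N)"
      using measurable_torus_monomial[OF \<alpha>(1)] measurable_cong[of "torus_measure N" \<gamma> "monomial \<alpha>"] \<alpha>(2) by blast
    show "norm (\<gamma> w) = 1" if w: "w \<in> space (torus_measure N)" for w
      unfolding \<alpha>(2)[OF w] by (rule norm_monomial[OF \<alpha>(1)]) (rule norm_torus[OF w])
    show "(\<lambda>w. cnj (\<gamma> w)) \<in> torus_chars N"
      unfolding torus_chars_def
    proof (intro CollectI bexI ballI)
      fix w assume w: "w \<in> space (torus_measure N)"
      show "cnj (\<gamma> w) = monomial (\<lambda>j. - \<alpha> j) w"
        unfolding \<alpha>(2)[OF w] by (rule monomial_uminus[OF \<alpha>(1), symmetric]) (rule norm_torus[OF w])
    qed (rule multi_indices_uminus[OF \<alpha>(1)])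
    show "\<delta> \<in> torus_chars N" if "\<And>w. w \<in> space (torus_measure N) \<Longrightarrow> \<delta> w = \<gamma> w" for \<delta>
      unfolding torus_chars_def using that \<alpha> by auto
    show "(\<integral>w. \<gamma> w \<partial>torus_measure N) = 0" if "w \<in> space (torus_measure N)" "\<gamma> w \<noteq> 1" for w
    proof -
      have "\<alpha> \<noteq> (\<lambda>j. 0)" using that \<alpha>(2) by auto
      from integral_torus_monomial[OF \<alpha>(1) this] show ?thesis
        using Bochner_Integration.integral_cong[of "torus_measure N" "torus_measure N" \<gamma> "monomial \<alpha>"] \<alpha>(2) by simp
    qed
    fix \<delta> assume "\<delta> \<in> torus_chars N"
    then obtain \<alpha>' where \<alpha>': "\<alpha>' \<in> multi_indices N" "\<And>w. w \<in> space (torus_measure N) \<Longrightarrow> \<delta> w = monomial \<alpha>' w"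
      by (auto simp: torus_chars_def)
    show "(\<lambda>w. \<gamma> w * \<delta> w) \<in> torus_chars N"
      unfolding torus_chars_def
    proof (intro CollectI bexI ballI)
      fix w assume w: "w \<in> space (torus_measure N)"
      have nz: "w j \<noteq> 0" if "j \<in> indices N" for j using norm_torus[OF w that] by auto
      show "\<gamma> w * \<delta> w = monomial (\<lambda>j. \<alpha> j + \<alpha>' j) w"
        unfolding \<alpha>(2)[OF w] \<alpha>'(2)[OF w] by (rule monomial_add[OF \<alpha>(1) \<alpha>'(1), symmetric]) (rule nz)
    qed (rule multi_indices_add[OF \<alpha>(1) \<alpha>'(1)])
  next
    show "(\<lambda>w. 1) \<in> torus_chars N"
      by (auto simp: torus_chars_def intro!: bexI[OF _ multi_indices_zero])
  next
    fix f assume f: "integrable (torus_measure N) f"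
      and coeff: "\<And>\<gamma>. \<gamma> \<in> torus_chars N \<Longrightarrow> (\<integral>w. f w * cnj (\<gamma> w) \<partial>torus_measure N) = 0"
    have norm_ext: "norm (extend_torus N w j) = 1" if "w \<in> space (torus_measure N)" for w j
      using norm_torus[OF that] by (simp add: extend_torus_def)
    have moment: "(\<integral>w. f w * monomial k (extend_torus N w) \<partial>torus_measure N) = 0" if k: "k \<in> multi_indices \<infinity>" for k
    proof -
      define \<alpha> where "\<alpha> j = (if j \<in> indices N then k j else 0)" for j
      have fin: "finite {j. k j \<noteq> 0}" using k by (simp add: multi_indices_def)
      have \<alpha>: "\<alpha> \<in> multi_indices N"
      proof -
        have "{j. \<alpha> j \<noteq> 0} \<subseteq> {j. k j \<noteq> 0}" by (auto simp: \<alpha>_def)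
        then show ?thesis using finite_subset[OF _ fin] by (auto simp: multi_indices_def \<alpha>_def)
      qed
      have "monomial k (extend_torus N w) = cnj (monomial (\<lambda>j. - \<alpha> j) w)" if w: "w \<in> space (torus_measure N)" for w
      proof -
        have "monomial k (extend_torus N w) = (\<Prod>j\<in>{j. k j \<noteq> 0}. w j powi \<alpha> j)"
          unfolding monomial_def by (intro prod.cong) (auto simp: extend_torus_def \<alpha>_def)
        also have "\<dots> = monomial \<alpha> w" by (rule monomial_eq_prod[OF fin, symmetric]) (auto simp: \<alpha>_def)
        also have "\<dots> = cnj (monomial (\<lambda>j. - \<alpha> j) w)"
        proof -
          have "monomial (\<lambda>j. - \<alpha> j) w = cnj (monomial \<alpha> w)"
            by (rule monomial_uminus[OF \<alpha>]) (rule norm_torus[OF w])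
          then show ?thesis by simp
        qed
        finally show ?thesis .
      qed
      then have "(\<integral>w. f w * monomial k (extend_torus N w) \<partial>torus_measure N) = (\<integral>w. f w * cnj (monomial (\<lambda>j. - \<alpha> j) w) \<partial>torus_measure N)"
        by (intro Bochner_Integration.integral_cong) simp_all
      also have "\<dots> = 0" by (rule coeff[OF monomial_in_torus_chars[OF multi_indices_uminus[OF \<alpha>]]])
      finally show ?thesis .
    qed
    show "AE w in torus_measure N. f w = 0"
    proof (rule density_zero[OF f])
      fix X assume X: "X \<in> sets (torus_measure N)"
      obtain A where A: "A \<in> sets borel" "X = extend_torus N -` A \<inter> space (torus_measure N)"
        using sets_torus_extend[OF X] by metis
      have "(\<integral>w. f w * indicator A (extend_torus N w) \<partial>torus_measure N) = (\<integral>w. 0 * indicator A (extend_torus N w) \<partial>torus_measure N)"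
        by (rule torus_moments_determine_measure[OF measurable_extend_torus norm_ext measurable_extend_torus norm_ext f _ _ A(1)])
          (simp_all add: moment)
      moreover have "(\<integral>w. indicator X w *\<^sub>R f w \<partial>torus_measure N) = (\<integral>w. f w * indicator A (extend_torus N w) \<partial>torus_measure N)"
        by (rule Bochner_Integration.integral_cong) (auto simp: A(2) indicator_def)
      ultimately show "set_lebesgue_integral (torus_measure N) X f = 0" by (simp add: set_lebesgue_integral_def)
    qed
  qed
qed

text \<open>A nonzero exponent gives integral \<open>0\<close>, the constant \<open>1\<close> has integral \<open>1\<close>.\<close>

lemma monomial_eq_one_iff:
  assumes \<alpha>: "\<alpha> \<in> multi_indices N"
  shows "(\<forall>w\<in>space (torus_measure N). monomial \<alpha> w = 1) \<longleftrightarrow> \<alpha> = (\<lambda>j. 0)"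
proof
  assume one: "\<forall>w\<in>space (torus_measure N). monomial \<alpha> w = 1"
  interpret prob_space "torus_measure N" by (rule prob_space_torus)
  show "\<alpha> = (\<lambda>j. 0)"
  proof (rule ccontr)
    assume "\<alpha> \<noteq> (\<lambda>j. 0)"
    from integral_torus_monomial[OF \<alpha> this] have "(\<integral>w. monomial \<alpha> w \<partial>torus_measure N) = 0" .
    moreover have "(\<integral>w. monomial \<alpha> w \<partial>torus_measure N) = (\<integral>w. 1 \<partial>torus_measure N)"
      by (rule Bochner_Integration.integral_cong) (use one in auto)
    ultimately show False by (simp add: prob_space)
  qed
qed simp

lemma monomial_inject:
  assumes \<alpha>: "\<alpha> \<in> multi_indices N" and \<alpha>': "\<alpha>' \<in> multi_indices N"
    and eq: "\<forall>w\<in>space (torus_measure N). monomial \<alpha> w = monomial \<alpha>' w"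
  shows "\<alpha> = \<alpha>'"
proof -
  have "\<forall>w\<in>space (torus_measure N). monomial (\<lambda>j. \<alpha> j + - \<alpha>' j) w = 1"
    using eq monomial_eq_iff_quotient[OF \<alpha> \<alpha>'] norm_torus by blast
  then have "(\<lambda>j. \<alpha> j + - \<alpha>' j) = (\<lambda>j. 0)"
    using monomial_eq_one_iff[OF multi_indices_add[OF \<alpha> multi_indices_uminus[OF \<alpha>']]] by blast
  then have "\<alpha> j + - \<alpha>' j = 0" for j by (rule fun_cong)
  then show ?thesis by auto
qed

text \<open>The exponent \<open>\<Sum> k\<^sub>n \<alpha>\<^sub>n\<close> of the product of the monomials with exponents \<open>\<alpha>\<^sub>n\<close>, taken to the powers
  \<open>k\<^sub>n\<close>; see \<open>monomial_of_monomials\<close>.\<close>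

definition combine_indices :: "(nat \<Rightarrow> int) \<Rightarrow> (nat \<Rightarrow> nat \<Rightarrow> int) \<Rightarrow> nat \<Rightarrow> int" where
  "combine_indices k \<alpha> j = (\<Sum>n | k n \<noteq> 0. k n * \<alpha> n j)"

text \<open>One finite set of coordinates carries all multi-indices involved, so that sums and products over
  coordinates and over \<open>n\<close> can be interchanged.\<close>

lemma combine_indices_support:
  assumes k: "k \<in> multi_indices \<infinity>" and \<alpha>: "\<And>n. \<alpha> n \<in> multi_indices N"
  shows "\<exists>J. finite J \<and> J \<subseteq> indices N \<and> (\<forall>n. k n \<noteq> 0 \<longrightarrow> {j. \<alpha> n j \<noteq> 0} \<subseteq> J) \<and>
    {j. combine_indices k \<alpha> j \<noteq> 0} \<subseteq> J"
proof (intro exI conjI allI impI)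
  let ?J = "\<Union>n\<in>{n. k n \<noteq> 0}. {j. \<alpha> n j \<noteq> 0}"
  show "finite ?J" using k \<alpha> by (auto simp: multi_indices_def)
  show "?J \<subseteq> indices N" using \<alpha> by (auto simp: multi_indices_def)
  show "{j. \<alpha> n j \<noteq> 0} \<subseteq> ?J" if "k n \<noteq> 0" for n using that by auto
  show "{j. combine_indices k \<alpha> j \<noteq> 0} \<subseteq> ?J"
  proof
    fix j assume "j \<in> {j. combine_indices k \<alpha> j \<noteq> 0}"
    then have "(\<Sum>n | k n \<noteq> 0. k n * \<alpha> n j) \<noteq> 0" by (simp add: combine_indices_def)
    then obtain n where "k n \<noteq> 0" "k n * \<alpha> n j \<noteq> 0" by (rule sum.not_neutral_contains_not_neutral) auto
    then show "j \<in> ?J" by auto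
  qed
qed

lemma combine_indices_mem:
  assumes k: "k \<in> multi_indices \<infinity>" and \<alpha>: "\<And>n. \<alpha> n \<in> multi_indices N"
  shows "combine_indices k \<alpha> \<in> multi_indices N"
proof -
  obtain J where J: "finite J" "J \<subseteq> indices N" "{j. combine_indices k \<alpha> j \<noteq> 0} \<subseteq> J"
    using combine_indices_support[where k = k and \<alpha> = \<alpha>, OF k \<alpha>] by blast
  then show ?thesis by (auto simp: multi_indices_def intro: finite_subset)
qed

lemma monomial_of_monomials:
  assumes k: "k \<in> multi_indices \<infinity>" and \<alpha>: "\<And>n. \<alpha> n \<in> multi_indices N" and w: "\<And>j. j \<in> indices N \<Longrightarrow> w j \<noteq> 0"
  shows "monomial k (\<lambda>n. monomial (\<alpha> n) w) = monomial (combine_indices k \<alpha>) w"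
proof -
  obtain J where J: "finite J" "J \<subseteq> indices N" "\<And>n. k n \<noteq> 0 \<Longrightarrow> {j. \<alpha> n j \<noteq> 0} \<subseteq> J"
    "{j. combine_indices k \<alpha> j \<noteq> 0} \<subseteq> J"
    using combine_indices_support[where k = k and \<alpha> = \<alpha>, OF k \<alpha>] by blast
  have fin: "finite {n. k n \<noteq> 0}" using k by (simp add: multi_indices_def)
  have pint: "prod g J powi c = (\<Prod>j\<in>J. g j powi c)" for g :: "nat \<Rightarrow> complex" and c
    using J(1) by (induction J) (simp_all add: power_int_mult_distrib)
  have psum: "z powi (\<Sum>n\<in>S. c n) = (\<Prod>n\<in>S. z powi c n)" if "z \<noteq> 0" "finite S" for z :: complex and c and S :: "nat set"
    using that(2) by (induction S) (simp_all add: power_int_add that(1))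
  have "monomial k (\<lambda>n. monomial (\<alpha> n) w) = (\<Prod>n | k n \<noteq> 0. (\<Prod>j\<in>J. w j powi \<alpha> n j) powi k n)"
    unfolding monomial_def[of k] by (intro prod.cong refl arg_cong2[where f = "(powi)"] monomial_eq_prod J) auto
  also have "\<dots> = (\<Prod>n | k n \<noteq> 0. \<Prod>j\<in>J. w j powi (k n * \<alpha> n j))"
    by (simp add: pint power_int_mult[symmetric] mult.commute)
  also have "\<dots> = (\<Prod>j\<in>J. \<Prod>n | k n \<noteq> 0. w j powi (k n * \<alpha> n j))" by (rule prod.swap)
  also have "\<dots> = (\<Prod>j\<in>J. w j powi combine_indices k \<alpha> j)"
    unfolding combine_indices_def using J(2) w by (intro prod.cong refl psum[symmetric] fin) auto
  also have "\<dots> = monomial (combine_indices k \<alpha>) w" by (rule monomial_eq_prod[OF J(1,4), symmetric])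
  finally show ?thesis .
qed

lemma rational_independence_integer:
  assumes inj: "inj_on b (indices N)" and ind: "module.independent (\<lambda>q x. of_rat q * x) (b ` indices N)"
    and c: "c \<in> multi_indices N"
  shows "(\<Sum>j | c j \<noteq> 0. of_int (c j) * b j) = (0 :: real) \<longleftrightarrow> c = (\<lambda>j. 0)"
proof
  interpret module "\<lambda>(q::rat) (x::real). of_rat q * x"
    by standard (simp_all add: of_rat_add of_rat_mult algebra_simps)
  define J where "J = {j. c j \<noteq> 0}"
  have J: "finite J" "J \<subseteq> indices N" using c by (auto simp: J_def multi_indices_def)
  have injJ: "inj_on b J" by (rule inj_on_subset[OF inj J(2)])
  assume z: "(\<Sum>j | c j \<noteq> 0. of_int (c j) * b j) = (0 :: real)"
  define u where "u v = (of_int (c (the_inv_into J b v)) :: rat)" for v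
  have u: "u (b j) = of_int (c j)" if "j \<in> J" for j
    using that injJ by (simp add: u_def the_inv_into_f_f)
  have "(\<Sum>v\<in>b ` J. of_rat (u v) * v) = (\<Sum>j\<in>J. of_rat (u (b j)) * b j)"
    using injJ by (simp add: sum.reindex)
  also have "\<dots> = (\<Sum>j\<in>J. of_int (c j) * b j)" by (intro sum.cong refl) (simp add: u)
  also have "\<dots> = 0" using z by (simp add: J_def)
  finally have s: "(\<Sum>v\<in>b ` J. of_rat (u v) * v) = 0" .
  have "c j = 0" for j
  proof (rule ccontr)
    assume "c j \<noteq> 0"
    then have j: "j \<in> J" by (simp add: J_def)
    have "u (b j) = 0"
      by (rule independentD[OF ind _ _ s]) (use J j in auto)
    then show False using u[OF j] \<open>c j \<noteq> 0\<close> by simp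
  qed
  then show "c = (\<lambda>j. 0)" by auto
qed simp

section \<open>Dirichlet groups as systems of characters\<close>

text \<open>Orthogonality follows from translation invariance, completeness from
  \<open>group_fourier_coefficients_determine\<close>.\<close>

lemma character_system_group:
  fixes \<beta> :: "real \<Rightarrow> 'g::{topological_ab_group_add, t2_space}" and m :: "'g measure"
  assumes G: "dirichlet_group \<beta>" and m: "normalized_haar m"
  shows "character_system m (Collect group_character)"
proof -
  have sets: "sets m = sets borel" and prob: "prob_space m"
    and inv: "\<And>a. distr m m (\<lambda>x. a + x) = m"
    using m by (auto simp: normalized_haar_def)
  have space: "space m = UNIV" using sets_eq_imp_space_eq[OF sets] by simp
  interpret prob_space m by fact
  show ?thesis
  proof
    fix \<gamma> :: "'g \<Rightarrow> complex" assume "\<gamma> \<in> Collect group_character"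
    then have \<gamma>: "group_character \<gamma>" by simp
    show \<gamma>m: "\<gamma> \<in> borel_measurable m" by (rule borel_measurable_group_character[OF sets \<gamma>])
    show "norm (\<gamma> x) = 1" for x using \<gamma> by (simp add: group_character_def)
    show "(\<lambda>x. cnj (\<gamma> x)) \<in> Collect group_character" using group_character_cnj[OF \<gamma>] by simp
    show "(\<lambda>x. \<gamma> x * \<delta> x) \<in> Collect group_character" if "\<delta> \<in> Collect group_character" for \<delta>
      using group_character_mult[OF \<gamma>] that by simp
    show "\<delta> \<in> Collect group_character" if "\<And>x. x \<in> space m \<Longrightarrow> \<delta> x = \<gamma> x" for \<delta>
    proof -
      have "\<delta> = \<gamma>" using that by (auto simp: space)
      then show ?thesis using \<gamma> by simp
    qed
    show "(\<integral>x. \<gamma> x \<partial>m) = 0" if a: "\<gamma> a \<noteq> 1" for a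
    proof -
      have "(\<lambda>x. a + x) \<in> borel_measurable borel"
        by (rule borel_measurable_continuous_onI) (intro continuous_intros)
      then have "(\<lambda>x. a + x) \<in> m \<rightarrow>\<^sub>M m" unfolding measurable_cong_sets[OF sets sets] .
      from integral_distr[OF this \<gamma>m] have "(\<integral>x. \<gamma> x \<partial>m) = (\<integral>x. \<gamma> (a + x) \<partial>m)" by (simp add: inv)
      also have "\<dots> = \<gamma> a * (\<integral>x. \<gamma> x \<partial>m)" using \<gamma> by (simp add: group_character_def)
      finally show ?thesis using a by simp
    qed
  next
    show "(\<lambda>x. 1) \<in> Collect group_character" using group_character_one by simp
  next
    fix f :: "'g \<Rightarrow> complex" assume f: "integrable m f"
      and coeff: "\<And>\<gamma>. \<gamma> \<in> Collect group_character \<Longrightarrow> (\<integral>x. f x * cnj (\<gamma> x) \<partial>m) = 0"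
    show "AE x in m. f x = 0"
    proof (rule group_fourier_coefficients_determine[OF G m f])
      fix \<gamma> :: "'g \<Rightarrow> complex" assume "group_character \<gamma>"
      from coeff[of "\<lambda>x. cnj (\<gamma> x)"] group_character_cnj[OF this] show "(\<integral>x. f x * \<gamma> x \<partial>m) = 0" by simp
    qed
  qed
qed

lemma extends_exp_unique:
  fixes \<beta> :: "real \<Rightarrow> 'g::{topological_ab_group_add, t2_space}"
  assumes G: "dirichlet_group \<beta>" and h: "extends_exp \<beta> x h" "extends_exp \<beta> x h'"
  shows "h = h'"
proof -
  have "closed {g. h g = h' g}"
    using h by (intro closed_Collect_eq) (auto simp: extends_exp_def group_character_def)
  moreover have "range \<beta> \<subseteq> {g. h g = h' g}" using h by (auto simp: extends_exp_def)
  ultimately have "closure (range \<beta>) \<subseteq> {g. h g = h' g}" by (intro closure_minimal)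
  then show ?thesis using G by (auto simp: dirichlet_group_def)
qed

lemma extends_exp_exp_char:
  fixes \<beta> :: "real \<Rightarrow> 'g::{topological_ab_group_add, t2_space}"
  assumes "lambda_dirichlet_group lam \<beta>"
  shows "extends_exp \<beta> (lam n) (exp_char \<beta> (lam n))"
proof -
  have G: "dirichlet_group \<beta>" using assms by (simp add: lambda_dirichlet_group_def)
  obtain h where h: "extends_exp \<beta> (lam n) h" using assms by (auto simp: lambda_dirichlet_group_def)
  then show ?thesis unfolding exp_char_def
    by (rule theI[where P = "extends_exp \<beta> (lam n)"]) (rule extends_exp_unique[OF G _ h])
qed

text \<open>For \<open>s \<noteq> 0\<close> the value at \<open>\<beta> (\<pi> / s)\<close> is \<open>-1\<close>.\<close>

lemma extends_exp_eq_one_iff: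
  fixes \<beta> :: "real \<Rightarrow> 'g::{topological_ab_group_add, t2_space}"
  assumes G: "dirichlet_group \<beta>" and h: "extends_exp \<beta> s h"
  shows "(\<forall>x. h x = 1) \<longleftrightarrow> s = 0"
proof
  assume one: "\<forall>x. h x = 1"
  show "s = 0"
  proof (rule ccontr)
    assume s: "s \<noteq> 0"
    have "h (\<beta> (pi / s)) = exp (- \<i> * of_real s * of_real (pi / s))" using h by (simp add: extends_exp_def)
    also have "\<dots> = exp (- (\<i> * pi))" using s by simp
    also have "\<dots> = -1" by (simp add: exp_minus)
    finally show False using one by simp
  qed
next
  assume "s = 0"
  then have "extends_exp \<beta> s (\<lambda>x. 1)" by (simp add: extends_exp_def group_character_one)
  from extends_exp_unique[OF G h this] show "\<forall>x. h x = 1" by simp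
qed

lemma extends_exp_monomial:
  fixes \<beta> :: "real \<Rightarrow> 'g::{topological_ab_group_add, t2_space}" and m :: "'g measure"
  assumes G: "dirichlet_group \<beta>" and m: "normalized_haar m"
    and h: "\<And>n. extends_exp \<beta> (lam n) (h n)" and k: "k \<in> multi_indices \<infinity>"
  shows "extends_exp \<beta> (\<Sum>n | k n \<noteq> 0. of_int (k n) * lam n) (\<lambda>x. monomial k (\<lambda>n. h n x))"
proof -
  interpret character_system m "Collect group_character" by (rule character_system_group[OF G m])
  have "(\<lambda>x. monomial k (\<lambda>n. h n x)) \<in> Collect group_character"
    by (rule monomial_char[OF _ k]) (use h in \<open>simp add: extends_exp_def\<close>)
  moreover have "monomial k (\<lambda>n. h n (\<beta> t)) = exp (- \<i> * of_real (\<Sum>n | k n \<noteq> 0. of_int (k n) * lam n) * of_real t)" for t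
  proof -
    have fin: "finite {n. k n \<noteq> 0}" using k by (simp add: multi_indices_def)
    have "monomial k (\<lambda>n. h n (\<beta> t)) = (\<Prod>n | k n \<noteq> 0. exp (of_int (k n) * (- \<i> * of_real (lam n) * of_real t)))"
      unfolding monomial_def
      by (intro prod.cong refl) (use h in \<open>simp add: extends_exp_def exp_power_int\<close>)
    also have "\<dots> = exp (\<Sum>n | k n \<noteq> 0. of_int (k n) * (- \<i> * of_real (lam n) * of_real t))"
      by (rule exp_sum[OF fin, symmetric])
    also have "(\<Sum>n | k n \<noteq> 0. of_int (k n) * (- \<i> * of_real (lam n) * of_real t))
       = - \<i> * of_real (\<Sum>n | k n \<noteq> 0. of_int (k n) * lam n) * of_real t"
      by (simp add: sum_distrib_left sum_distrib_right mult_ac)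
    finally show ?thesis .
  qed
  ultimately show ?thesis by (simp add: extends_exp_def)
qed

section \<open>Hardy spaces of Dirichlet series and of the torus\<close>

text \<open>For a matrix with integer entries the floor only changes the type.\<close>

definition row_index :: "(nat \<Rightarrow> nat \<Rightarrow> rat) \<Rightarrow> nat \<Rightarrow> nat \<Rightarrow> int" where
  "row_index R n j = \<lfloor>R n j\<rfloor>"

lemma integer_type_row_index:
  assumes "integer_type_decomposition N b lam R"
  shows "R n j = of_int (row_index R n j)" "row_index R n \<in> multi_indices N"
    "row_index R n \<in> bohr_rows R"
    "lam n = (\<Sum>j | row_index R n j \<noteq> 0. of_int (row_index R n j) * b j)"
proof -
  have bm: "bohr_matrix N b lam R" and int: "\<And>n j. R n j \<in> \<int>"
    using assms by (auto simp: integer_type_decomposition_def)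
  show R: "R n j = of_int (row_index R n j)" for n j
    using int[of n j] by (auto simp: row_index_def elim: Ints_cases)
  have nz: "{j. R n j \<noteq> 0} = {j. row_index R n j \<noteq> 0}" by (simp add: R)
  show "row_index R n \<in> multi_indices N"
    using bm unfolding bohr_matrix_def nz[symmetric] multi_indices_def by (simp add: nz[symmetric])
  show "row_index R n \<in> bohr_rows R" by (auto simp: bohr_rows_def R)
  have "lam n = (\<Sum>j | R n j \<noteq> 0. of_rat (R n j) * b j)" using bm by (simp add: bohr_matrix_def)
  then show "lam n = (\<Sum>j | row_index R n j \<noteq> 0. of_int (row_index R n j) * b j)"
    by (simp add: nz) (simp add: R)
qed

lemma bohr_rows_eq:
  assumes "integer_type_decomposition N b lam R"
  shows "bohr_rows R = range (row_index R)"
proof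
  show "bohr_rows R \<subseteq> range (row_index R)"
  proof
    fix \<alpha> assume "\<alpha> \<in> bohr_rows R"
    then obtain n where "\<forall>j. R n j = of_int (\<alpha> j)" by (auto simp: bohr_rows_def)
    then have "\<alpha> = row_index R n" by (auto simp: row_index_def)
    then show "\<alpha> \<in> range (row_index R)" by simp
  qed
  show "range (row_index R) \<subseteq> bohr_rows R" using integer_type_row_index(3)[OF assms] by auto
qed

lemma torus_coeff_eq:
  assumes "\<alpha> \<in> multi_indices N"
  shows "torus_coeff N F \<alpha> = group_coeff (torus_measure N) F (monomial \<alpha>)"
  unfolding torus_coeff_def group_coeff_def
proof (rule Bochner_Integration.integral_cong[OF refl])
  fix w assume w: "w \<in> space (torus_measure N)"
  have "monomial (\<lambda>j. - \<alpha> j) w = cnj (monomial \<alpha> w)"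
    by (rule monomial_uminus[OF assms]) (rule norm_torus[OF w])
  then show "rep F w * monomial (\<lambda>j. - \<alpha> j) w = rep F w * cnj (monomial \<alpha> w)" by simp
qed

lemma character_sequence_torus:
  assumes "\<And>n. \<alpha> n \<in> multi_indices N"
  shows "character_sequence (torus_measure N) (torus_chars N) (\<lambda>n. monomial (\<alpha> n))"
  by (intro character_sequence.intro character_system_torus character_sequence_axioms.intro
      monomial_in_torus_chars assms)

lemma torus_Hardy_eq_spectral_Hardy:
  assumes R: "integer_type_decomposition N b lam R"
  shows "torus_Hardy p N R = spectral_Hardy p (torus_measure N) (torus_chars N) (\<lambda>n. monomial (row_index R n))"
proof -
  have "(\<forall>\<alpha>\<in>multi_indices N. torus_coeff N F \<alpha> \<noteq> 0 \<longrightarrow> \<alpha> \<in> bohr_rows R) \<longleftrightarrow>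
    (\<forall>\<gamma>\<in>torus_chars N. group_coeff (torus_measure N) F \<gamma> \<noteq> 0 \<longrightarrow>
       (\<exists>n. \<forall>w\<in>space (torus_measure N). \<gamma> w = monomial (row_index R n) w))" (is "?L \<longleftrightarrow> ?R") for F
  proof
    assume L: ?L
    show ?R
    proof (intro ballI impI)
      fix \<gamma> assume "\<gamma> \<in> torus_chars N" and nz: "group_coeff (torus_measure N) F \<gamma> \<noteq> 0"
      then obtain \<alpha> where \<alpha>: "\<alpha> \<in> multi_indices N" "\<forall>w\<in>space (torus_measure N). \<gamma> w = monomial \<alpha> w"
        by (auto simp: torus_chars_def)
      have "group_coeff (torus_measure N) F \<gamma> = group_coeff (torus_measure N) F (monomial \<alpha>)"
        unfolding group_coeff_def by (rule Bochner_Integration.integral_cong) (use \<alpha> in auto)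
      then have "torus_coeff N F \<alpha> \<noteq> 0" using nz by (simp add: torus_coeff_eq[OF \<alpha>(1)])
      then have "\<alpha> \<in> range (row_index R)" using L \<alpha>(1) bohr_rows_eq[OF R] by blast
      then show "\<exists>n. \<forall>w\<in>space (torus_measure N). \<gamma> w = monomial (row_index R n) w" using \<alpha>(2) by auto
    qed
  next
    assume R': ?R
    show ?L
    proof (intro ballI impI)
      fix \<alpha> assume \<alpha>: "\<alpha> \<in> multi_indices N" and nz: "torus_coeff N F \<alpha> \<noteq> 0"
      then obtain n where "\<forall>w\<in>space (torus_measure N). monomial \<alpha> w = monomial (row_index R n) w"
        using R' monomial_in_torus_chars[OF \<alpha>] torus_coeff_eq[OF \<alpha>] by metis
      then have "\<alpha> = row_index R n" by (rule monomial_inject[OF \<alpha> integer_type_row_index(2)[OF R]])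
      then show "\<alpha> \<in> bohr_rows R" using integer_type_row_index(3)[OF R] by simp
    qed
  qed
  then show ?thesis by (simp add: torus_Hardy_def spectral_Hardy_def)
qed

text \<open>Both sides say that \<open>\<Sum> k\<^sub>n \<lambda>\<^sub>n = 0\<close>: on the group because a character is determined by its
  values on the dense one-parameter subgroup, on the torus because the basis is rationally independent.\<close>

lemma same_relations:
  fixes \<beta> :: "real \<Rightarrow> 'g::{topological_ab_group_add, t2_space}" and m :: "'g measure"
  assumes R: "integer_type_decomposition N b lam R"
    and G: "lambda_dirichlet_group lam \<beta>" and m: "normalized_haar m"
    and k: "k \<in> multi_indices \<infinity>"
  shows "(\<forall>x\<in>space m. monomial k (\<lambda>n. exp_char \<beta> (lam n) x) = 1) \<longleftrightarrow>
    (\<forall>w\<in>space (torus_measure N). monomial k (\<lambda>n. monomial (row_index R n) w) = 1)"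
proof -
  have G': "dirichlet_group \<beta>" using G by (simp add: lambda_dirichlet_group_def)
  have space: "space m = UNIV" using m sets_eq_imp_space_eq[of m borel] by (simp add: normalized_haar_def)
  define \<alpha> where "\<alpha> = combine_indices k (row_index R)"
  have \<alpha>: "\<alpha> \<in> multi_indices N" unfolding \<alpha>_def by (rule combine_indices_mem[OF k integer_type_row_index(2)[OF R]])
  obtain J where J: "finite J" "J \<subseteq> indices N" "\<forall>n. k n \<noteq> 0 \<longrightarrow> {j. row_index R n j \<noteq> 0} \<subseteq> J" "{j. \<alpha> j \<noteq> 0} \<subseteq> J"
    unfolding \<alpha>_def using combine_indices_support[where \<alpha> = "row_index R", OF k integer_type_row_index(2)[OF R]] by blast
  have "(\<forall>x\<in>space m. monomial k (\<lambda>n. exp_char \<beta> (lam n) x) = 1) \<longleftrightarrow> (\<Sum>n | k n \<noteq> 0. of_int (k n) * lam n) = 0"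
    unfolding space
    using extends_exp_eq_one_iff[OF G' extends_exp_monomial[OF G' m extends_exp_exp_char[OF G] k]] by simp
  also have "(\<Sum>n | k n \<noteq> 0. of_int (k n) * lam n) = (\<Sum>n | k n \<noteq> 0. \<Sum>j\<in>J. of_int (k n) * (of_int (row_index R n j) * b j))"
  proof (rule sum.cong[OF refl])
    fix n assume "n \<in> {n. k n \<noteq> 0}"
    then have sub: "{j. row_index R n j \<noteq> 0} \<subseteq> J" using J(3) by auto
    have "lam n = (\<Sum>j\<in>J. of_int (row_index R n j) * b j)"
      unfolding integer_type_row_index(4)[OF R, of n] by (rule sum.mono_neutral_left[OF J(1) sub]) auto
    then show "of_int (k n) * lam n = (\<Sum>j\<in>J. of_int (k n) * (of_int (row_index R n j) * b j))"
      by (simp add: sum_distrib_left)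
  qed
  also have "\<dots> = (\<Sum>j\<in>J. \<Sum>n | k n \<noteq> 0. of_int (k n) * (of_int (row_index R n j) * b j))" by (rule sum.swap)
  also have "\<dots> = (\<Sum>j\<in>J. of_int (\<alpha> j) * b j)"
    unfolding \<alpha>_def combine_indices_def by (simp add: sum_distrib_right mult.assoc)
  also have "\<dots> = (\<Sum>j | \<alpha> j \<noteq> 0. of_int (\<alpha> j) * b j)"
    by (rule sum.mono_neutral_right[OF J(1,4)]) auto
  also have "\<dots> = 0 \<longleftrightarrow> \<alpha> = (\<lambda>j. 0)"
    using R by (intro rational_independence_integer[OF _ _ \<alpha>]) (auto simp: integer_type_decomposition_def frequency_basis_def)
  also have "\<dots> \<longleftrightarrow> (\<forall>w\<in>space (torus_measure N). monomial \<alpha> w = 1)"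
    by (rule monomial_eq_one_iff[OF \<alpha>, symmetric])
  also have "\<dots> \<longleftrightarrow> (\<forall>w\<in>space (torus_measure N). monomial k (\<lambda>n. monomial (row_index R n) w) = 1)"
  proof (rule ball_cong[OF refl])
    fix w assume w: "w \<in> space (torus_measure N)"
    have nz: "w j \<noteq> 0" if "j \<in> indices N" for j using norm_torus[OF w that] by auto
    have "monomial k (\<lambda>n. monomial (row_index R n) w) = monomial \<alpha> w"
      unfolding \<alpha>_def by (rule monomial_of_monomials[OF k integer_type_row_index(2)[OF R]]) (rule nz)
    then show "(monomial \<alpha> w = 1) = (monomial k (\<lambda>n. monomial (row_index R n) w) = 1)" by simp
  qed
  finally show ?thesis .
qed

theorem theorem3p31:
  fixes p :: ennreal
    and lam :: "nat \<Rightarrow> real"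
    and N :: enat
    and b :: "nat \<Rightarrow> real"
    and R :: "nat \<Rightarrow> nat \<Rightarrow> rat"
    and \<beta> :: "real \<Rightarrow> 'g::{topological_ab_group_add, t2_space}"
    and m :: "'g measure"
  assumes "1 \<le> p"
    and "frequency lam"
    and "integer_type_decomposition N b lam R"
    and "lambda_dirichlet_group lam \<beta>"
    and "normalized_haar m"
  shows "\<exists>!\<psi>. \<psi> \<in> extensional (series_Hardy p lam \<beta> m) \<and>
      onto_isometry (series_Hardy p lam \<beta> m) (series_norm p lam \<beta> m) p (torus_measure N)
        (torus_Hardy p N R) \<psi> \<and>
      (\<forall>D \<in> series_Hardy p lam \<beta> m. \<forall>\<alpha> \<in> bohr_rows R. \<forall>n.
         lam n = (\<Sum>j | \<alpha> j \<noteq> 0. of_int (\<alpha> j) * b j) \<longrightarrow> torus_coeff N (\<psi> D) \<alpha> = D n)"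
proof -
  note p = assms(1) and R = assms(3) and G = assms(4) and m = assms(5)
  have G': "dirichlet_group \<beta>" using G by (simp add: lambda_dirichlet_group_def)
  have space: "space m = UNIV" using m sets_eq_imp_space_eq[of m borel] by (simp add: normalized_haar_def)
  define h1 where "h1 n = exp_char \<beta> (lam n)" for n
  define h2 where "h2 n = monomial (row_index R n)" for n
  interpret A: character_sequence m "Collect group_character" h1
  proof (intro character_sequence.intro character_system_group[OF G' m] character_sequence_axioms.intro)
    show "h1 n \<in> Collect group_character" for n
      using extends_exp_exp_char[OF G, of n] by (simp add: h1_def extends_exp_def)
  qed
  interpret B: character_sequence "torus_measure N" "torus_chars N" h2
    unfolding h2_def by (rule character_sequence_torus[OF integer_type_row_index(2)[OF R]])
  define HA where "HA = spectral_Hardy p m (Collect group_character) h1"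
  define HB where "HB = spectral_Hardy p (torus_measure N) (torus_chars N) h2"
  have HA: "group_Hardy p lam \<beta> m = HA"
    by (auto simp: group_Hardy_def HA_def spectral_Hardy_def h1_def space fun_eq_iff)
  have HB: "torus_Hardy p N R = HB"
    unfolding HB_def h2_def by (rule torus_Hardy_eq_spectral_Hardy[OF R])
  have rel: "(\<forall>x\<in>space m. monomial k (\<lambda>n. h1 n x) = 1) \<longleftrightarrow> (\<forall>x\<in>space (torus_measure N). monomial k (\<lambda>n. h2 n x) = 1)"
    if "k \<in> multi_indices \<infinity>" for k
    unfolding h1_def h2_def by (rule same_relations[OF R G m that])
  let ?cA = "\<lambda>F n. group_coeff m F (h1 n)" and ?cB = "\<lambda>F n. group_coeff (torus_measure N) F (h2 n)"
  define S where "S = series_Hardy p lam \<beta> m"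
  have S: "D \<in> S \<longleftrightarrow> (\<exists>F\<in>HA. ?cA F = D)" for D
    unfolding S_def series_Hardy_def has_group_function_def HA by (auto simp: h1_def fun_eq_iff)
  have uniqueA: "F = G" if "F \<in> HA" "G \<in> HA" "?cA F = ?cA G" for F G
    by (rule A.spectral_Hardy_eqI[OF p that(1,2)[unfolded HA_def] fun_cong[OF that(3)]])
  have uniqueB: "F = G" if "F \<in> HB" "G \<in> HB" "?cB F = ?cB G" for F G
    by (rule B.spectral_Hardy_eqI[OF p that(1,2)[unfolded HB_def] fun_cong[OF that(3)]])
  have AB: "\<exists>G\<in>HB. ?cB G = ?cA F \<and> Lp_norm p (torus_measure N) G = Lp_norm p m F" if "F \<in> HA" for F
    unfolding HB_def
    by (rule spectral_Hardy_transfer[OF A.character_sequence_axioms B.character_sequence_axioms rel p that[unfolded HA_def]])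
  have BA: "\<exists>G\<in>HA. ?cA G = ?cB F" if "F \<in> HB" for F
    using spectral_Hardy_transfer[OF B.character_sequence_axioms A.character_sequence_axioms rel[symmetric] p that[unfolded HB_def]]
    unfolding HA_def by blast
  have norm: "series_norm p lam \<beta> m D = Lp_norm p m F" if "F \<in> HA" "?cA F = D" for F D
  proof -
    have "(THE f. f \<in> group_Hardy p lam \<beta> m \<and> has_group_function lam \<beta> m D f) = F"
    proof (rule the_equality)
      show "F \<in> group_Hardy p lam \<beta> m \<and> has_group_function lam \<beta> m D F"
        using that by (auto simp: HA has_group_function_def h1_def)
      fix f assume f: "f \<in> group_Hardy p lam \<beta> m \<and> has_group_function lam \<beta> m D f"
      then have "?cA f = D" by (auto simp: has_group_function_def h1_def)
      then show "f = F" using uniqueA[of f F] f that by (simp add: HA)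
    qed
    then show ?thesis by (simp add: series_norm_def)
  qed
  have "\<exists>G\<in>HB. ?cB G = D \<and> Lp_norm p (torus_measure N) G = series_norm p lam \<beta> m D" if D: "D \<in> S" for D
  proof -
    obtain F where F: "F \<in> HA" "?cA F = D" using D S by blast
    show ?thesis using AB[OF F(1)] unfolding norm[OF F] F(2) .
  qed
  then obtain \<psi>0 where \<psi>0: "\<And>D. D \<in> S \<Longrightarrow> \<psi>0 D \<in> HB" "\<And>D. D \<in> S \<Longrightarrow> ?cB (\<psi>0 D) = D"
    "\<And>D. D \<in> S \<Longrightarrow> Lp_norm p (torus_measure N) (\<psi>0 D) = series_norm p lam \<beta> m D"
    by metis
  define \<psi> where "\<psi> = restrict \<psi>0 S"
  have \<psi>: "\<psi> D \<in> HB" "?cB (\<psi> D) = D" "Lp_norm p (torus_measure N) (\<psi> D) = series_norm p lam \<beta> m D" if "D \<in> S" for D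
    using \<psi>0[OF that] that by (simp_all add: \<psi>_def)
  \<comment> \<open>Linearity, surjectivity and uniqueness of \<open>\<psi>\<close> reduce to comparing coefficients.\<close>
  have \<psi>_eqI: "\<psi> D = F" if "D \<in> S" "F \<in> HB" "?cB F = D" for D F
    by (rule uniqueB[OF \<psi>(1)[OF that(1)] that(2)]) (simp only: \<psi>(2)[OF that(1)] that(3))
  have Sadd: "(\<lambda>n. D n + E n) \<in> S" if DE: "D \<in> S" "E \<in> S" for D E
  proof -
    obtain F G where FG: "F \<in> HA" "?cA F = D" "G \<in> HA" "?cA G = E" using DE S by blast
    have L: "F \<in> Lp p m" "G \<in> Lp p m" using FG by (auto simp: HA_def spectral_Hardy_def)
    have "Lp_add m F G \<in> HA" using A.spectral_Hardy_add[OF p] FG by (simp add: HA_def)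
    moreover have "?cA (Lp_add m F G) = (\<lambda>n. D n + E n)"
      using A.Lp_add_coeff(2)[OF p L A.sequence_char] FG by auto
    ultimately show ?thesis using S by blast
  qed
  have Sscale: "(\<lambda>n. c * D n) \<in> S" if D: "D \<in> S" for c D
  proof -
    obtain F where F: "F \<in> HA" "?cA F = D" using D S by blast
    have L: "F \<in> Lp p m" using F by (auto simp: HA_def spectral_Hardy_def)
    have "Lp_scale m c F \<in> HA" using A.spectral_Hardy_scale F by (simp add: HA_def)
    moreover have "?cA (Lp_scale m c F) = (\<lambda>n. c * D n)"
      using A.Lp_scale_coeff(2)[OF L A.sequence_char] F by auto
    ultimately show ?thesis using S by blast
  qed
  have iso: "onto_isometry S (series_norm p lam \<beta> m) p (torus_measure N) HB \<psi>"
    unfolding onto_isometry_def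
  proof (intro conjI ballI allI)
    show "bij_betw \<psi> S HB"
    proof (rule bij_betw_imageI)
      show "inj_on \<psi> S" by (rule inj_onI) (metis \<psi>(2))
      show "\<psi> ` S = HB"
      proof
        show "\<psi> ` S \<subseteq> HB" using \<psi>(1) by auto
        show "HB \<subseteq> \<psi> ` S"
        proof
          fix F assume F: "F \<in> HB"
          then have "?cB F \<in> S" using BA S by blast
          from \<psi>_eqI[OF this F refl] this show "F \<in> \<psi> ` S" by force
        qed
      qed
    qed
    fix D assume D: "D \<in> S"
    have L: "\<psi> D \<in> Lp p (torus_measure N)" using \<psi>(1)[OF D] by (simp add: HB_def spectral_Hardy_def)
    show "Lp_norm p (torus_measure N) (\<psi> D) = series_norm p lam \<beta> m D" by (rule \<psi>(3)[OF D])
    show "\<psi> (\<lambda>n. c * D n) = Lp_scale (torus_measure N) c (\<psi> D)" for c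
    proof (rule \<psi>_eqI[OF Sscale[OF D]])
      show "Lp_scale (torus_measure N) c (\<psi> D) \<in> HB"
        using B.spectral_Hardy_scale \<psi>(1)[OF D] by (simp add: HB_def)
      show "?cB (Lp_scale (torus_measure N) c (\<psi> D)) = (\<lambda>n. c * D n)"
        using B.Lp_scale_coeff(2)[OF L B.sequence_char] fun_cong[OF \<psi>(2)[OF D]] by auto
    qed
    fix E assume E: "E \<in> S"
    have L': "\<psi> E \<in> Lp p (torus_measure N)" using \<psi>(1)[OF E] by (simp add: HB_def spectral_Hardy_def)
    show "\<psi> (\<lambda>n. D n + E n) = Lp_add (torus_measure N) (\<psi> D) (\<psi> E)"
    proof (rule \<psi>_eqI[OF Sadd[OF D E]])
      show "Lp_add (torus_measure N) (\<psi> D) (\<psi> E) \<in> HB"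
        using B.spectral_Hardy_add[OF p] \<psi>(1)[OF D] \<psi>(1)[OF E] by (simp add: HB_def)
      show "?cB (Lp_add (torus_measure N) (\<psi> D) (\<psi> E)) = (\<lambda>n. D n + E n)"
        using B.Lp_add_coeff(2)[OF p L L' B.sequence_char] fun_cong[OF \<psi>(2)[OF D]] fun_cong[OF \<psi>(2)[OF E]] by auto
    qed
  qed
  have cB: "torus_coeff N F (row_index R n) = ?cB F n" for F n
    unfolding h2_def by (rule torus_coeff_eq[OF integer_type_row_index(2)[OF R]])
  have inj: "inj lam" using assms(2) by (auto simp: frequency_def intro: strict_mono_imp_inj_on)
  have coeffs: "torus_coeff N (\<psi> D) \<alpha> = D n"
    if D: "D \<in> S" and row: "\<alpha> \<in> bohr_rows R" and lam: "lam n = (\<Sum>j | \<alpha> j \<noteq> 0. of_int (\<alpha> j) * b j)" for D \<alpha> n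
  proof -
    obtain n' where \<alpha>: "\<alpha> = row_index R n'" using row bohr_rows_eq[OF R] by auto
    have "lam n' = lam n" using integer_type_row_index(4)[OF R, of n'] lam \<alpha> by simp
    then have "n' = n" by (rule injD[OF inj])
    then show ?thesis using \<alpha> cB fun_cong[OF \<psi>(2)[OF D]] by simp
  qed
  show ?thesis
    unfolding HB S_def[symmetric]
  proof (rule ex1I[of _ \<psi>])
    show "\<psi> \<in> extensional S \<and> onto_isometry S (series_norm p lam \<beta> m) p (torus_measure N) HB \<psi> \<and>
      (\<forall>D\<in>S. \<forall>\<alpha>\<in>bohr_rows R. \<forall>n. lam n = (\<Sum>j | \<alpha> j \<noteq> 0. of_int (\<alpha> j) * b j) \<longrightarrow> torus_coeff N (\<psi> D) \<alpha> = D n)"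
      using iso coeffs by (auto simp: \<psi>_def)
    fix \<psi>' assume \<psi>': "\<psi>' \<in> extensional S \<and> onto_isometry S (series_norm p lam \<beta> m) p (torus_measure N) HB \<psi>' \<and>
      (\<forall>D\<in>S. \<forall>\<alpha>\<in>bohr_rows R. \<forall>n. lam n = (\<Sum>j | \<alpha> j \<noteq> 0. of_int (\<alpha> j) * b j) \<longrightarrow> torus_coeff N (\<psi>' D) \<alpha> = D n)"
    show "\<psi>' = \<psi>"
    proof (rule extensionalityI[of _ S])
      show "\<psi>' \<in> extensional S" using \<psi>' by blast
      show "\<psi> \<in> extensional S" by (simp add: \<psi>_def)
      fix D assume D: "D \<in> S"
      have "\<psi>' D \<in> HB" using \<psi>' D by (auto simp: onto_isometry_def bij_betw_def)
      moreover have "?cB (\<psi>' D) = D"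
      proof
        fix n
        have "torus_coeff N (\<psi>' D) (row_index R n) = D n"
          using \<psi>' D integer_type_row_index(3)[OF R, of n] integer_type_row_index(4)[OF R, of n] by blast
        then show "?cB (\<psi>' D) n = D n" by (simp only: cB)
      qed
      ultimately show "\<psi>' D = \<psi> D" using \<psi>_eqI[OF D] by simp
    qed
  qed
qed

end
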